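(* Let $p>2$ and $N\in\mathbb{N}$, let $k$, $a$, $A$, $\alpha$ be as in the context, let $\beta$ be any real number with $\alpha-1<\beta<2\alpha-1$, and let $Y_1$ be the corresponding weighted space. Then any solution $v\in Y_1\cap C^\infty(\overline{\mathbb{D}}\setminus\{0\})$ of the linearized $p$-Laplace equation $\operatorname{div}^\circ(A\nabla^\circ v)=0$ in $\mathbb{D}^*$ satisfies $v\in L^\infty(\mathbb{D})$ and $|x|\,\nabla v(x)\in L^\infty(\mathbb{D})$.
   Context: $\mathbb{D}=\{x\in\mathbb{R}^2:|x|<1\}$, $\mathbb{D}^*=\mathbb{D}\setminus\{0\}$; $(r,\theta)$ are polar coordinates, $dA=r\,dr\,d\theta$; subscripts $r,\theta$ denote derivatives. The function $f(r,\theta)=r^ka(\theta)$. Put $b=p/(p-2)$ and let $k=k(p,N)\ge 1$ be the larger root of $(2N-1)(b+1)k^2-2(N^2b+2N-1)k+N^2(1+b)=0$. Let $a\in C^\infty(\mathbb{R})$ be a $2\pi/N$-periodic, not identically zero solution of $a_{\theta\theta}+V(a,a_\theta)a=0$, where $$V(a,a_\theta)=\frac{\bigl((2p-3)k^2-(p-2)k\bigr)a_\theta^2+\bigl((p-1)k^2-(p-2)k\bigr)k^2a^2}{(p-1)a_\theta^2+k^2a^2}.$$ It is known that such an $a$ exists (unique given $a(0),a_\theta(0)$, e.g. $a(0)=1$, $a_\theta(0)=0$) and that $f=r^ka(\theta)$ is $p$-harmonic in $\mathbb{R}^2$, i.e. $\operatorname{div}(|\nabla f|^{p-2}\nabla f)=0$.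 Moving frame: $\nabla^\circ v=(v_r,\tfrac1r v_\theta)$, and for a vector field $F=(F_1,F_2)$, $\operatorname{div}^\circ F=\frac1r\partial_r(rF_1)+\frac1r\partial_\theta F_2$. The matrix $$A(r,\theta)=r^{(p-2)(k-1)}(a_\theta^2+k^2a^2)^{\frac{p-4}{2}}\begin{pmatrix}a_\theta^2+(p-1)k^2a^2&(p-2)kaa_\theta\\(p-2)kaa_\theta&k^2a^2+(p-1)a_\theta^2\end{pmatrix}.$$ The equation $\operatorname{div}^\circ(A\nabla^\circ v)=0$ is the linearization $\frac{d}{d\varepsilon}\big|_{\varepsilon=0}\Delta_p(f+\varepsilon v)=0$ of the $p$-Laplace equation at $f$. Weighted space: $\alpha=(p-2)(k-1)/2$, and for $\alpha-1<\beta<2\alpha-1$, $$Y_1=\Bigl\{v\in W^{1,2}_{\mathrm{loc}}(\mathbb{D}^* ): v(r,\theta+\tfrac{2\pi}{N})=v(r,\theta),\ \int_{\mathbb{D}}|v|^2r^{2\beta}+|\nabla^\circ v|^2r^{2\alpha}\,dA<\infty\Bigr\}.$$ *)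

theory Defs
  imports "HOL-Analysis.Analysis"
begin

section \<open>Smooth functions\<close>

definition smooth_real :: "(real \<Rightarrow> real) \<Rightarrow> bool" where
  "smooth_real a \<longleftrightarrow> (\<forall>n \<theta>. ((deriv ^^ n) a) differentiable (at \<theta>))"

definition partial :: "'n \<Rightarrow> (real ^ 'n \<Rightarrow> real) \<Rightarrow> real ^ 'n \<Rightarrow> real" where
  "partial i v x = deriv (\<lambda>t. v (x + t *\<^sub>R axis i 1)) 0"

definition grad :: "(real ^ 'n \<Rightarrow> real) \<Rightarrow> real ^ 'n \<Rightarrow> real ^ 'n" where
  "grad v x = (\<chi> i. partial i v x)"

primrec iter_partial :: "'n list \<Rightarrow> (real ^ 'n \<Rightarrow> real) \<Rightarrow> real ^ 'n \<Rightarrow> real" where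
  "iter_partial [] v = v"
| "iter_partial (i # is) v = partial i (iter_partial is v)"

text \<open>On open \<open>U\<close> this is membership in \<open>C\<^sup>\<infinity>(U)\<close>: differentiability of all iterated
  partial derivatives implies their continuity.\<close>

definition smooth_on :: "(real ^ 'n) set \<Rightarrow> (real ^ 'n \<Rightarrow> real) \<Rightarrow> bool" where
  "smooth_on U v \<longleftrightarrow> (\<forall>is. \<forall>x\<in>U. iter_partial is v differentiable (at x))"

text \<open>For \<open>U\<close> open and \<open>U \<subseteq> S \<subseteq> closure U\<close> this is \<open>C\<^sup>\<infinity>(S)\<close>: smooth functions on \<open>U\<close> all of whose
  derivatives extend continuously to \<open>S\<close>. Elements are regarded as functions on \<open>U\<close>; the
  values of \<open>v\<close> outside \<open>U\<close> are immaterial.\<close>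

definition smooth_up_to :: "(real ^ 'n) set \<Rightarrow> (real ^ 'n) set \<Rightarrow> (real ^ 'n \<Rightarrow> real) set" where
  "smooth_up_to U S = {v. smooth_on U v \<and>
     (\<forall>is. \<exists>g. continuous_on S g \<and> (\<forall>x\<in>U. g x = iter_partial is v x))}"


section \<open>Lebesgue and Sobolev spaces\<close>

definition L_infinity :: "(real ^ 'n) set \<Rightarrow> (real ^ 'n \<Rightarrow> 'b::euclidean_space) set" where
  "L_infinity U = {f. f \<in> borel_measurable (lebesgue_on U) \<and>
     (\<exists>C::real. AE x in lebesgue_on U. norm (f x) \<le> C)}"

definition L2_loc :: "(real ^ 'n) set \<Rightarrow> (real ^ 'n \<Rightarrow> 'b::euclidean_space) set" where
  "L2_loc U = {f. f \<in> borel_measurable (lebesgue_on U) \<and>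
     (\<forall>K. compact K \<and> K \<subseteq> U \<longrightarrow> set_integrable lebesgue K (\<lambda>x. (norm (f x))\<^sup>2))}"

definition test_function :: "(real ^ 'n) set \<Rightarrow> (real ^ 'n \<Rightarrow> real) \<Rightarrow> bool" where
  "test_function U \<phi> \<longleftrightarrow> smooth_on UNIV \<phi> \<and>
     (\<exists>K. compact K \<and> K \<subseteq> U \<and> (\<forall>x. x \<notin> K \<longrightarrow> \<phi> x = 0))"

definition weak_gradient ::
    "(real ^ 'n) set \<Rightarrow> (real ^ 'n \<Rightarrow> real) \<Rightarrow> (real ^ 'n \<Rightarrow> real ^ 'n) \<Rightarrow> bool" where
  "weak_gradient U v G \<longleftrightarrow> (\<forall>\<phi> i. test_function U \<phi> \<longrightarrow>
     (LINT x:U|lebesgue. v x * partial i \<phi> x) = - (LINT x:U|lebesgue. G x $ i * \<phi> x))"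

text \<open>\<open>v\<close> is in \<open>W\<^sup>1\<^sup>,\<^sup>2\<^bsub>loc\<^esub>(U)\<close>, with (a representative of) its weak gradient \<open>G\<close>.\<close>

definition W12_loc ::
    "(real ^ 'n) set \<Rightarrow> (real ^ 'n \<Rightarrow> real) \<Rightarrow> (real ^ 'n \<Rightarrow> real ^ 'n) \<Rightarrow> bool" where
  "W12_loc U v G \<longleftrightarrow> v \<in> L2_loc U \<and> G \<in> L2_loc U \<and> weak_gradient U v G"


section \<open>The disc, polar coordinates and the moving frame\<close>

definition disc :: "(real ^ 2) set" where
  "disc = {x. norm x < 1}"

definition punctured_disc :: "(real ^ 2) set" where
  "punctured_disc = disc - {0}"

definition polar :: "real \<Rightarrow> real \<Rightarrow> real ^ 2" where
  "polar r \<theta> = vector [r * cos \<theta>, r * sin \<theta>]"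

text \<open>Components of the Cartesian vector \<open>y\<close> in the orthonormal frame \<open>(e\<^sub>r, e\<^sub>\<theta>)\<close> at \<open>x \<noteq> 0\<close>; applied
  to the (weak) gradient at \<open>x\<close> this gives \<open>(v\<^sub>r, v\<^sub>\<theta>/r)\<close>.\<close>

definition frame_components :: "real ^ 2 \<Rightarrow> real ^ 2 \<Rightarrow> real ^ 2" where
  "frame_components x y =
     vector [y \<bullet> (x /\<^sub>R norm x), y \<bullet> (vector [- (x $ 2), x $ 1] /\<^sub>R norm x)]"

text \<open>Frame operators acting on functions of \<open>(r, \<theta>)\<close>.\<close>

definition frame_grad :: "(real \<Rightarrow> real \<Rightarrow> real) \<Rightarrow> real \<Rightarrow> real \<Rightarrow> real ^ 2" where
  "frame_grad w r \<theta> = vector [deriv (\<lambda>s. w s \<theta>) r, (1 / r) * deriv (\<lambda>\<tau>. w r \<tau>) \<theta>]"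

definition frame_div :: "(real \<Rightarrow> real \<Rightarrow> real ^ 2) \<Rightarrow> real \<Rightarrow> real \<Rightarrow> real" where
  "frame_div F r \<theta> =
     (1 / r) * deriv (\<lambda>s. s * (F s \<theta> $ 1)) r + (1 / r) * deriv (\<lambda>\<tau>. F r \<tau> $ 2) \<theta>"


section \<open>The quasi-radial \<open>p\<close>-harmonic function and the linearized equation\<close>

definition k_exponent :: "real \<Rightarrow> nat \<Rightarrow> real" where
  "k_exponent p N = (let b = p / (p - 2); n = real N in
     Max {k. (2 * n - 1) * (b + 1) * k\<^sup>2 - 2 * (n\<^sup>2 * b + 2 * n - 1) * k + n\<^sup>2 * (1 + b) = 0})"

definition V :: "real \<Rightarrow> real \<Rightarrow> real \<Rightarrow> real \<Rightarrow> real" where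
  "V p k s s' =
     (((2 * p - 3) * k\<^sup>2 - (p - 2) * k) * s'\<^sup>2 + ((p - 1) * k\<^sup>2 - (p - 2) * k) * k\<^sup>2 * s\<^sup>2) /
     ((p - 1) * s'\<^sup>2 + k\<^sup>2 * s\<^sup>2)"

text \<open>\<open>V\<close> is bounded, so a solution with \<open>a = a\<^sub>\<theta> = 0\<close> at some point vanishes identically;
  hence the denominator of \<open>V\<close> is positive along every \<open>a\<close> as below.\<close>

definition angular_profile :: "real \<Rightarrow> nat \<Rightarrow> (real \<Rightarrow> real) \<Rightarrow> bool" where
  "angular_profile p N a \<longleftrightarrow>
     smooth_real a \<and>
     (\<forall>\<theta>. a (\<theta> + 2 * pi / real N) = a \<theta>) \<and>
     (\<exists>\<theta>. a \<theta> \<noteq> 0) \<and>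
     (\<forall>\<theta>. deriv (deriv a) \<theta> + V p (k_exponent p N) (a \<theta>) (deriv a \<theta>) * a \<theta> = 0)"

definition A_matrix :: "real \<Rightarrow> real \<Rightarrow> (real \<Rightarrow> real) \<Rightarrow> real \<Rightarrow> real \<Rightarrow> real ^ 2 ^ 2" where
  "A_matrix p k a r \<theta> = (let s = a \<theta>; s' = deriv a \<theta> in
     (r powr ((p - 2) * (k - 1)) * (s'\<^sup>2 + k\<^sup>2 * s\<^sup>2) powr ((p - 4) / 2)) *\<^sub>R
     vector [vector [s'\<^sup>2 + (p - 1) * k\<^sup>2 * s\<^sup>2, (p - 2) * k * s * s'],
             vector [(p - 2) * k * s * s', k\<^sup>2 * s\<^sup>2 + (p - 1) * s'\<^sup>2]])"

definition linearized_solution :: "real \<Rightarrow> real \<Rightarrow> (real \<Rightarrow> real) \<Rightarrow> (real ^ 2 \<Rightarrow> real) \<Rightarrow> bool" where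
  "linearized_solution p k a v \<longleftrightarrow> (\<forall>r \<theta>. 0 < r \<and> r < 1 \<longrightarrow>
     frame_div (\<lambda>s \<tau>. A_matrix p k a s \<tau> *v frame_grad (\<lambda>s \<tau>. v (polar s \<tau>)) s \<tau>) r \<theta> = 0)"

definition alpha_weight :: "real \<Rightarrow> real \<Rightarrow> real" where
  "alpha_weight p k = (p - 2) * (k - 1) / 2"

text \<open>Elements of \<open>Y\<^sub>1\<close> are only determined almost everywhere, hence the almost-everywhere form of
  the rotational periodicity.\<close>

definition Y1 :: "nat \<Rightarrow> real \<Rightarrow> real \<Rightarrow> (real ^ 2 \<Rightarrow> real) set" where
  "Y1 N \<alpha> \<beta> = {v. \<exists>G. W12_loc punctured_disc v G \<and>
     (AE x in lebesgue. \<forall>r \<theta>. 0 < r \<and> r < 1 \<and> x = polar r \<theta> \<longrightarrow>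
        v (polar r (\<theta> + 2 * pi / real N)) = v (polar r \<theta>)) \<and>
     (\<integral>\<^sup>+x\<in>disc. ennreal (\<bar>v x\<bar>\<^sup>2 * norm x powr (2 * \<beta>) +
        (norm (frame_components x (G x)))\<^sup>2 * norm x powr (2 * \<alpha>)) \<partial>lebesgue) < \<infinity>}"

end

theory Submission
  imports Defs
begin

text \<open>In the variables \<open>u(s, \<theta>) = v(e\<^sup>s cos \<theta>, e\<^sup>s sin \<theta>)\<close> the linearized equation is a uniformly elliptic
  equation on the half-cylinder \<open>s < 0\<close> without zeroth-order term, whose coefficients do not depend on
  \<open>s\<close>. It has the explicit positive solution \<open>e\<^bsup>-2\<alpha>s\<^esup>\<psi>(\<theta>)\<close> with
  \<open>\<psi> = ((a\<^sub>\<theta>\<^sup>2 + k\<^sup>2a\<^sup>2) / ((p-1)a\<^sub>\<theta>\<^sup>2 + c a\<^sup>2))\<^sup>\<alpha>\<close> and \<open>c = (p-1)k\<^sup>2 - (p-2)k\<close>.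

  A Caccioppoli inequality and the one-dimensional Sobolev inequality turn the finiteness of
  \<open>\<integral> |v|\<^sup>2 r\<^bsup>2\<beta>\<^esup> dA\<close> into \<open>|v| \<le> C r\<^bsup>-(\<beta>+1)\<^esup>\<close> on a sequence of circles shrinking to \<open>0\<close>. Since
  \<open>\<beta> + 1 < 2\<alpha>\<close>, the maximum principle applied to \<open>\<plusminus>u - \<epsilon>e\<^bsup>-2\<alpha>s\<^esup>\<psi>\<close> shows that \<open>v\<close> is bounded.
  Bernstein's method then bounds \<open>u\<^sub>s\<close> and, as \<open>u\<^sub>s\<close> solves the same equation, \<open>u\<^sub>s\<^sub>s\<close>; on each circle
  the equation now becomes an ordinary differential equation that bounds \<open>u\<^sub>\<theta>\<close>. Near \<open>r = 1\<close> all
  bounds come from the smoothness up to the boundary.\<close>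

section \<open>Calculus on the half-cylinder\<close>

text \<open>In logarithmic variables dA becomes e^{2s} ds d\<theta>, so the weight r^{2\<beta>}
  yields the rate \<beta> + 1. Applied to e^{-2\<alpha>s}\<psi>(\<theta>), the operator collapses to
  e^{-2\<alpha>s} times the derivative of b22 \<psi>' - 2 \<alpha> b12 \<psi>, so it suffices that
  this bracket vanishes. That first-order equation always has positive solutions; the delicate point
  is periodicity, i.e. that b12/b22 has mean zero, and the closed form of \<psi>, which involves
  only a and its derivative, provides it. One barrier with a known exponent then replaces an
  analysis of all exponents of separated solutions. The coefficients depend on \<theta>, so
  differentiation in \<theta> does not preserve the equation and Bernstein's argument is confined to
  s-derivatives; hence the \<theta>-derivative is recovered from the equation itself, at the price
  of a bound on the second s-derivative.\<close>

lemma second_derivative_test_max: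
  fixes g g1 :: "real \<Rightarrow> real"
  assumes d: "d > 0" and g: "\<And>x. \<bar>x\<bar> < d \<Longrightarrow> (g has_real_derivative g1 x) (at x)"
    and g1: "(g1 has_real_derivative g2) (at 0)"
    and max: "\<And>x. \<bar>x\<bar> < d \<Longrightarrow> g x \<le> g 0"
  shows "g1 0 = 0" "g2 \<le> 0"
proof -
  show z: "g1 0 = 0"
    by (rule DERIV_local_max[OF g[of 0] d]) (use d max in auto)
  show "g2 \<le> 0"
  proof (rule ccontr)
    assume "\<not> g2 \<le> 0"
    then obtain e where e: "e > 0" "\<And>h. 0 < h \<Longrightarrow> h < e \<Longrightarrow> g1 0 < g1 (0 + h)"
      using DERIV_pos_inc_right[OF g1] by (metis not_le)
    define h where "h = min d e / 2"
    have h: "0 < h" "h < d" "h < e" using d e by (auto simp: h_def)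
    obtain x where x: "0 < x" "x < h" "g h - g 0 = (h - 0) * g1 x"
      using MVT2[of 0 h g g1] h g by auto
    have "g1 x > 0" using e(2)[of x] x h z by auto
    then have "g h > g 0" using x h by (metis diff_0_right diff_gt_0_iff_gt mult_pos_pos)
    then show False using max[of h] h by auto
  qed
qed

section \<open>Bounds for continuous periodic functions of the angle\<close>

lemma periodic_representative:
  fixes f :: "real \<Rightarrow> 'a" and c :: real
  assumes "\<And>t. f (t + c) = f t" and "c > 0"
  obtains t' where "0 \<le> t'" "t' \<le> c" "f t = f t'"
proof -
  interpret periodic_fun_simple f c by standard (use assms in auto)
  define n where "n = \<lfloor>t / c\<rfloor>"
  have a: "of_int n \<le> t / c" "t / c < of_int n + 1" by (auto simp: n_def)
  have "f (t - of_int n * c) = f t" by (rule minus_of_int)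
  moreover have "of_int n * c \<le> t" using a(1) assms(2) by (simp add: field_simps)
  moreover have "t \<le> of_int n * c + c" using a(2) assms(2) by (simp add: field_simps)
  ultimately show ?thesis using that[of "t - of_int n * c"] by auto
qed

lemma periodic_bounded:
  fixes f :: "real \<Rightarrow> real"
  assumes "continuous_on UNIV f" "\<And>t. f (t + 2 * pi) = f t"
  obtains K where "K > 0" "\<And>t. \<bar>f t\<bar> \<le> K"
proof -
  have "compact (f ` {0..2*pi})"
    by (rule compact_continuous_image[OF continuous_on_subset[OF assms(1)]]) auto
  then obtain K where K: "K > 0" "\<And>t. t \<in> {0..2*pi} \<Longrightarrow> \<bar>f t\<bar> \<le> K"
    by (force dest!: compact_imp_bounded simp: bounded_pos)
  show ?thesis
  proof (rule that[OF K(1)])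
    show "\<bar>f t\<bar> \<le> K" for t
      by (rule periodic_representative[of f "2*pi" t, OF assms(2)]) (use K(2) in auto)
  qed
qed

lemma periodic_bounded_below:
  fixes f :: "real \<Rightarrow> real"
  assumes "continuous_on UNIV f" "\<And>t. f (t + 2 * pi) = f t" "\<And>t. f t > 0"
  obtains c where "c > 0" "\<And>t. c \<le> f t"
proof -
  have "continuous_on UNIV (\<lambda>t. inverse (f t))"
    using assms by (intro continuous_intros) (auto simp: less_imp_neq[THEN not_sym])
  then obtain K where K: "K > 0" "\<And>t. \<bar>inverse (f t)\<bar> \<le> K"
    using periodic_bounded[of "\<lambda>t. inverse (f t)"] assms(2) by metis
  show ?thesis
  proof (rule that[of "inverse K"])
    show "inverse K \<le> f t" for t
      using K(2)[of t] assms(3)[of t] K(1) by (simp add: abs_of_pos field_simps)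
  qed (use K in auto)
qed

text \<open>The partial derivatives are arguments of a relation about the total derivative, so
  product and chain rules carry explicit formulas instead of terms in \<open>deriv\<close>. Only
  \<open>s < 0\<close> is constrained, so \<open>f1\<close> and \<open>f2\<close> may be replaced by
  functions that agree with them there.\<close>

definition jet :: "(real \<Rightarrow> real \<Rightarrow> real) \<Rightarrow> (real \<Rightarrow> real \<Rightarrow> real) \<Rightarrow> (real \<Rightarrow> real \<Rightarrow> real) \<Rightarrow> bool" where
  "jet f f1 f2 \<longleftrightarrow> (\<forall>s<0. \<forall>t.
     ((\<lambda>z. f (fst z) (snd z)) has_derivative (\<lambda>z. f1 s t * fst z + f2 s t * snd z)) (at (s, t)))"

lemma jetD:
  "jet f f1 f2 \<Longrightarrow> s < 0 \<Longrightarrow>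
    ((\<lambda>z. f (fst z) (snd z)) has_derivative (\<lambda>z. f1 s t * fst z + f2 s t * snd z)) (at (s, t))"
  by (auto simp: jet_def)

lemma jet_add: "jet f f1 f2 \<Longrightarrow> jet g g1 g2 \<Longrightarrow>
    jet (\<lambda>s t. f s t + g s t) (\<lambda>s t. f1 s t + g1 s t) (\<lambda>s t. f2 s t + g2 s t)"
  unfolding jet_def
  by (auto intro!: derivative_eq_intros simp: algebra_simps fun_eq_iff)

lemma jet_mult: "jet f f1 f2 \<Longrightarrow> jet g g1 g2 \<Longrightarrow>
    jet (\<lambda>s t. f s t * g s t) (\<lambda>s t. f1 s t * g s t + f s t * g1 s t)
      (\<lambda>s t. f2 s t * g s t + f s t * g2 s t)"
  unfolding jet_def
  by (auto intro!: derivative_eq_intros simp: algebra_simps fun_eq_iff)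

lemma jet_const: "jet (\<lambda>s t. c) (\<lambda>s t. 0) (\<lambda>s t. 0)"
  unfolding jet_def by (auto intro!: derivative_eq_intros)

lemma jet_cmult: "jet f f1 f2 \<Longrightarrow>
    jet (\<lambda>s t. c * f s t) (\<lambda>s t. c * f1 s t) (\<lambda>s t. c * f2 s t)"
  using jet_mult[OF jet_const[of c]] by auto

lemma jet_axial:
  assumes "\<And>s. (g has_real_derivative g' s) (at s)"
  shows "jet (\<lambda>s t. g s) (\<lambda>s t. g' s) (\<lambda>s t. 0)"
  unfolding jet_def
proof (intro allI impI)
  fix s t :: real
  have "(g has_derivative (*) (g' s)) (at (fst (s,t)))"
    using assms[of s] by (simp add: has_field_derivative_def)
  from has_derivative_compose[OF has_derivative_fst[OF has_derivative_ident] this]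
  show "((\<lambda>z. g (fst z)) has_derivative (\<lambda>z. g' s * fst z + 0 * snd z)) (at (s, t))"
    by simp
qed

lemma jet_angular:
  assumes "\<And>s. (g has_real_derivative g' s) (at s)"
  shows "jet (\<lambda>s t. g t) (\<lambda>s t. 0) (\<lambda>s t. g' t)"
  unfolding jet_def
proof (intro allI impI)
  fix s t :: real
  have "(g has_derivative (*) (g' t)) (at (snd (s,t)))"
    using assms[of t] by (simp add: has_field_derivative_def)
  from has_derivative_compose[OF has_derivative_snd[OF has_derivative_ident] this]
  show "((\<lambda>z. g (snd z)) has_derivative (\<lambda>z. 0 * fst z + g' t * snd z)) (at (s, t))"
    by simp
qed

lemma jet_line:
  assumes "jet f f1 f2" "s + \<xi> * x < 0"
  shows "((\<lambda>x. f (s + \<xi> * x) (t + \<eta> * x)) has_real_derivative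
    \<xi> * f1 (s + \<xi> * x) (t + \<eta> * x) + \<eta> * f2 (s + \<xi> * x) (t + \<eta> * x)) (at x)"
proof -
  have "((\<lambda>x. (s + \<xi> * x, t + \<eta> * x)) has_derivative (\<lambda>h. (\<xi> * h, \<eta> * h))) (at x)"
    by (auto intro!: derivative_eq_intros)
  from has_derivative_compose[OF this jetD[OF assms(1,2)]]
  show ?thesis
    unfolding has_field_derivative_def fst_conv snd_conv
    by (rule has_derivative_eq_rhs) (auto simp: fun_eq_iff algebra_simps)
qed

lemma jet_partial1: "jet f f1 f2 \<Longrightarrow> s < 0 \<Longrightarrow> ((\<lambda>x. f x t) has_real_derivative f1 s t) (at s)"
  using jet_line[of f f1 f2 0 1 s t 0] by simp

lemma jet_partial2: "jet f f1 f2 \<Longrightarrow> s < 0 \<Longrightarrow> ((\<lambda>y. f s y) has_real_derivative f2 s t) (at t)"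
  using jet_line[of f f1 f2 s 0 t 0 1] by simp

lemma jet_continuous_on: "jet f f1 f2 \<Longrightarrow> continuous_on ({..<0} \<times> UNIV) (\<lambda>z. f (fst z) (snd z))"
  unfolding jet_def
  by (intro continuous_at_imp_continuous_on ballI) (auto dest!: has_derivative_continuous)

lemma jet_continuous_on': "jet f f1 f2 \<Longrightarrow> s < 0 \<Longrightarrow> continuous_on T (f s)"
  by (intro continuous_at_imp_continuous_on ballI) (metis DERIV_isCont jet_partial2)

lemma jet_cong:
  "jet f f1 f2 \<Longrightarrow> (\<And>s t. s < 0 \<Longrightarrow> f1 s t = g1 s t) \<Longrightarrow> (\<And>s t. s < 0 \<Longrightarrow> f2 s t = g2 s t) \<Longrightarrow>
    jet f g1 g2"
  by (simp add: jet_def)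

text \<open>One function \<open>f12\<close> serves as the t-derivative of \<open>f1\<close> and as
  the s-derivative of \<open>f2\<close>, which builds the symmetry of the Hessian into the
  predicate.\<close>

definition jet2 where
  "jet2 f f1 f2 f11 f12 f22 \<longleftrightarrow> jet f f1 f2 \<and> jet f1 f11 f12 \<and> jet f2 f12 f22"

lemma jet2_mult:
  assumes "jet2 f f1 f2 f11 f12 f22" "jet2 g g1 g2 g11 g12 g22"
  shows "jet2 (\<lambda>s t. f s t * g s t) (\<lambda>s t. f1 s t * g s t + f s t * g1 s t)
      (\<lambda>s t. f2 s t * g s t + f s t * g2 s t)
      (\<lambda>s t. f11 s t * g s t + 2 * (f1 s t * g1 s t) + f s t * g11 s t)
      (\<lambda>s t. f12 s t * g s t + f1 s t * g2 s t + f2 s t * g1 s t + f s t * g12 s t)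
      (\<lambda>s t. f22 s t * g s t + 2 * (f2 s t * g2 s t) + f s t * g22 s t)"
proof -
  have *: "jet f f1 f2" "jet f1 f11 f12" "jet f2 f12 f22" "jet g g1 g2" "jet g1 g11 g12" "jet g2 g12 g22"
    using assms by (auto simp: jet2_def)
  show ?thesis
    unfolding jet2_def
  proof (intro conjI)
    show "jet (\<lambda>s t. f1 s t * g s t + f s t * g1 s t)
      (\<lambda>s t. f11 s t * g s t + 2 * (f1 s t * g1 s t) + f s t * g11 s t)
      (\<lambda>s t. f12 s t * g s t + f1 s t * g2 s t + f2 s t * g1 s t + f s t * g12 s t)"
      by (rule jet_cong[OF jet_add[OF jet_mult[OF *(2,4)] jet_mult[OF *(1,5)]]])
        (simp_all add: algebra_simps)
    show "jet (\<lambda>s t. f2 s t * g s t + f s t * g2 s t)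
      (\<lambda>s t. f12 s t * g s t + f1 s t * g2 s t + f2 s t * g1 s t + f s t * g12 s t)
      (\<lambda>s t. f22 s t * g s t + 2 * (f2 s t * g2 s t) + f s t * g22 s t)"
      by (rule jet_cong[OF jet_add[OF jet_mult[OF *(3,4)] jet_mult[OF *(1,6)]]])
        (simp_all add: algebra_simps)
  qed (rule jet_mult[OF *(1,4)])
qed

lemma jet2_add:
  assumes "jet2 f f1 f2 f11 f12 f22" "jet2 g g1 g2 g11 g12 g22"
  shows "jet2 (\<lambda>s t. f s t + g s t) (\<lambda>s t. f1 s t + g1 s t) (\<lambda>s t. f2 s t + g2 s t)
     (\<lambda>s t. f11 s t + g11 s t) (\<lambda>s t. f12 s t + g12 s t) (\<lambda>s t. f22 s t + g22 s t)"
  using assms unfolding jet2_def by (auto intro: jet_add)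

lemma jet2_cmult:
  assumes "jet2 f f1 f2 f11 f12 f22"
  shows "jet2 (\<lambda>s t. c * f s t) (\<lambda>s t. c * f1 s t) (\<lambda>s t. c * f2 s t)
     (\<lambda>s t. c * f11 s t) (\<lambda>s t. c * f12 s t) (\<lambda>s t. c * f22 s t)"
  using assms unfolding jet2_def by (auto intro: jet_cmult)

lemma jet2_axial:
  assumes "\<And>s. (g has_real_derivative g' s) (at s)" "\<And>s. (g' has_real_derivative g'' s) (at s)"
  shows "jet2 (\<lambda>s t. g s) (\<lambda>s t. g' s) (\<lambda>s t. 0) (\<lambda>s t. g'' s) (\<lambda>s t. 0) (\<lambda>s t. 0)"
  using assms unfolding jet2_def by (auto intro: jet_axial jet_const)

lemma jet2_angular:
  assumes "\<And>s. (g has_real_derivative g' s) (at s)" "\<And>s. (g' has_real_derivative g'' s) (at s)"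
  shows "jet2 (\<lambda>s t. g t) (\<lambda>s t. 0) (\<lambda>s t. g' t) (\<lambda>s t. 0) (\<lambda>s t. 0) (\<lambda>s t. g'' t)"
  using assms unfolding jet2_def by (auto intro: jet_angular jet_const)

text \<open>By the mean value theorem in the two possible orders, the second difference of
  \<open>f\<close> over a small square is h^2 times a value of \<open>f12\<close> and also h^2 times
  a value of \<open>f21\<close>; continuity forces agreement at the corner.\<close>

lemma jet_mixed_partials:
  assumes f: "jet f f1 f2" and f1: "jet f1 f11 f12" and f2: "jet f2 f21 f22"
    and c12: "continuous_on ({..<0} \<times> UNIV) (\<lambda>z. f12 (fst z) (snd z))"
    and c21: "continuous_on ({..<0} \<times> UNIV) (\<lambda>z. f21 (fst z) (snd z))"
    and "s < 0"
  shows "f12 s t = f21 s t"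
proof (rule ccontr)
  assume ne: "f12 s t \<noteq> f21 s t"
  define e where "e = \<bar>f12 s t - f21 s t\<bar> / 2"
  have e: "e > 0" using ne by (auto simp: e_def)
  have op: "open ({..<0::real} \<times> (UNIV::real set))" by (intro open_Times open_lessThan open_UNIV)
  have "isCont (\<lambda>z. f12 (fst z) (snd z)) (s,t)" "isCont (\<lambda>z. f21 (fst z) (snd z)) (s,t)"
    using c12 c21 \<open>s < 0\<close> op continuous_on_eq_continuous_at by fastforce+
  then obtain d1 d2 where d: "d1 > 0" "d2 > 0"
     "\<And>x y. dist (x,y) (s,t) < d1 \<Longrightarrow> \<bar>f12 x y - f12 s t\<bar> < e"
     "\<And>x y. dist (x,y) (s,t) < d2 \<Longrightarrow> \<bar>f21 x y - f21 s t\<bar> < e"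
    unfolding continuous_at_eps_delta using e by (force simp: dist_real_def)
  \<comment> \<open>Points of the open square have distance less than 2h from \<open>(s, t)\<close>,
    so both continuity estimates apply; the second bound keeps the right edge below 0.\<close>
  define h where "h = min (min d1 d2 / 4) (- s / 2)"
  have h: "h > 0" "s + h < 0" "2 * h < d1" "2 * h < d2"
    using d \<open>s < 0\<close> by (auto simp: h_def min_def)
  have near: "dist (x,y) (s,t) < 2 * h" if "s < x" "x < s + h" "t < y" "y < t + h" for x y
  proof -
    have "dist (x,y) (s,t) \<le> dist x s + dist y t"
      by (simp add: dist_Pair_Pair sqrt_sum_squares_le_sum)
    also have "\<dots> < 2 * h" using that by (auto simp: dist_real_def)
    finally show ?thesis .
  qed
  define \<Delta> where "\<Delta> = f (s+h) (t+h) - f (s+h) t - f s (t+h) + f s t"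
  have "\<exists>x>s. x < s + h \<and> (f (s+h) (t+h) - f (s+h) t) - (f s (t+h) - f s t)
      = (s + h - s) * (f1 x (t+h) - f1 x t)"
    using h by (intro MVT2) (auto intro!: derivative_eq_intros jet_partial1[OF f])
  then obtain x where x: "s < x" "x < s + h" "\<Delta> = h * (f1 x (t+h) - f1 x t)"
    by (auto simp: \<Delta>_def algebra_simps)
  have "\<exists>y>t. y < t + h \<and> f1 x (t+h) - f1 x t = (t + h - t) * f12 x y"
    using h x by (intro MVT2) (auto intro!: derivative_eq_intros jet_partial2[OF f1])
  then obtain y where y: "t < y" "y < t + h" "\<Delta> = h * (h * f12 x y)"
    using x by auto
  have "\<exists>y>t. y < t + h \<and> (f (s+h) (t+h) - f s (t+h)) - (f (s+h) t - f s t)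
      = (t + h - t) * (f2 (s+h) y - f2 s y)"
    using h \<open>s < 0\<close> by (intro MVT2) (auto intro!: derivative_eq_intros jet_partial2[OF f])
  then obtain y' where y': "t < y'" "y' < t + h" "\<Delta> = h * (f2 (s+h) y' - f2 s y')"
    by (auto simp: \<Delta>_def algebra_simps)
  have "\<exists>x>s. x < s + h \<and> f2 (s+h) y' - f2 s y' = (s + h - s) * f21 x y'"
    using h y' by (intro MVT2) (auto intro!: derivative_eq_intros jet_partial1[OF f2])
  then obtain x' where x': "s < x'" "x' < s + h" "\<Delta> = h * (h * f21 x' y')"
    using y' by auto
  have "f12 x y = f21 x' y'" using y(3) x'(3) h by auto
  moreover have "\<bar>f12 x y - f12 s t\<bar> < e"
    by (rule d(3)) (use near[OF x(1,2) y(1,2)] h in auto)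
  moreover have "\<bar>f21 x' y' - f21 s t\<bar> < e"
    by (rule d(4)) (use near[OF x'(1,2) y'(1,2)] h in auto)
  ultimately show False unfolding e_def by (smt (verit) field_sum_of_halves)
qed

section \<open>Translation-invariant elliptic equations on the half-cylinder\<close>

text \<open>Models (e^{2\<alpha>s}(b11 u_s + b12 u_t))_s + (e^{2\<alpha>s}(b12 u_s + b22 u_t))_t =
  0; the operator \<open>L\<close> is the left-hand side multiplied by e^{-2\<alpha>s}. The periodic
  angular factor \<psi> of the barrier is a hypothesis here and is supplied later for the concrete
  coefficients.\<close>

locale cylinder_equation =
  fixes \<alpha> :: real and b11 b12 b22 d12 d22 \<psi> :: "real \<Rightarrow> real"
  assumes \<alpha>_pos: "\<alpha> > 0"
    and b12_deriv: "\<And>t. (b12 has_real_derivative d12 t) (at t)"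
    and b22_deriv: "\<And>t. (b22 has_real_derivative d22 t) (at t)"
    and b11_cont: "continuous_on UNIV b11"
    and d12_cont: "continuous_on UNIV d12"
    and b11_periodic: "\<And>t. b11 (t + 2 * pi) = b11 t"
    and b12_periodic: "\<And>t. b12 (t + 2 * pi) = b12 t"
    and b22_periodic: "\<And>t. b22 (t + 2 * pi) = b22 t"
    and d12_periodic: "\<And>t. d12 (t + 2 * pi) = d12 t"
    and b22_pos: "\<And>t. b22 t > 0"
    and det_pos: "\<And>t. b11 t * b22 t - (b12 t)\<^sup>2 > 0"
    and \<psi>_deriv: "\<And>t. (\<psi> has_real_derivative 2 * \<alpha> * b12 t / b22 t * \<psi> t) (at t)"
    and \<psi>_periodic: "\<And>t. \<psi> (t + 2 * pi) = \<psi> t"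
    and \<psi>_pos: "\<And>t. \<psi> t > 0"
begin

section \<open>The operator, its quadratic form and the maximum principle\<close>

definition L :: "real \<Rightarrow> real \<Rightarrow> real \<Rightarrow> real \<Rightarrow> real \<Rightarrow> real \<Rightarrow> real" where
  "L t f1 f2 f11 f12 f22 = b11 t * f11 + 2 * b12 t * f12 + b22 t * f22
     + (2 * \<alpha> * b11 t + d12 t) * f1 + (2 * \<alpha> * b12 t + d22 t) * f2"

lemma L_add: "L t (x1 + y1) (x2 + y2) (x11 + y11) (x12 + y12) (x22 + y22)
    = L t x1 x2 x11 x12 x22 + L t y1 y2 y11 y12 y22"
  by (simp add: L_def algebra_simps)

lemma L_cmult: "L t (c * x1) (c * x2) (c * x11) (c * x12) (c * x22) = c * L t x1 x2 x11 x12 x22"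
  by (simp add: L_def algebra_simps)

definition Q :: "real \<Rightarrow> real \<Rightarrow> real \<Rightarrow> real" where
  "Q t x y = b11 t * x\<^sup>2 + 2 * b12 t * x * y + b22 t * y\<^sup>2"

lemma b11_pos: "b11 t > 0"
proof -
  have "b11 t * b22 t > 0" using det_pos[of t] by (smt (verit) zero_le_power2)
  then show ?thesis using b22_pos[of t] by (simp add: zero_less_mult_iff)
qed

lemma b12_cont: "continuous_on UNIV b12"
  by (meson DERIV_isCont b12_deriv continuous_at_imp_continuous_on)

lemma b22_cont: "continuous_on UNIV b22"
  by (meson DERIV_isCont b22_deriv continuous_at_imp_continuous_on)

lemma \<psi>_cont: "continuous_on UNIV \<psi>"
  by (meson DERIV_isCont \<psi>_deriv continuous_at_imp_continuous_on)

lemma Q_eq1: "Q t x y = (b11 t * x + b12 t * y)\<^sup>2 / b11 t + (b11 t * b22 t - (b12 t)\<^sup>2) / b11 t * y\<^sup>2"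
  using b11_pos[of t] by (simp add: Q_def field_simps power2_eq_square)

lemma Q_eq2: "Q t x y = (b22 t * y + b12 t * x)\<^sup>2 / b22 t + (b11 t * b22 t - (b12 t)\<^sup>2) / b22 t * x\<^sup>2"
  using b22_pos[of t] by (simp add: Q_def field_simps power2_eq_square)

text \<open>Cauchy-Schwarz for \<open>Q\<close>: the flux b11 x + b12 y pairs (x, y) with the axial
  unit vector, whose \<open>Q\<close>-value is b11. It absorbs the cross terms that contain
  derivatives of cut-offs in s.\<close>

lemma Q_ge_flux: "(b11 t * x + b12 t * y)\<^sup>2 / b11 t \<le> Q t x y"
proof -
  have "0 \<le> (b11 t * b22 t - (b12 t)\<^sup>2) / b11 t * y\<^sup>2"
    using b11_pos[of t] det_pos[of t] by (intro mult_nonneg_nonneg divide_nonneg_nonneg) auto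
  then show ?thesis unfolding Q_eq1 by linarith
qed

lemma Q_nonneg: "0 \<le> Q t x y"
  using Q_ge_flux[of t x y] b11_pos[of t] by (smt (verit) divide_nonneg_pos zero_le_power2)

text \<open>Each completion of the square isolates one variable with coefficient det/b11 or det/b22,
  which is positive, continuous and periodic, hence bounded away from zero.\<close>

lemma Q_coercive:
  obtains c where "c > 0" "\<And>t x y. c * x\<^sup>2 \<le> Q t x y" "\<And>t x y. c * y\<^sup>2 \<le> Q t x y"
proof -
  obtain c1 where c1: "c1 > 0" "\<And>t. c1 \<le> (b11 t * b22 t - (b12 t)\<^sup>2) / b11 t"
    by (rule periodic_bounded_below[of "\<lambda>t. (b11 t * b22 t - (b12 t)\<^sup>2) / b11 t"])
      (auto intro!: continuous_intros b11_cont b12_cont b22_cont divide_pos_pos b11_pos det_pos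
        simp: less_imp_neq[OF b11_pos, THEN not_sym] b11_periodic b12_periodic b22_periodic)
  obtain c2 where c2: "c2 > 0" "\<And>t. c2 \<le> (b11 t * b22 t - (b12 t)\<^sup>2) / b22 t"
    by (rule periodic_bounded_below[of "\<lambda>t. (b11 t * b22 t - (b12 t)\<^sup>2) / b22 t"])
      (auto intro!: continuous_intros b11_cont b12_cont b22_cont divide_pos_pos b22_pos det_pos
        simp: less_imp_neq[OF b22_pos, THEN not_sym] b11_periodic b12_periodic b22_periodic)
  note c = c1 c2
  show ?thesis
  proof (rule that[of "min c1 c2"])
    show "0 < min c1 c2" using c by auto
    show "min c1 c2 * y\<^sup>2 \<le> Q t x y" for t x y
    proof -
      have "min c1 c2 * y\<^sup>2 \<le> (b11 t * b22 t - (b12 t)\<^sup>2) / b11 t * y\<^sup>2"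
        using c(2)[of t] by (intro mult_right_mono) auto
      moreover have "0 \<le> (b11 t * x + b12 t * y)\<^sup>2 / b11 t"
        using b11_pos[of t] by auto
      ultimately show ?thesis unfolding Q_eq1 by linarith
    qed
    show "min c1 c2 * x\<^sup>2 \<le> Q t x y" for t x y
    proof -
      have "min c1 c2 * x\<^sup>2 \<le> (b11 t * b22 t - (b12 t)\<^sup>2) / b22 t * x\<^sup>2"
        using c(4)[of t] by (intro mult_right_mono) auto
      moreover have "0 \<le> (b22 t * y + b12 t * x)\<^sup>2 / b22 t"
        using b22_pos[of t] by auto
      ultimately show ?thesis unfolding Q_eq2 by linarith
    qed
  qed
qed

text \<open>At an interior maximum the gradient vanishes and all directional second derivatives are
  nonpositive, while the second-order part of \<open>L\<close> is a nonnegative combination of two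
  of them. Periodicity reduces the strip to a compact rectangle.\<close>

lemma maximum_principle_strict:
  assumes Z: "jet2 Z Z1 Z2 Z11 Z12 Z22"
    and per: "\<And>s t. s < 0 \<Longrightarrow> Z s (t + 2 * pi) = Z s t"
    and s12: "s1 < s2" "s2 < 0"
    and pos: "\<And>s t. s1 < s \<Longrightarrow> s < s2 \<Longrightarrow> L t (Z1 s t) (Z2 s t) (Z11 s t) (Z12 s t) (Z22 s t) > 0"
    and bd: "\<And>t. Z s1 t \<le> M" "\<And>t. Z s2 t \<le> M"
    and s: "s1 \<le> s" "s \<le> s2"
  shows "Z s t \<le> M"
proof -
  have jets: "jet Z Z1 Z2" "jet Z1 Z11 Z12" "jet Z2 Z12 Z22" using Z by (auto simp: jet2_def)
  have "continuous_on ({s1..s2} \<times> {0..2*pi}) (\<lambda>z. Z (fst z) (snd z))"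
    by (rule continuous_on_subset[OF jet_continuous_on[OF jets(1)]]) (use s12 in auto)
  then obtain z where z: "z \<in> {s1..s2} \<times> {0..2*pi}"
      "\<And>y. y \<in> {s1..s2} \<times> {0..2*pi} \<Longrightarrow> Z (fst y) (snd y) \<le> Z (fst z) (snd z)"
    using continuous_attains_sup[of "{s1..s2} \<times> {0..2*pi}" "\<lambda>z. Z (fst z) (snd z)"] s12
    by (auto simp: compact_Times)
  obtain p q where pq: "z = (p, q)" by (cases z)
  have max: "Z x y \<le> Z p q" if x: "s1 \<le> x" "x \<le> s2" for x y
  proof -
    have "Z x (t + 2 * pi) = Z x t" for t using per x s12 by auto
    then    obtain y' where y': "0 \<le> y'" "y' \<le> 2 * pi" "Z x y = Z x y'"
      by (rule periodic_representative[of "Z x" "2*pi" y]) auto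
    have "Z x y' \<le> Z p q"
      using z(2)[of "(x, y')"] x y' by (simp add: pq)
    then show ?thesis using y' by simp
  qed
  have "p = s1 \<or> p = s2"
  proof (rule ccontr)
    assume "\<not> ?thesis"
    then have p: "s1 < p" "p < s2" using z(1) by (auto simp: pq)
    define d where "d = min (p - s1) (s2 - p)"
    have d: "d > 0" using p by (auto simp: d_def)
    have line: "\<xi> * Z1 p q + \<eta> * Z2 p q = 0"
       "\<xi> * (\<xi> * Z11 p q + \<eta> * Z12 p q) + \<eta> * (\<xi> * Z12 p q + \<eta> * Z22 p q) \<le> 0" for \<xi> \<eta>
    proof -
      \<comment> \<open>Keeps the segment in the direction (\<xi>, \<eta>) between the heights
        \<open>s1\<close> and \<open>s2\<close>; the summand 1 covers \<xi> = 0.\<close>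
      define e where "e = d / (1 + \<bar>\<xi>\<bar>)"
      have e: "e > 0" using d by (auto simp: e_def intro!: divide_pos_pos)
      have near: "\<bar>\<xi> * x\<bar> < d" if "\<bar>x\<bar> < e" for x
      proof -
        have "\<bar>x\<bar> * (1 + \<bar>\<xi>\<bar>) < d" using that by (simp add: e_def pos_less_divide_eq)
        then show ?thesis by (simp add: abs_mult algebra_simps)
      qed
      have inside: "s1 \<le> p + \<xi> * x" "p + \<xi> * x \<le> s2" if "\<bar>x\<bar> < e" for x
        using near[OF that] by (auto simp: d_def)
      let ?g = "\<lambda>x. Z (p + \<xi> * x) (q + \<eta> * x)"
      let ?g1 = "\<lambda>x. \<xi> * Z1 (p + \<xi> * x) (q + \<eta> * x) + \<eta> * Z2 (p + \<xi> * x) (q + \<eta> * x)"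
      have 1: "(?g has_real_derivative ?g1 x) (at x)" if "\<bar>x\<bar> < e" for x
        by (rule jet_line[OF jets(1)]) (use inside[OF that] s12 in auto)
      have 2: "(?g1 has_real_derivative
          \<xi> * (\<xi> * Z11 p q + \<eta> * Z12 p q) + \<eta> * (\<xi> * Z12 p q + \<eta> * Z22 p q)) (at 0)"
        by (rule derivative_eq_intros jet_line[OF jets(2)] jet_line[OF jets(3)] refl | use p s12 in simp)+
      show "\<xi> * Z1 p q + \<eta> * Z2 p q = 0"
       "\<xi> * (\<xi> * Z11 p q + \<eta> * Z12 p q) + \<eta> * (\<xi> * Z12 p q + \<eta> * Z22 p q) \<le> 0"
        using second_derivative_test_max[of e ?g ?g1, OF e 1 2] inside max by auto
    qed
    have z12: "Z1 p q = 0" "Z2 p q = 0" using line(1)[of 1 0] line(1)[of 0 1] by auto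
    \<comment> \<open>With this slope the second-order part of \<open>L\<close> is b11 - b22 \<xi>^2
      = det/b22 times the second derivative along (1, 0) plus b22 times the one along (\<xi>,
      1).\<close>
    define \<xi> where "\<xi> = b12 q / b22 q"
    have bx: "b12 q = b22 q * \<xi>" using b22_pos[of q] by (simp add: \<xi>_def)
    have "b11 q - b22 q * \<xi>\<^sup>2 \<ge> 0"
      using det_pos[of q] b22_pos[of q] by (simp add: \<xi>_def field_simps power2_eq_square)
    then have "(b11 q - b22 q * \<xi>\<^sup>2) * Z11 p q \<le> 0"
      using line(2)[of 1 0] by (intro mult_nonneg_nonpos) auto
    moreover have "b22 q * (\<xi>\<^sup>2 * Z11 p q + 2 * \<xi> * Z12 p q + Z22 p q) \<le> 0"
      using line(2)[of \<xi> 1] b22_pos[of q]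
      by (intro mult_nonneg_nonpos) (auto simp: algebra_simps power2_eq_square)
    ultimately have "L q (Z1 p q) (Z2 p q) (Z11 p q) (Z12 p q) (Z22 p q) \<le> 0"
      unfolding L_def z12 bx by (simp add: algebra_simps)
    then show False using pos[OF p, of q] by simp
  qed
  then show ?thesis using max[OF s] bd by (metis order_trans)
qed

text \<open>Adding \<epsilon> e^{ls} with large l makes the differential inequality strict; for s <
  0 the added term is at most \<epsilon>.\<close>

lemma maximum_principle:
  assumes Z: "jet2 Z Z1 Z2 Z11 Z12 Z22"
    and per: "\<And>s t. s < 0 \<Longrightarrow> Z s (t + 2 * pi) = Z s t"
    and s12: "s1 < s2" "s2 < 0"
    and pos: "\<And>s t. s1 < s \<Longrightarrow> s < s2 \<Longrightarrow> L t (Z1 s t) (Z2 s t) (Z11 s t) (Z12 s t) (Z22 s t) \<ge> 0"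
    and bd: "\<And>t. Z s1 t \<le> M" "\<And>t. Z s2 t \<le> M"
    and s: "s1 \<le> s" "s \<le> s2"
  shows "Z s t \<le> M"
proof (rule field_le_epsilon)
  fix \<epsilon> :: real assume \<epsilon>: "\<epsilon> > 0"
  obtain c where c: "c > 0" "\<And>t. c \<le> b11 t"
    using periodic_bounded_below[OF b11_cont b11_periodic b11_pos] by blast
  obtain K where K: "K > 0" "\<And>t. \<bar>d12 t\<bar> \<le> K"
    using periodic_bounded[OF d12_cont d12_periodic] by blast
  \<comment> \<open>Then b11 l is at least K + 1 and exceeds |d12|, so \<open>L\<close> is positive
    on e^{ls} whatever the sign of \<open>d12\<close>.\<close>
  define l where "l = (K + 1) / c"
  have l: "l > 0" using c K by (auto simp: l_def)
  have lb: "0 < b11 t * l\<^sup>2 + (2 * \<alpha> * b11 t + d12 t) * l" for t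
  proof -
    have "K + 1 = c * l" using c(1) by (simp add: l_def)
    also have "\<dots> \<le> b11 t * l" using c(2)[of t] l by (intro mult_right_mono) auto
    finally have "K + 1 \<le> b11 t * l" .
    moreover have "0 < 2 * \<alpha> * b11 t" using \<alpha>_pos b11_pos by auto
    ultimately have "0 < l * (b11 t * l + (2 * \<alpha> * b11 t + d12 t))"
      using K(2)[of t] l by (intro mult_pos_pos) linarith+
    then show ?thesis by (simp add: algebra_simps power2_eq_square)
  qed
  let ?e = "\<lambda>s. exp (l * s)"
  have "jet2 (\<lambda>s t. ?e s) (\<lambda>s t. l * ?e s) (\<lambda>s t. 0) (\<lambda>s t. l\<^sup>2 * ?e s) (\<lambda>s t. 0) (\<lambda>s t. 0)"
    by (rule jet2_axial) (auto intro!: derivative_eq_intros simp: power2_eq_square)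
  note J = jet2_add[OF Z jet2_cmult[OF this, of \<epsilon>]]
  have e1: "?e x \<le> 1" if "x < 0" for x using that l by (simp add: mult_nonneg_nonpos)
  have "Z s t + \<epsilon> * ?e s \<le> M + \<epsilon>"
  proof (rule maximum_principle_strict[OF J _ s12 _ _ _ s])
    show "Z x (y + 2 * pi) + \<epsilon> * ?e x = Z x y + \<epsilon> * ?e x" if "x < 0" for x y
      using per[OF that] by simp
    show "Z s1 y + \<epsilon> * ?e s1 \<le> M + \<epsilon>" "Z s2 y + \<epsilon> * ?e s2 \<le> M + \<epsilon>" for y
      using bd[of y] e1[of s1] e1[of s2] s12 \<epsilon> by (auto intro!: add_mono simp: mult_left_le)
    show "0 < L y (Z1 x y + \<epsilon> * (l * ?e x)) (Z2 x y + \<epsilon> * 0) (Z11 x y + \<epsilon> * (l\<^sup>2 * ?e x))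
        (Z12 x y + \<epsilon> * 0) (Z22 x y + \<epsilon> * 0)" if "s1 < x" "x < s2" for x y
    proof -
      have "0 < \<epsilon> * ?e x * (b11 y * l\<^sup>2 + (2 * \<alpha> * b11 y + d12 y) * l)"
        using lb \<epsilon> by simp
      then show ?thesis using pos[OF that, of y] unfolding L_def by (simp add: algebra_simps)
    qed
  qed
  moreover have "0 \<le> \<epsilon> * ?e s" using \<epsilon> by simp
  ultimately show "Z s t \<le> M + \<epsilon>" by linarith
qed

definition solution where
  "solution u u1 u2 u11 u12 u22 \<longleftrightarrow> jet2 u u1 u2 u11 u12 u22 \<and>
     (\<forall>s<0. \<forall>t. u s (t + 2 * pi) = u s t \<and> L t (u1 s t) (u2 s t) (u11 s t) (u12 s t) (u22 s t) = 0)"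

text \<open>The barrier \<open>e\<^bsup>-2\<alpha>s\<^esup>\<psi>(t)\<close> is the solution dual to the constants under the
  formal symmetry \<open>\<lambda> \<mapsto> -2\<alpha> - \<lambda>\<close> of the exponents of separated solutions.\<close>

lemma barrier_upper_bound:
  assumes u: "solution u u1 u2 u11 u12 u22"
    and M: "M \<ge> 0" "\<And>t. u (-1) t \<le> M"
    and \<gamma>: "\<gamma> < 2 * \<alpha>"
    and grow: "\<And>S. \<exists>\<xi><S. \<forall>t. u \<xi> t \<le> C * exp (- \<gamma> * \<xi>)"
    and s: "s < -1"
  shows "u s t \<le> M"
proof (rule field_le_epsilon)
  fix \<epsilon>' :: real assume \<epsilon>': "\<epsilon>' > 0"
  \<comment> \<open>The multiple of the barrier is calibrated to equal \<open>\<epsilon>'\<close> at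
    the one point under consideration.\<close>
  define \<epsilon> where "\<epsilon> = \<epsilon>' / (exp (-2 * \<alpha> * s) * \<psi> t)"
  have \<epsilon>: "\<epsilon> > 0" using \<epsilon>' \<psi>_pos by (simp add: \<epsilon>_def)
  obtain c where c: "c > 0" "\<And>t. c \<le> \<psi> t"
    using periodic_bounded_below[OF \<psi>_cont \<psi>_periodic \<psi>_pos] by blast
  \<comment> \<open>So far down that (2\<alpha> - \<gamma>)(-\<xi>) exceeds |C|/(\<epsilon>c); since
    e^x > x, the barrier of rate 2\<alpha> then dominates the growth bound of rate \<gamma> on this
    circle.\<close>
  obtain \<xi> where \<xi>: "\<xi> < min s (- (\<bar>C\<bar> / (\<epsilon> * c)) / (2 * \<alpha> - \<gamma>))" "\<And>t. u \<xi> t \<le> C * exp (- \<gamma> * \<xi>)"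
    using grow by blast
  have "\<xi> < - (\<bar>C\<bar> / (\<epsilon> * c)) / (2 * \<alpha> - \<gamma>)" using \<xi>(1) by simp
  then have "\<xi> * (2 * \<alpha> - \<gamma>) < - (\<bar>C\<bar> / (\<epsilon> * c))"
    using \<gamma> by (subst (asm) pos_less_divide_eq) auto
  then have "\<bar>C\<bar> / (\<epsilon> * c) \<le> - (2 * \<alpha> - \<gamma>) * \<xi>"
    by (simp add: algebra_simps)
  also have "\<dots> \<le> exp (- (2 * \<alpha> - \<gamma>) * \<xi>)"
    using exp_ge_add_one_self[of "- (2 * \<alpha> - \<gamma>) * \<xi>"] by linarith
  finally have "\<bar>C\<bar> \<le> \<epsilon> * c * exp (- (2 * \<alpha> - \<gamma>) * \<xi>)"
    using \<epsilon> c by (simp add: pos_divide_le_eq algebra_simps)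
  then have "C * exp (- \<gamma> * \<xi>) \<le> \<epsilon> * c * exp (- (2 * \<alpha> - \<gamma>) * \<xi>) * exp (- \<gamma> * \<xi>)"
    by (intro mult_right_mono) auto
  also have "\<dots> = \<epsilon> * exp (- 2 * \<alpha> * \<xi>) * c"
    by (simp add: exp_add[symmetric] algebra_simps flip: mult.assoc)
  finally have C: "C * exp (- \<gamma> * \<xi>) \<le> \<epsilon> * exp (- 2 * \<alpha> * \<xi>) * c" .
  define \<psi>1 where "\<psi>1 t = 2 * \<alpha> * b12 t / b22 t * \<psi> t" for t
  define \<psi>2 where "\<psi>2 t = 2 * \<alpha> * ((d12 t * b22 t - b12 t * d22 t) / (b22 t)\<^sup>2 * \<psi> t
      + b12 t / b22 t * \<psi>1 t)" for t
  have "jet2 (\<lambda>s t. \<psi> t) (\<lambda>s t. 0) (\<lambda>s t. \<psi>1 t) (\<lambda>s t. 0) (\<lambda>s t. 0) (\<lambda>s t. \<psi>2 t)"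
  proof (rule jet2_angular)
    show "(\<psi> has_real_derivative \<psi>1 t) (at t)" for t using \<psi>_deriv[of t] by (simp add: \<psi>1_def)
    show "(\<psi>1 has_real_derivative \<psi>2 t) (at t)" for t
      unfolding \<psi>1_def \<psi>2_def using b22_pos[of t]
      by (auto intro!: derivative_eq_intros b12_deriv b22_deriv \<psi>_deriv simp: field_simps power2_eq_square)
  qed
  moreover have "jet2 (\<lambda>s t. exp (-2*\<alpha> * s)) (\<lambda>s t. -2*\<alpha> * exp (-2*\<alpha> * s)) (\<lambda>s t. 0)
      (\<lambda>s t. 4 * \<alpha>\<^sup>2 * exp (-2*\<alpha> * s)) (\<lambda>s t. 0) (\<lambda>s t. 0)"
    by (rule jet2_axial) (auto intro!: derivative_eq_intros simp: power2_eq_square)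
  ultimately have w: "jet2 (\<lambda>s t. exp (-2*\<alpha> * s) * \<psi> t) (\<lambda>s t. -2*\<alpha> * exp (-2*\<alpha> * s) * \<psi> t)
      (\<lambda>s t. exp (-2*\<alpha> * s) * \<psi>1 t) (\<lambda>s t. 4 * \<alpha>\<^sup>2 * exp (-2*\<alpha> * s) * \<psi> t)
      (\<lambda>s t. -2*\<alpha> * exp (-2*\<alpha> * s) * \<psi>1 t) (\<lambda>s t. exp (-2*\<alpha> * s) * \<psi>2 t)"
    using jet2_mult[of "\<lambda>s t. exp (-2*\<alpha> * s)" _ _ _ _ _ "\<lambda>s t. \<psi> t"] by fastforce
  have Lw: "L t (-2*\<alpha> * exp (-2*\<alpha> * s) * \<psi> t) (exp (-2*\<alpha> * s) * \<psi>1 t)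
     (4 * \<alpha>\<^sup>2 * exp (-2*\<alpha> * s) * \<psi> t) (-2*\<alpha> * exp (-2*\<alpha> * s) * \<psi>1 t) (exp (-2*\<alpha> * s) * \<psi>2 t) = 0" for s t
  proof -
    have 1: "b22 t * \<psi>1 t = 2 * \<alpha> * b12 t * \<psi> t" using b22_pos[of t] by (simp add: \<psi>1_def)
    \<comment> \<open>The derivative of the relation b22 \<psi>' = 2 \<alpha> b12 \<psi>. Up to the
      factor e^{-2\<alpha>s}, this is all that remains when \<open>L\<close> is applied to the
      barrier.\<close>
    have 2: "b22 t * \<psi>2 t = 2 * \<alpha> * (d12 t * \<psi> t + b12 t * \<psi>1 t) - d22 t * \<psi>1 t"
      using b22_pos[of t] by (simp add: \<psi>2_def \<psi>1_def field_simps power2_eq_square)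
    have "L t (-2*\<alpha> * exp (-2*\<alpha> * s) * \<psi> t) (exp (-2*\<alpha> * s) * \<psi>1 t)
       (4 * \<alpha>\<^sup>2 * exp (-2*\<alpha> * s) * \<psi> t) (-2*\<alpha> * exp (-2*\<alpha> * s) * \<psi>1 t) (exp (-2*\<alpha> * s) * \<psi>2 t)
      = exp (-2*\<alpha> * s) * (b22 t * \<psi>2 t - 2*\<alpha>*(d12 t * \<psi> t + b12 t * \<psi>1 t) + d22 t * \<psi>1 t)"
      unfolding L_def by (simp add: algebra_simps power2_eq_square)
    then show ?thesis using 2 by simp
  qed
  have uj: "jet2 u u1 u2 u11 u12 u22" using u by (simp add: solution_def)
  have "u s t + (-\<epsilon>) * (exp (-2*\<alpha> * s) * \<psi> t) \<le> M"
  proof (rule maximum_principle[OF jet2_add[OF uj jet2_cmult[OF w, of "-\<epsilon>"]], of \<xi> "-1"])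
    show "u x (y + 2 * pi) + (-\<epsilon>) * (exp (-2*\<alpha> * x) * \<psi> (y + 2 * pi))
       = u x y + (-\<epsilon>) * (exp (-2*\<alpha> * x) * \<psi> y)" if "x < 0" for x y
      using u that \<psi>_periodic by (simp add: solution_def)
    show "u \<xi> y + (-\<epsilon>) * (exp (-2*\<alpha> * \<xi>) * \<psi> y) \<le> M" for y
    proof -
      have "\<epsilon> * exp (-2*\<alpha> * \<xi>) * c \<le> \<epsilon> * exp (-2*\<alpha> * \<xi>) * \<psi> y"
        using \<epsilon> c(2)[of y] by (intro mult_left_mono) auto
      then show ?thesis using \<xi>(2)[of y] C M(1) by (simp add: algebra_simps)
    qed
    show "u (-1) y + (-\<epsilon>) * (exp (-2*\<alpha>*(-1)) * \<psi> y) \<le> M" for y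
      using M(2)[of y] \<epsilon> \<psi>_pos[of y] by (smt (verit) exp_gt_zero mult_minus_left mult_pos_pos)
    fix x y assume "\<xi> < x" "x < -1"
    then have "L y (u1 x y) (u2 x y) (u11 x y) (u12 x y) (u22 x y) = 0"
      using u by (simp add: solution_def)
    then show "0 \<le> L y (u1 x y + - \<epsilon> * (-2*\<alpha> * exp (-2*\<alpha> * x) * \<psi> y)) (u2 x y + - \<epsilon> * (exp (-2*\<alpha> * x) * \<psi>1 y))
       (u11 x y + - \<epsilon> * (4 * \<alpha>\<^sup>2 * exp (-2*\<alpha> * x) * \<psi> y)) (u12 x y + - \<epsilon> * (-2*\<alpha> * exp (-2*\<alpha> * x) * \<psi>1 y))
       (u22 x y + - \<epsilon> * (exp (-2*\<alpha> * x) * \<psi>2 y))"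
      unfolding L_add L_cmult Lw by simp
  qed (use \<xi> s in auto)
  moreover have "\<epsilon> * (exp (-2*\<alpha> * s) * \<psi> t) = \<epsilon>'"
    using \<psi>_pos[of t] by (simp add: \<epsilon>_def)
  ultimately show "u s t \<le> M + \<epsilon>'" by linarith
qed

end

section \<open>Integrals over circles\<close>

lemma leibniz_cylinder:
  assumes f: "\<And>s t. s < 0 \<Longrightarrow> ((\<lambda>x. f x t) has_real_derivative g s t) (at s)"
    and "\<And>s. s < 0 \<Longrightarrow> continuous_on UNIV (f s)"
    and g: "continuous_on ({..<0} \<times> UNIV) (\<lambda>z. g (fst z) (snd z))" and s: "s < 0"
  shows "((\<lambda>s. integral {0..2*pi} (f s)) has_real_derivative integral {0..2*pi} (g s)) (at s)"
proof -
  have "((\<lambda>s. integral (cbox 0 (2*pi)) (f s)) has_real_derivative integral (cbox 0 (2*pi)) (g s))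
      (at s within {..<0})"
  proof (rule leibniz_rule_field_derivative)
    show "((\<lambda>x. f x t) has_real_derivative g x t) (at x within {..<0})" if "x \<in> {..<0}" for x t
      using f[of x t] that by (auto intro: has_field_derivative_at_within)
    show "f x integrable_on cbox 0 (2*pi)" if "x \<in> {..<0}" for x
      using assms(2) that by (intro integrable_continuous) (auto intro: continuous_on_subset)
    show "continuous_on ({..<0} \<times> cbox 0 (2*pi)) (\<lambda>(x, t). g x t)"
      unfolding split_beta by (rule continuous_on_subset[OF g]) auto
  qed (use s in auto)
  then show ?thesis using s by (simp add: at_within_open[of s "{..<0}"])
qed

text \<open>The minimum of \<phi>^2 is at most its mean, hence at most its integral because 2 pi
  \<ge> 1. Elsewhere \<phi>^2 exceeds the minimum by an integral of 2 \<phi> \<phi>', which is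
  bounded by the integral of \<phi>^2 + \<phi>'^2.\<close>

lemma sobolev_circle:
  fixes \<phi> \<phi>' :: "real \<Rightarrow> real"
  assumes d: "\<And>t. (\<phi> has_real_derivative \<phi>' t) (at t)" and c: "continuous_on UNIV \<phi>'"
    and t: "t \<in> {0..2*pi}"
  shows "(\<phi> t)\<^sup>2 \<le> 2 * integral {0..2*pi} (\<lambda>t. (\<phi> t)\<^sup>2) + integral {0..2*pi} (\<lambda>t. (\<phi>' t)\<^sup>2)"
proof -
  have c0: "continuous_on UNIV \<phi>"
    by (meson DERIV_isCont d continuous_at_imp_continuous_on)
  note ci = continuous_on_subset[OF c0 subset_UNIV] continuous_on_subset[OF c subset_UNIV]
  have dd: "((\<lambda>t. (\<phi> t)\<^sup>2) has_real_derivative 2 * \<phi> t * \<phi>' t) (at t)" for t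
    by (auto intro!: derivative_eq_intros d)
  let ?I = "{0..2*pi}"
  have int: "(\<lambda>t. (\<phi> t)\<^sup>2) integrable_on S" "(\<lambda>t. (\<phi>' t)\<^sup>2) integrable_on S"
     "(\<lambda>t. 2 * \<phi> t * \<phi>' t) integrable_on S" if "S = {a..b}" for S a b
    unfolding that by (intro integrable_continuous_real continuous_intros ci)+
  have "\<exists>m\<in>?I. \<forall>t\<in>?I. (\<phi> m)\<^sup>2 \<le> (\<phi> t)\<^sup>2"
    by (rule continuous_attains_inf) (auto intro!: continuous_intros ci)
  then obtain m where m: "m \<in> ?I" "\<And>t. t \<in> ?I \<Longrightarrow> (\<phi> m)\<^sup>2 \<le> (\<phi> t)\<^sup>2" by blast
  have "integral ?I (\<lambda>t. (\<phi> m)\<^sup>2) \<le> integral ?I (\<lambda>t. (\<phi> t)\<^sup>2)"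
    by (rule integral_le) (use m int(1)[OF refl] in auto)
  then have "2 * pi * (\<phi> m)\<^sup>2 \<le> integral ?I (\<lambda>t. (\<phi> t)\<^sup>2)" by simp
  moreover have "1 * (\<phi> m)\<^sup>2 \<le> 2 * pi * (\<phi> m)\<^sup>2"
    using pi_gt3 by (intro mult_right_mono) auto
  ultimately have 1: "(\<phi> m)\<^sup>2 \<le> integral ?I (\<lambda>t. (\<phi> t)\<^sup>2)" by linarith
  have 2: "\<bar>(\<phi> y)\<^sup>2 - (\<phi> x)\<^sup>2\<bar> \<le> integral ?I (\<lambda>t. (\<phi> t)\<^sup>2) + integral ?I (\<lambda>t. (\<phi>' t)\<^sup>2)"
    if xy: "x \<le> y" "x \<in> ?I" "y \<in> ?I" for x y
  proof -
    have "((\<lambda>t. 2 * \<phi> t * \<phi>' t) has_integral ((\<phi> y)\<^sup>2 - (\<phi> x)\<^sup>2)) {x..y}"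
      by (rule fundamental_theorem_of_calculus[OF xy(1)])
        (use has_field_derivative_at_within[OF dd] in
          \<open>simp add: has_real_derivative_iff_has_vector_derivative\<close>)
    then have "\<bar>(\<phi> y)\<^sup>2 - (\<phi> x)\<^sup>2\<bar> = norm (integral {x..y} (\<lambda>t. 2 * \<phi> t * \<phi>' t))"
      by (simp add: integral_unique)
    also have "\<dots> \<le> integral {x..y} (\<lambda>t. (\<phi> t)\<^sup>2 + (\<phi>' t)\<^sup>2)"
    proof (rule integral_norm_bound_integral)
      show "norm (2 * \<phi> t * \<phi>' t) \<le> (\<phi> t)\<^sup>2 + (\<phi>' t)\<^sup>2" for t
        using sum_squares_bound[of "\<bar>\<phi> t\<bar>" "\<bar>\<phi>' t\<bar>"] by (simp add: abs_mult)
    qed (auto intro!: integrable_add int[OF refl])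
    also have "\<dots> \<le> integral ?I (\<lambda>t. (\<phi> t)\<^sup>2 + (\<phi>' t)\<^sup>2)"
      using xy by (intro integral_subset_le) (auto intro!: integrable_add int[OF refl])
    also have "\<dots> = integral ?I (\<lambda>t. (\<phi> t)\<^sup>2) + integral ?I (\<lambda>t. (\<phi>' t)\<^sup>2)"
      by (intro integral_add int[OF refl])
    finally show ?thesis .
  qed
  show ?thesis
    using 1 2[of t m] 2[of m t] m(1) t by (cases "t \<le> m") (auto simp: abs_le_iff)
qed

section \<open>Product rule for the operator and gradient bounds\<close>

context cylinder_equation begin

lemma solution_jets:
  assumes "solution u u1 u2 u11 u12 u22"
  shows "jet2 u u1 u2 u11 u12 u22" "jet u u1 u2" "jet u1 u11 u12" "jet u2 u12 u22"
    "s < 0 \<Longrightarrow> u s (t + 2 * pi) = u s t"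
    "s < 0 \<Longrightarrow> L t (u1 s t) (u2 s t) (u11 s t) (u12 s t) (u22 s t) = 0"
  using assms by (auto simp: solution_def jet2_def)

text \<open>The symmetric bilinear form belonging to \<open>Q\<close>; it is the cross term when
  \<open>L\<close> acts on a product.\<close>

definition P :: "real \<Rightarrow> real \<Rightarrow> real \<Rightarrow> real \<Rightarrow> real \<Rightarrow> real" where
  "P t x1 x2 y1 y2 = b11 t * x1 * y1 + b12 t * (x1 * y2 + x2 * y1) + b22 t * x2 * y2"

text \<open>Second derivatives are hidden behind existential quantifiers, so a test function
  assembled from sums and products only carries its gradient and its image under
  \<open>L\<close>.\<close>

definition has_L where
  "has_L f f1 f2 l \<longleftrightarrow> (\<exists>f11 f12 f22. jet2 f f1 f2 f11 f12 f22 \<and>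
     (\<forall>s t. l s t = L t (f1 s t) (f2 s t) (f11 s t) (f12 s t) (f22 s t)))"

lemma has_L_add:
  assumes "has_L f f1 f2 l" "has_L g g1 g2 m"
  shows "has_L (\<lambda>s t. f s t + g s t) (\<lambda>s t. f1 s t + g1 s t) (\<lambda>s t. f2 s t + g2 s t)
     (\<lambda>s t. l s t + m s t)"
proof -
  obtain f11 f12 f22 g11 g12 g22 where
    *: "jet2 f f1 f2 f11 f12 f22" "jet2 g g1 g2 g11 g12 g22"
     "\<And>s t. l s t = L t (f1 s t) (f2 s t) (f11 s t) (f12 s t) (f22 s t)"
     "\<And>s t. m s t = L t (g1 s t) (g2 s t) (g11 s t) (g12 s t) (g22 s t)"
    using assms unfolding has_L_def by blast
  show ?thesis
    unfolding has_L_def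
    by (intro exI conjI allI, rule jet2_add[OF *(1,2)]) (simp add: *(3,4) L_add)
qed

lemma has_L_cmult:
  assumes "has_L f f1 f2 l"
  shows "has_L (\<lambda>s t. c * f s t) (\<lambda>s t. c * f1 s t) (\<lambda>s t. c * f2 s t) (\<lambda>s t. c * l s t)"
proof -
  obtain f11 f12 f22 where
    *: "jet2 f f1 f2 f11 f12 f22"
     "\<And>s t. l s t = L t (f1 s t) (f2 s t) (f11 s t) (f12 s t) (f22 s t)"
    using assms unfolding has_L_def by blast
  show ?thesis
    unfolding has_L_def
    by (intro exI conjI allI, rule jet2_cmult[OF *(1)]) (simp add: *(2) L_cmult)
qed

lemma has_L_mult:
  assumes "has_L f f1 f2 l" "has_L g g1 g2 m"
  shows "has_L (\<lambda>s t. f s t * g s t) (\<lambda>s t. f1 s t * g s t + f s t * g1 s t)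
     (\<lambda>s t. f2 s t * g s t + f s t * g2 s t)
     (\<lambda>s t. g s t * l s t + f s t * m s t + 2 * P t (f1 s t) (f2 s t) (g1 s t) (g2 s t))"
proof -
  obtain f11 f12 f22 g11 g12 g22 where
    *: "jet2 f f1 f2 f11 f12 f22" "jet2 g g1 g2 g11 g12 g22"
     "\<And>s t. l s t = L t (f1 s t) (f2 s t) (f11 s t) (f12 s t) (f22 s t)"
     "\<And>s t. m s t = L t (g1 s t) (g2 s t) (g11 s t) (g12 s t) (g22 s t)"
    using assms unfolding has_L_def by blast
  show ?thesis
    unfolding has_L_def
    by (intro exI conjI allI, rule jet2_mult[OF *(1,2)]) (simp add: *(3,4) L_def P_def algebra_simps)
qed

lemma has_L_axial:
  assumes "\<And>s. (g has_real_derivative g' s) (at s)" "\<And>s. (g' has_real_derivative g'' s) (at s)"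
  shows "has_L (\<lambda>s t. g s) (\<lambda>s t. g' s) (\<lambda>s t. 0)
     (\<lambda>s t. b11 t * g'' s + (2 * \<alpha> * b11 t + d12 t) * g' s)"
  unfolding has_L_def
  by (intro exI conjI allI, rule jet2_axial[OF assms]) (simp_all add: L_def)

lemma maximum_principle_has_L:
  assumes "has_L Z Z1 Z2 l"
    and "\<And>s t. s < 0 \<Longrightarrow> Z s (t + 2 * pi) = Z s t"
    and "s1 < s2" "s2 < 0"
    and "\<And>s t. s1 < s \<Longrightarrow> s < s2 \<Longrightarrow> l s t \<ge> 0"
    and "\<And>t. Z s1 t \<le> M" "\<And>t. Z s2 t \<le> M"
    and "s1 \<le> s" "s \<le> s2"
  shows "Z s t \<le> M"
proof -
  obtain Z11 Z12 Z22 where *: "jet2 Z Z1 Z2 Z11 Z12 Z22"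
     "\<And>s t. l s t = L t (Z1 s t) (Z2 s t) (Z11 s t) (Z12 s t) (Z22 s t)"
    using assms(1) unfolding has_L_def by blast
  show ?thesis
    by (rule maximum_principle[OF *(1) assms(2-4) _ assms(6-9)]) (use assms(5) *(2) in auto)
qed

lemma solution_has_L:
  "solution u u1 u2 u11 u12 u22 \<Longrightarrow>
    has_L u u1 u2 (\<lambda>s t. L t (u1 s t) (u2 s t) (u11 s t) (u12 s t) (u22 s t))"
  unfolding has_L_def by (intro exI conjI allI, erule solution_jets(1)) (rule refl)

text \<open>Bernstein's method: since the coefficients do not depend on \<open>s\<close>, \<open>u\<^sub>s\<close> solves the same equation,
  and \<open>\<zeta>\<^sup>2 u\<^sub>s\<^sup>2 + \<Lambda> u\<^sup>2\<close> is a subsolution for large \<open>\<Lambda>\<close>.\<close>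

lemma axial_derivative_bound:
  assumes u: "solution u u1 u2 u11 u12 u22" and u1: "solution u1 u11 u12 u111 u112 u122"
    and M: "\<And>s t. s < 0 \<Longrightarrow> \<bar>u s t\<bar> \<le> M"
  shows "\<exists>K. \<forall>s< - 1. \<forall>t. \<bar>u1 s t\<bar> \<le> K"
proof -
  obtain c where c: "c > 0" "\<And>t x y. c * x\<^sup>2 \<le> Q t x y" using Q_coercive by metis
  obtain K1 where K1: "K1 > 0" "\<And>t. \<bar>b11 t\<bar> \<le> K1"
    using periodic_bounded[OF b11_cont b11_periodic] by blast
  obtain K2 where K2: "K2 > 0" "\<And>t. \<bar>d12 t\<bar> \<le> K2"
    using periodic_bounded[OF d12_cont d12_periodic] by blast
  \<comment> \<open>Collects the bounds |g'| \<le> 4 and |g''| \<le> 12 for the cut-off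
    \<open>g\<close> below and the term 32 b11 y^2 left over from completing a square; 44 is 12 +
    32. The choice of \<open>\<Lambda>\<close> makes 2 \<Lambda> c equal to
    \<open>R\<close>.\<close>
  define R where "R = 44 * K1 + 4 * (2 * \<alpha> * K1 + K2)"
  define \<Lambda> where "\<Lambda> = R / (2 * c)"
  have R: "R > 0" using K1 K2 \<alpha>_pos by (auto simp: R_def intro!: add_pos_pos)
  have \<Lambda>: "\<Lambda> > 0" "2 * \<Lambda> * c = R" using R c by (auto simp: \<Lambda>_def)
  have "(u1 s0 t0)\<^sup>2 \<le> \<Lambda> * M\<^sup>2" if s0: "s0 < -1" for s0 t0
  proof -
    \<comment> \<open>The cut-off is the square of w = 1 - (s - s0)^2: it is 1 at \<open>s0\<close>
      and 0 at \<open>s0 - 1\<close> and \<open>s0 + 1\<close>, which is still a negative height.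
      Squaring leaves a factor w in g', so that the cross term can be absorbed into w^2
      \<open>Q\<close>.\<close>
    define g where "g s = (1 - (s - s0)\<^sup>2)\<^sup>2" for s
    define g1 where "g1 s = - 4 * (s - s0) * (1 - (s - s0)\<^sup>2)" for s
    define g2 where "g2 s = 12 * (s - s0)\<^sup>2 - 4" for s
    define l0 where "l0 s t = L t (u1 s t) (u2 s t) (u11 s t) (u12 s t) (u22 s t)" for s t
    define l1 where "l1 s t = L t (u11 s t) (u12 s t) (u111 s t) (u112 s t) (u122 s t)" for s t
    have H: "has_L u u1 u2 l0" "has_L u1 u11 u12 l1"
      using solution_has_L[OF u] solution_has_L[OF u1] by (simp_all add: l0_def[abs_def] l1_def[abs_def])
    have l0: "l0 s t = 0" "l1 s t = 0" if "s < 0" for s t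
      using solution_jets(6)[OF u that] solution_jets(6)[OF u1 that] by (auto simp: l0_def l1_def)
    have G: "has_L (\<lambda>s t. g s) (\<lambda>s t. g1 s) (\<lambda>s t. 0)
        (\<lambda>s t. b11 t * g2 s + (2 * \<alpha> * b11 t + d12 t) * g1 s)"
      by (rule has_L_axial; unfold g_def g1_def g2_def)
        (auto intro!: derivative_eq_intros simp: algebra_simps power2_eq_square)
    note J = has_L_add[OF has_L_mult[OF G has_L_mult[OF H(2) H(2)]] has_L_cmult[OF has_L_mult[OF H(1) H(1)], of \<Lambda>]]
    have uM: "u s t * u s t \<le> M\<^sup>2" if "s < 0" for s t
      using M[OF that, of t] using power_mono[of "\<bar>u s t\<bar>" M 2] by (simp add: power2_eq_square)
    have "g s0 * (u1 s0 t0 * u1 s0 t0) + \<Lambda> * (u s0 t0 * u s0 t0) \<le> \<Lambda> * M\<^sup>2"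
    proof (rule maximum_principle_has_L[OF J, of "s0 - 1" "s0 + 1"])
      show "g (s0 - 1) * (u1 (s0 - 1) t * u1 (s0 - 1) t) + \<Lambda> * (u (s0 - 1) t * u (s0 - 1) t) \<le> \<Lambda> * M\<^sup>2"
        "g (s0 + 1) * (u1 (s0 + 1) t * u1 (s0 + 1) t) + \<Lambda> * (u (s0 + 1) t * u (s0 + 1) t) \<le> \<Lambda> * M\<^sup>2" for t
        using uM[of "s0 - 1" t] uM[of "s0 + 1" t] s0 \<Lambda>(1) by (auto simp: g_def)
      fix s t assume s: "s0 - 1 < s" "s < s0 + 1"
      define y where "y = s - s0"
      have y: "y\<^sup>2 \<le> 1" "\<bar>y\<bar> \<le> 1" using s by (auto simp: y_def abs_square_le_1)
      have sneg: "s < 0" using s s0 by auto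
      have z: "0 \<le> 1 - y\<^sup>2" "1 - y\<^sup>2 \<le> 1" using y by auto
      define F where "F = b11 t * u11 s t + b12 t * u12 s t"
      define h where "h = u1 s t"
      define w where "w = 1 - y\<^sup>2"
      have gg: "g s = w\<^sup>2" "g1 s = - 4 * y * w" "g2 s = 12 * y\<^sup>2 - 4"
        by (auto simp: g_def g1_def g2_def y_def w_def)
      have "0 \<le> 2 * w\<^sup>2 * Q t (u11 s t) (u12 s t)
          + h\<^sup>2 * (b11 t * g2 s + (2 * \<alpha> * b11 t + d12 t) * g1 s) - 16 * y * w * h * F
          + 2 * \<Lambda> * Q t h (u2 s t)"
      proof -
        have p: "b11 t > 0" by (rule b11_pos)
        \<comment> \<open>The square is chosen so that its mixed term is exactly the cross term -16
          y w h F of the product rule.\<close>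
        have "0 \<le> 2 * (w * F - 4 * b11 t * y * h)\<^sup>2 / b11 t" using p by simp
        also have "\<dots> = 2 * w\<^sup>2 * (F\<^sup>2 / b11 t) - 16 * y * w * h * F + 32 * b11 t * y\<^sup>2 * h\<^sup>2"
          using p by (simp add: field_simps power2_eq_square)
        also have "\<dots> \<le> 2 * w\<^sup>2 * Q t (u11 s t) (u12 s t) - 16 * y * w * h * F + 32 * b11 t * y\<^sup>2 * h\<^sup>2"
          using mult_left_mono[OF Q_ge_flux[of t "u11 s t" "u12 s t"], of "2 * w\<^sup>2"] by (simp add: F_def)
        finally have 1: "0 \<le> 2 * w\<^sup>2 * Q t (u11 s t) (u12 s t) - 16 * y * w * h * F + 32 * b11 t * y\<^sup>2 * h\<^sup>2" .
        have a1: "\<bar>b11 t * g2 s\<bar> \<le> K1 * 12"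
        proof -
          have "\<bar>g2 s\<bar> \<le> 12" using y(1) zero_le_power2[of y] unfolding gg abs_le_iff by linarith
          then show ?thesis unfolding abs_mult using K1 by (intro mult_mono) auto
        qed
        have "\<bar>g1 s\<bar> \<le> 4 * 1"
        proof -
          have "\<bar>g1 s\<bar> = 4 * (\<bar>y\<bar> * \<bar>w\<bar>)" by (simp add: gg abs_mult)
          also have "\<bar>y\<bar> * \<bar>w\<bar> \<le> 1 * 1" using y z by (intro mult_mono) (auto simp: w_def)
          finally show ?thesis by simp
        qed
        moreover have "\<bar>2 * \<alpha> * b11 t + d12 t\<bar> \<le> 2 * \<alpha> * K1 + K2"
        proof -
          have "\<bar>2 * \<alpha> * b11 t + d12 t\<bar> \<le> 2 * \<alpha> * \<bar>b11 t\<bar> + \<bar>d12 t\<bar>"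
            using \<alpha>_pos abs_triangle_ineq[of "2 * \<alpha> * b11 t" "d12 t"] by (simp add: abs_mult)
          also have "\<dots> \<le> 2 * \<alpha> * K1 + K2"
            using K1(2)[of t] K2(2)[of t] \<alpha>_pos by (intro add_mono mult_left_mono) auto
          finally show ?thesis .
        qed
        ultimately have a2: "\<bar>(2 * \<alpha> * b11 t + d12 t) * g1 s\<bar> \<le> (2 * \<alpha> * K1 + K2) * 4"
          unfolding abs_mult by (intro mult_mono) auto
        have a3: "b11 t * y\<^sup>2 \<le> K1 * 1"
          using K1(2)[of t] y p by (intro mult_mono) auto
        have "- R \<le> b11 t * g2 s + (2 * \<alpha> * b11 t + d12 t) * g1 s - 32 * (b11 t * y\<^sup>2)"
          using a1 a2 a3 unfolding R_def by linarith
        from mult_left_mono[OF this, of "h\<^sup>2"]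
        have 2: "- R * h\<^sup>2 \<le> h\<^sup>2 * (b11 t * g2 s + (2 * \<alpha> * b11 t + d12 t) * g1 s) - 32 * b11 t * y\<^sup>2 * h\<^sup>2"
          by (simp add: algebra_simps)
        have 3: "R * h\<^sup>2 \<le> 2 * \<Lambda> * Q t h (u2 s t)"
          using mult_left_mono[OF c(2)[of h t "u2 s t"], of "2 * \<Lambda>"] \<Lambda> by (simp add: mult.assoc[symmetric])
        show ?thesis using 1 2 3 by linarith
      qed
      also have "\<dots> = u1 s t * u1 s t * (b11 t * g2 s + (2 * \<alpha> * b11 t + d12 t) * g1 s)
          + g s * (u1 s t * l1 s t + u1 s t * l1 s t + 2 * P t (u11 s t) (u12 s t) (u11 s t) (u12 s t))
          + 2 * P t (g1 s) 0 (u11 s t * u1 s t + u1 s t * u11 s t) (u12 s t * u1 s t + u1 s t * u12 s t)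
          + \<Lambda> * (u s t * l0 s t + u s t * l0 s t + 2 * P t (u1 s t) (u2 s t) (u1 s t) (u2 s t))"
        unfolding l0[OF sneg] P_def Q_def F_def h_def gg by (simp add: algebra_simps power2_eq_square)
      finally show "0 \<le> \<dots>" .
    qed (use s0 solution_jets(5)[OF u] solution_jets(5)[OF u1] in auto)
    moreover have "0 \<le> \<Lambda> * (u s0 t0 * u s0 t0)" using \<Lambda> by simp
    ultimately show ?thesis by (simp add: g_def power2_eq_square)
  qed
  then have "\<forall>s< - 1. \<forall>t. \<bar>u1 s t\<bar> \<le> sqrt (\<Lambda> * M\<^sup>2)"
    by (auto intro!: real_le_rsqrt)
  then show ?thesis by blast
qed

text \<open>Once \<open>u\<^sub>s\<close> and \<open>u\<^sub>s\<^sub>s\<close> are bounded, the equation is a first-order linear equation in \<open>t\<close> for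
  \<open>b22 u\<^sub>t + 2 b12 u\<^sub>s\<close> with bounded right-hand side and integrating factor \<open>\<psi>\<close>.\<close>

lemma angular_derivative_bound:
  assumes u: "solution u u1 u2 u11 u12 u22"
    and per2: "\<And>s t. s < 0 \<Longrightarrow> u2 s (t + 2 * pi) = u2 s t"
    and M: "\<And>s t. s < 0 \<Longrightarrow> \<bar>u1 s t\<bar> \<le> M" "\<And>s t. s < 0 \<Longrightarrow> \<bar>u11 s t\<bar> \<le> M"
  shows "\<exists>K. \<forall>s<0. \<forall>t. \<bar>u2 s t\<bar> \<le> K"
proof -
  have M0: "0 \<le> M" using M(1)[of "-1" 0] by linarith
  \<comment> \<open>The quantity \<psi> (b22 u_t + 2 b12 u_s) equals \<psi> b22 u_t + D u_s, and its
    t-derivative is A u_s - B u_ss: the equation removes u_tt and u_st, and the remaining multiple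
    of the quantity itself is cancelled by the derivative of \<psi>.\<close>
  define A where "A t = \<psi> t * (4 * \<alpha> * (b12 t)\<^sup>2 / b22 t - 2 * \<alpha> * b11 t + d12 t)" for t
  define B where "B t = \<psi> t * b11 t" for t
  define D where "D t = 2 * (\<psi> t * b12 t)" for t
  have nz: "b22 t \<noteq> 0" for t using b22_pos[of t] by simp
  have "continuous_on UNIV A"
    unfolding A_def by (intro continuous_intros \<psi>_cont b12_cont b22_cont b11_cont d12_cont) (use nz in auto)
  moreover have "continuous_on UNIV B" "continuous_on UNIV D"
    unfolding B_def D_def by (intro continuous_intros \<psi>_cont b11_cont b12_cont)+
  moreover have "A (t + 2*pi) = A t" "B (t + 2*pi) = B t" "D (t + 2*pi) = D t" for t
    by (simp_all add: A_def B_def D_def \<psi>_periodic b11_periodic b12_periodic b22_periodic d12_periodic)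
  ultimately obtain KA KB KD where K: "KA > 0" "\<And>t. \<bar>A t\<bar> \<le> KA" "KB > 0" "\<And>t. \<bar>B t\<bar> \<le> KB"
      "KD > 0" "\<And>t. \<bar>D t\<bar> \<le> KD"
    using periodic_bounded[of A] periodic_bounded[of B] periodic_bounded[of D] by metis
  obtain c where c: "c > 0" "\<And>t. c \<le> \<psi> t * b22 t"
    using periodic_bounded_below[of "\<lambda>t. \<psi> t * b22 t"] \<psi>_cont b22_cont \<psi>_periodic b22_periodic
      \<psi>_pos b22_pos by (auto intro: continuous_intros)
  define X where "X = KD * M + (KA * M + KB * M) * (2 * pi)"
  have main: "\<bar>u2 s t\<bar> \<le> (X + KD * M) / c" if s: "s < 0" and t: "t \<in> {0..2*pi}" for s t
  proof -
    define \<phi> where "\<phi> t = \<psi> t * (b22 t * u2 s t + 2 * b12 t * u1 s t)" for t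
    define \<phi>' where "\<phi>' t = A t * u1 s t - B t * u11 s t" for t
    have d: "(\<phi> has_real_derivative \<phi>' t) (at t)" for t
    proof -
      let ?q = "b22 t * u2 s t + 2 * b12 t * u1 s t"
      have "(\<phi> has_real_derivative (2 * \<alpha> * b12 t / b22 t * \<psi> t) * ?q
          + \<psi> t * (d22 t * u2 s t + b22 t * u22 s t + 2 * (d12 t * u1 s t + b12 t * u12 s t))) (at t)"
        unfolding \<phi>_def
        by (rule derivative_eq_intros \<psi>_deriv b22_deriv b12_deriv jet_partial2[OF solution_jets(3)[OF u] s]
            jet_partial2[OF solution_jets(4)[OF u] s] refl | simp add: algebra_simps)+
      moreover have u22: "u22 s t = - (b11 t * u11 s t + 2 * b12 t * u12 s t
           + (2 * \<alpha> * b11 t + d12 t) * u1 s t + (2 * \<alpha> * b12 t + d22 t) * u2 s t) / b22 t"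
        using solution_jets(6)[OF u s, of t] nz[of t] unfolding L_def by (simp add: field_simps)
      have "(2 * \<alpha> * b12 t / b22 t * \<psi> t) * ?q
          + \<psi> t * (d22 t * u2 s t + b22 t * u22 s t + 2 * (d12 t * u1 s t + b12 t * u12 s t)) = \<phi>' t"
        unfolding u22 using nz[of t] by (simp add: \<phi>'_def A_def B_def field_simps power2_eq_square)
      ultimately show ?thesis by simp
    qed
    have b: "\<bar>\<phi>' t\<bar> \<le> KA * M + KB * M" for t
    proof -
      have "\<bar>A t * u1 s t\<bar> \<le> KA * M" "\<bar>B t * u11 s t\<bar> \<le> KB * M"
        unfolding abs_mult using K(1,3) M0 by (intro mult_mono K M[OF s]; simp)+
      then show ?thesis unfolding \<phi>'_def by linarith
    qed
    \<comment> \<open>Periodicity gives u_t a zero on every circle, which supplies the initial value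
      for the integration in t.\<close>
    have "\<exists>m>0. m < 2*pi \<and> u s (2*pi) - u s 0 = (2*pi - 0) * u2 s m"
      by (rule MVT2) (auto intro: jet_partial2[OF solution_jets(2)[OF u] s])
    moreover have "u s (2*pi) = u s 0" using solution_jets(5)[OF u s, of 0] by simp
    ultimately obtain m where m: "0 < m" "m < 2*pi" "u2 s m = 0" by auto
    have Db: "\<bar>D t * u1 s t\<bar> \<le> KD * M" for t
      unfolding abs_mult using K(5) M0 by (intro mult_mono K M[OF s]; simp)
    have \<phi>m: "\<bar>\<phi> m\<bar> \<le> KD * M" using Db[of m] m by (simp add: \<phi>_def D_def algebra_simps)
    have "norm (\<phi> t - \<phi> m) \<le> (KA * M + KB * M) * norm (t - m)"
      by (rule field_differentiable_bound[of UNIV \<phi> \<phi>']) (use d b in auto)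
    also have "\<dots> \<le> (KA * M + KB * M) * (2 * pi)"
      using t m K M0 by (intro mult_left_mono) auto
    finally have "\<bar>\<phi> t\<bar> \<le> X" using \<phi>m by (simp add: X_def)
    moreover have "\<psi> t * b22 t * u2 s t = \<phi> t - D t * u1 s t"
      by (simp add: \<phi>_def D_def algebra_simps)
    ultimately have "\<bar>\<psi> t * b22 t * u2 s t\<bar> \<le> X + KD * M" using Db[of t] by linarith
    moreover have "c * \<bar>u2 s t\<bar> \<le> \<bar>\<psi> t * b22 t * u2 s t\<bar>"
      unfolding abs_mult[of "\<psi> t * b22 t"] using c(2)[of t] by (intro mult_right_mono) auto
    ultimately show ?thesis using c(1) by (simp add: pos_le_divide_eq mult.commute)
  qed
  have "\<bar>u2 s t\<bar> \<le> (X + KD * M) / c" if s: "s < 0" for s t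
  proof -
    obtain t' where "0 \<le> t'" "t' \<le> 2 * pi" "u2 s t = u2 s t'"
      by (rule periodic_representative[of "u2 s" "2*pi" t, OF per2[OF s]]) auto
    then show ?thesis using main[OF s, of t'] by auto
  qed
  then show ?thesis by blast
qed

end

section \<open>Caccioppoli inequality and selection of good circles\<close>

context cylinder_equation begin

text \<open>A Caccioppoli inequality for the quantity
  \<open>m(s) = \<integral> u (b11 u\<^sub>s + b12 u\<^sub>t) dt\<close>, which satisfies \<open>m' + 2\<alpha>m = \<integral> Q(\<nabla>u) dt\<close>; by the mean value
  theorem it controls the circle at one well-chosen height \<open>\<xi>\<close>.\<close>

lemma energy_estimate:
  assumes u: "solution u u1 u2 u11 u12 u22"
    and per2: "\<And>s t. s < 0 \<Longrightarrow> u1 s (t + 2 * pi) = u1 s t" "\<And>s t. s < 0 \<Longrightarrow> u2 s (t + 2 * pi) = u2 s t"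
    and c11: "continuous_on ({..<0} \<times> UNIV) (\<lambda>z. u11 (fst z) (snd z))"
    and c12: "continuous_on ({..<0} \<times> UNIV) (\<lambda>z. u12 (fst z) (snd z))"
    and c22: "\<And>s. s < 0 \<Longrightarrow> continuous_on UNIV (u22 s)"
  shows "\<exists>C>0. \<forall>S< - 1. \<exists>\<xi>\<in>{S..S+1}. \<forall>t.
     (u \<xi> t)\<^sup>2 \<le> C * integral {S..S+1} (\<lambda>s. integral {0..2*pi} (\<lambda>t. (u s t)\<^sup>2))"
proof -
  note j = solution_jets(2-4)[OF u]
  let ?I = "{0..2*pi}"
  have cj: "continuous_on T (u s)" "continuous_on T (u1 s)" "continuous_on T (u2 s)" if "s < 0" for s T
    using j that by (auto intro: jet_continuous_on')
  have cb: "continuous_on T b11" "continuous_on T b12" "continuous_on T b22" "continuous_on T d12" for T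
    using b11_cont b12_cont b22_cont d12_cont by (auto intro: continuous_on_subset)
  have cb2: "continuous_on T (\<lambda>z. b11 (snd z))" "continuous_on T (\<lambda>z. b12 (snd z))"
    for T :: "(real \<times> real) set"
    by (auto intro!: continuous_on_compose2[OF b11_cont] continuous_on_compose2[OF b12_cont] continuous_intros)
  note c2 = jet_continuous_on[OF j(1)] jet_continuous_on[OF j(2)] jet_continuous_on[OF j(3)] c11 c12
  define H where "H s = integral ?I (\<lambda>t. (u s t)\<^sup>2)" for s
  define F where "F s t = b11 t * u1 s t + b12 t * u2 s t" for s t
  define G where "G s t = b12 t * u1 s t + b22 t * u2 s t" for s t
  define m where "m s = integral ?I (\<lambda>t. u s t * F s t)" for s
  define IQ where "IQ s = integral ?I (\<lambda>t. Q t (u1 s t) (u2 s t))" for s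
  have cF: "continuous_on T (F s)" "continuous_on T (\<lambda>t. Q t (u1 s t) (u2 s t))" if "s < 0" for s T
    unfolding F_def Q_def by (intro continuous_intros cj cb that)+
  have int: "(\<lambda>t. u s t * F s t) integrable_on ?I" "(\<lambda>t. Q t (u1 s t) (u2 s t)) integrable_on ?I"
     "(\<lambda>t. (u s t)\<^sup>2) integrable_on ?I" "(\<lambda>t. (u2 s t)\<^sup>2) integrable_on ?I" if "s < 0" for s
    by (intro integrable_continuous_real continuous_intros cj cF that)+
  have Hd: "(H has_real_derivative integral ?I (\<lambda>t. 2 * u s t * u1 s t)) (at s)" if "s < 0" for s
    unfolding H_def[abs_def]
  proof (rule leibniz_cylinder)
    show "((\<lambda>x. (u x t)\<^sup>2) has_real_derivative 2 * u s t * u1 s t) (at s)" if "s < 0" for s t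
      by (auto intro!: derivative_eq_intros jet_partial1[OF j(1) that])
    show "continuous_on ({..<0} \<times> UNIV) (\<lambda>z. 2 * u (fst z) (snd z) * u1 (fst z) (snd z))"
      by (intro continuous_intros c2)
  qed (auto intro!: continuous_intros cj that)
  have md: "(m has_real_derivative IQ s - 2 * \<alpha> * m s) (at s)" if s: "s < 0" for s
  proof -
    define g where "g s t = u1 s t * F s t + u s t * (b11 t * u11 s t + b12 t * u12 s t)" for s t
    have "(m has_real_derivative integral ?I (g s)) (at s)"
      unfolding m_def[abs_def]
    proof (rule leibniz_cylinder)
      show "((\<lambda>x. u x t * F x t) has_real_derivative g s t) (at s)" if "s < 0" for s t
        unfolding F_def g_def
        by (auto intro!: derivative_eq_intros jet_partial1[OF j(1) that] jet_partial1[OF j(2) that]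
           jet_partial1[OF j(3) that] simp: algebra_simps)
      show "continuous_on ({..<0} \<times> UNIV) (\<lambda>z. g (fst z) (snd z))"
        unfolding g_def F_def by (intro continuous_intros c2 cb2)
    qed (auto intro!: continuous_intros cj cF s)
    moreover have "integral ?I (g s) = IQ s - 2 * \<alpha> * m s"
    proof -
      \<comment> \<open>The t-derivative of u times the angular flux \<open>G\<close>, whose
        integral over a full period vanishes; subtracting it is the integration by parts in
        t.\<close>
      define h where "h t = u2 s t * G s t + u s t * (d12 t * u1 s t + b12 t * u12 s t + d22 t * u2 s t + b22 t * u22 s t)" for t
      have "((\<lambda>t. u s t * G s t) has_real_derivative h t) (at t)" for t
        unfolding G_def h_def
        by (rule derivative_eq_intros jet_partial2[OF j(1) s] jet_partial2[OF j(2) s] jet_partial2[OF j(3) s]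
            b12_deriv b22_deriv refl | simp add: algebra_simps)+
      then have "(h has_integral (u s (2*pi) * G s (2*pi) - u s 0 * G s 0)) ?I"
        by (intro fundamental_theorem_of_calculus)
          (auto simp: has_real_derivative_iff_has_vector_derivative[symmetric] intro: has_field_derivative_at_within)
      moreover have "u s (2*pi) * G s (2*pi) - u s 0 * G s 0 = 0"
        using solution_jets(5)[OF u s, of 0] per2[OF s, of 0] b12_periodic[of 0] b22_periodic[of 0]
        by (simp add: G_def)
      ultimately have h: "(h has_integral 0) ?I" by simp
      have "((\<lambda>t. Q t (u1 s t) (u2 s t) - 2 * \<alpha> * (u s t * F s t) - h t) has_integral
          (IQ s - 2 * \<alpha> * m s - 0)) ?I"
        unfolding IQ_def m_def
        by (intro has_integral_diff has_integral_mult_right h integrable_integral int s)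
      moreover have "Q t (u1 s t) (u2 s t) - 2 * \<alpha> * (u s t * F s t) - h t = g s t" for t
      proof -
        have "b11 t * u11 s t + b12 t * u12 s t = - 2 * \<alpha> * F s t
            - (d12 t * u1 s t + b12 t * u12 s t + d22 t * u2 s t + b22 t * u22 s t)"
          using solution_jets(6)[OF u s, of t] by (simp add: L_def F_def algebra_simps)
        then have "g s t = u1 s t * F s t + u s t * (- 2 * \<alpha> * F s t
            - (d12 t * u1 s t + b12 t * u12 s t + d22 t * u2 s t + b22 t * u22 s t))"
          by (simp add: g_def)
        then show ?thesis
          by (simp add: h_def Q_def F_def G_def algebra_simps power2_eq_square)
      qed
      ultimately show ?thesis by (simp add: integral_unique)
    qed
    ultimately show ?thesis by simp
  qed
  obtain c where c: "c > 0" "\<And>t x y. c * y\<^sup>2 \<le> Q t x y" using Q_coercive by metis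
  obtain K where K: "K > 0" "\<And>t. \<bar>b11 t\<bar> \<le> K"
    using periodic_bounded[OF b11_cont b11_periodic] by blast
  \<comment> \<open>Half the upper bound for e^2 b11, where e = 2\<eta>' - 2\<alpha>\<eta> satisfies
    |e| \<le> 2(1 + \<alpha>): the loss in Young's inequality below.\<close>
  define C1 where "C1 = 2 * (1 + \<alpha>)\<^sup>2 * K"
  have C1: "C1 > 0" using K \<alpha>_pos by (simp add: C1_def)
  have H0: "0 \<le> H s" and IQ0: "0 \<le> IQ s" if "s < 0" for s
    unfolding H_def IQ_def by (intro integral_nonneg int that; simp add: Q_nonneg)+
  have IQU: "c * integral ?I (\<lambda>t. (u2 s t)\<^sup>2) \<le> IQ s" if "s < 0" for s
    unfolding IQ_def integral_mult_right[symmetric]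
    by (intro integral_le integrable_on_mult_right int that) (use c in auto)
  have main: "\<exists>\<xi>\<in>{S..S+1}. \<forall>t. (u \<xi> t)\<^sup>2 \<le> (6 * (C1 + 1) + 486 * (C1 + 1) / c) * integral {S..S+1} H"
    if S: "S < -1" for S
  proof -
    \<comment> \<open>Vanishes at both ends of the shell, which kills the boundary values of
      \<eta>^2 m, and is at least 1/9 on the middle third.\<close>
    define \<eta> where "\<eta> s = (s - S) * (S + 1 - s)" for s
    define \<eta>' where "\<eta>' s = 2 * S + 1 - 2 * s" for s
    define J where "J = integral {S..S+1} H"
    \<comment> \<open>The lower limit \<open>S - 1\<close> makes \<open>S\<close> an interior point
      of the interval of integration, so that \<open>R\<close> has a two-sided derivative on the
      whole closed shell.\<close>
    define R where "R s = integral {S-1..s} H" for s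
    \<comment> \<open>The multiple of \<open>R\<close> compensates the loss C1 H and leaves one
      further \<open>H\<close>. Hence \<open>W\<close> is nondecreasing and its derivative controls
      both the energy and the integral of u^2 on a circle.\<close>
    define W where "W s = (\<eta> s)\<^sup>2 * m s + (C1 + 1) * R s" for s
    define W' where "W' s = 2 * \<eta> s * \<eta>' s * m s + (\<eta> s)\<^sup>2 * (IQ s - 2 * \<alpha> * m s) + (C1 + 1) * H s" for s
    have contH: "continuous_on T H" if "T \<subseteq> {..<0}" for T
      by (intro continuous_at_imp_continuous_on ballI DERIV_isCont[OF Hd]) (use that in auto)
    have Rd: "(R has_real_derivative H s) (at s)" if "S \<le> s" "s \<le> S + 1" for s
    proof -
      have "(R has_real_derivative H s) (at s within {S-1..(S+1)/2})"
        unfolding R_def[abs_def] by (rule integral_has_real_derivative[OF contH]) (use that S in auto)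
      moreover have "at s within {S-1..(S+1)/2} = at s"
        by (rule at_within_interior) (use that S in auto)
      ultimately show ?thesis by simp
    qed
    have Wd: "(W has_real_derivative W' s) (at s)" if "S \<le> s" "s \<le> S + 1" for s
    proof -
      have "(\<eta> has_real_derivative \<eta>' s) (at s)"
        unfolding \<eta>_def[abs_def] \<eta>'_def by (auto intro!: derivative_eq_intros)
      then show ?thesis
        unfolding W_def[abs_def] W'_def using S that
        by (auto intro!: derivative_eq_intros md Rd)
    qed
    have W'_ge: "(\<eta> s)\<^sup>2 / 2 * IQ s + H s \<le> W' s" if s: "S \<le> s" "s \<le> S + 1" for s
    proof -
      have sn: "s < 0" using s S by auto
      define e where "e = 2 * \<eta>' s - 2 * \<alpha> * \<eta> s"
      have "\<bar>\<eta>' s\<bar> \<le> 1" using s by (auto simp: \<eta>'_def)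
      moreover have "0 \<le> \<eta> s" using s by (auto simp: \<eta>_def)
      moreover have "\<eta> s \<le> 1 * 1" unfolding \<eta>_def using s by (intro mult_mono) auto
      ultimately have "\<bar>e\<bar> \<le> 2 * 1 + 2 * \<alpha> * 1"
        unfolding e_def using \<alpha>_pos mult_left_mono[of "\<eta> s" 1 "2 * \<alpha>"] mult_nonneg_nonneg[of "2 * \<alpha>" "\<eta> s"] by linarith
      then have e: "e\<^sup>2 \<le> 4 * (1 + \<alpha>)\<^sup>2"
        using power_mono[of "\<bar>e\<bar>" "2 * (1 + \<alpha>)" 2] by (simp add: power2_eq_square algebra_simps)
      have pt: "(\<eta> s)\<^sup>2 / 2 * Q t (u1 s t) (u2 s t) - C1 * (u s t)\<^sup>2
          \<le> (\<eta> s)\<^sup>2 * Q t (u1 s t) (u2 s t) + \<eta> s * e * (u s t * F s t)" for t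
      proof -
        have p: "b11 t > 0" by (rule b11_pos)
        have "0 \<le> (\<eta> s * F s t + e * b11 t * u s t)\<^sup>2 / b11 t" using p by simp
        also have "\<dots> = (\<eta> s)\<^sup>2 * ((F s t)\<^sup>2 / b11 t) + 2 * (\<eta> s * e * (u s t * F s t)) + e\<^sup>2 * b11 t * (u s t)\<^sup>2"
          using p by (simp add: field_simps power2_eq_square)
        also have "\<dots> \<le> (\<eta> s)\<^sup>2 * Q t (u1 s t) (u2 s t) + 2 * (\<eta> s * e * (u s t * F s t)) + 2 * C1 * (u s t)\<^sup>2"
        proof -
          have "(F s t)\<^sup>2 / b11 t \<le> Q t (u1 s t) (u2 s t)" unfolding F_def by (rule Q_ge_flux)
          then have "(\<eta> s)\<^sup>2 * ((F s t)\<^sup>2 / b11 t) \<le> (\<eta> s)\<^sup>2 * Q t (u1 s t) (u2 s t)"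
            by (rule mult_left_mono) simp
          moreover have "e\<^sup>2 * b11 t \<le> 4 * (1 + \<alpha>)\<^sup>2 * K"
            using e K(2)[of t] p by (intro mult_mono) auto
          then have "e\<^sup>2 * b11 t * (u s t)\<^sup>2 \<le> 2 * C1 * (u s t)\<^sup>2"
            by (intro mult_right_mono) (auto simp: C1_def)
          ultimately show ?thesis by linarith
        qed
        finally show ?thesis by (simp add: field_simps)
      qed
      have "((\<lambda>t. (\<eta> s)\<^sup>2 / 2 * Q t (u1 s t) (u2 s t) - C1 * (u s t)\<^sup>2) has_integral
          ((\<eta> s)\<^sup>2 / 2 * IQ s - C1 * H s)) ?I"
        unfolding IQ_def H_def by (intro has_integral_diff has_integral_mult_right integrable_integral int sn)
      moreover have "((\<lambda>t. (\<eta> s)\<^sup>2 * Q t (u1 s t) (u2 s t) + \<eta> s * e * (u s t * F s t)) has_integral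
          ((\<eta> s)\<^sup>2 * IQ s + \<eta> s * e * m s)) ?I"
        unfolding IQ_def m_def by (intro has_integral_add has_integral_mult_right integrable_integral int sn)
      ultimately have "(\<eta> s)\<^sup>2 / 2 * IQ s - C1 * H s \<le> (\<eta> s)\<^sup>2 * IQ s + \<eta> s * e * m s"
        by (rule has_integral_le) (rule pt)
      then show ?thesis unfolding W'_def e_def by (simp add: algebra_simps power2_eq_square)
    qed
    have W'0: "0 \<le> W' s" if "S \<le> s" "s \<le> S + 1" for s
    proof -
      have "s < 0" using that S by linarith
      then have "0 \<le> (\<eta> s)\<^sup>2 / 2 * IQ s" "0 \<le> H s" by (auto intro!: mult_nonneg_nonneg IQ0 H0)
      then show ?thesis using W'_ge[OF that] by linarith
    qed
    have mono: "W x \<le> W y" if xy: "S \<le> x" "x \<le> y" "y \<le> S + 1" for x y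
    proof (rule DERIV_nonneg_imp_nondecreasing[OF xy(2)])
      fix z assume "x \<le> z" "z \<le> y"
      then show "\<exists>d. (W has_real_derivative d) (at z) \<and> 0 \<le> d"
        using Wd[of z] W'0[of z] xy by (intro exI[of _ "W' z"]) simp
    qed
    \<comment> \<open>On the middle third, of length 1/3, the mean value theorem selects a height
      where \<open>W'\<close> is at most three times the increase of \<open>W\<close> over the
      shell.\<close>
    have "\<exists>z>S+1/3. z < S+2/3 \<and> W (S+2/3) - W (S+1/3) = (S+2/3 - (S+1/3)) * W' z"
      by (rule MVT2) (auto intro: Wd)
    then obtain \<xi> where \<xi>: "S + 1/3 < \<xi>" "\<xi> < S + 2/3" "3 * (W (S+2/3) - W (S+1/3)) = W' \<xi>"
      by auto
    have "{S-1..S+1} \<subseteq> {..<0}" using S by auto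
    then have RJ: "R (S+1) - R S = J"
      unfolding R_def J_def
      using Henstock_Kurzweil_Integration.integral_combine[of "S-1" S "S+1" H] S
        integrable_continuous_real[OF contH, of "S-1" "S+1"] by auto
    have "W (S+1) - W S = (C1 + 1) * (R (S+1) - R S)"
      by (simp add: W_def \<eta>_def algebra_simps)
    then have "W (S+2/3) - W (S+1/3) \<le> (C1 + 1) * J"
      using mono[of S "S+1/3"] mono[of "S+2/3" "S+1"] RJ by simp
    then have "W' \<xi> \<le> 3 * ((C1 + 1) * J)" unfolding \<xi>(3)[symmetric] by (rule mult_left_mono) simp
    moreover have "S \<le> \<xi>" "\<xi> \<le> S + 1" using \<xi> by auto
    ultimately have le: "(\<eta> \<xi>)\<^sup>2 / 2 * IQ \<xi> + H \<xi> \<le> 3 * ((C1 + 1) * J)"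
      using W'_ge[of \<xi>] by (blast intro: order_trans)
    have sn: "\<xi> < 0" using \<xi> S by linarith
    \<comment> \<open>So \<eta>^2 / 2 is at least 1/162. In the final constant, 486 is 3 times 162
      for the angular energy and 6 is 3 times the factor 2 of the one-dimensional Sobolev
      inequality.\<close>
    have "1/3 * (1/3) \<le> \<eta> \<xi>" unfolding \<eta>_def using \<xi> by (intro mult_mono) auto
    then have "(1/9)\<^sup>2 \<le> (\<eta> \<xi>)\<^sup>2" by (intro power_mono) auto
    then have "1/162 * IQ \<xi> \<le> (\<eta> \<xi>)\<^sup>2 / 2 * IQ \<xi>"
      using IQ0[OF sn] by (intro mult_right_mono) (auto simp: power2_eq_square)
    then have l2: "1/162 * IQ \<xi> + H \<xi> \<le> 3 * ((C1 + 1) * J)" using le by linarith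
    have U: "integral ?I (\<lambda>t. (u2 \<xi> t)\<^sup>2) \<le> 486 * ((C1 + 1) * J) / c"
      using IQU[OF sn] l2 H0[OF sn] c(1) by (simp add: pos_le_divide_eq mult.commute)
    have bd: "(u \<xi> t)\<^sup>2 \<le> (6 * (C1 + 1) + 486 * (C1 + 1) / c) * J" if t: "t \<in> ?I" for t
    proof -
      have "(u \<xi> t)\<^sup>2 \<le> 2 * H \<xi> + integral ?I (\<lambda>t. (u2 \<xi> t)\<^sup>2)"
        unfolding H_def
        by (rule sobolev_circle[OF jet_partial2[OF j(1) sn] cj(3)[OF sn] t])
      also have "\<dots> \<le> 2 * (3 * ((C1 + 1) * J)) + 486 * ((C1 + 1) * J) / c"
        using l2 IQ0[OF sn] U by linarith
      finally show ?thesis by (simp add: algebra_simps)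
    qed
    have "(u \<xi> t)\<^sup>2 \<le> (6 * (C1 + 1) + 486 * (C1 + 1) / c) * J" for t
    proof -
      obtain t' where "0 \<le> t'" "t' \<le> 2 * pi" "u \<xi> t = u \<xi> t'"
        by (rule periodic_representative[of "u \<xi>" "2*pi" t, OF solution_jets(5)[OF u sn]]) auto
      then show ?thesis using bd[of t'] by auto
    qed
    then show ?thesis using \<xi> by (intro bexI[of _ \<xi>]) (auto simp: J_def)
  qed
  show ?thesis
    by (rule exI[of _ "6 * (C1 + 1) + 486 * (C1 + 1) / c"])
      (use main C1 c in \<open>auto simp: H_def[abs_def] intro!: add_pos_pos\<close>)
qed

end

text \<open>The interface between disc and cylinder: derivatives of every order within the class,
  well-definedness on the circle, and bounds on the outer part -1 \<le> s < 0 that express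
  regularity up to r = 1.\<close>

definition smooth_class :: "(real \<Rightarrow> real \<Rightarrow> real) set \<Rightarrow> bool" where
  "smooth_class \<C> \<longleftrightarrow> (\<forall>f\<in>\<C>. (\<exists>f1\<in>\<C>. \<exists>f2\<in>\<C>. jet f f1 f2) \<and>
     (\<forall>s<0. \<forall>t. f s (t + 2 * pi) = f s t) \<and> (\<exists>K. \<forall>s\<in>{-1..<0}. \<forall>t. \<bar>f s t\<bar> \<le> K))"

lemma smooth_classD:
  assumes "smooth_class \<C>" "f \<in> \<C>"
  shows "\<exists>f1\<in>\<C>. \<exists>f2\<in>\<C>. jet f f1 f2" "s < 0 \<Longrightarrow> f s (t + 2 * pi) = f s t"
    "\<exists>K. \<forall>s\<in>{-1..<0}. \<forall>t. \<bar>f s t\<bar> \<le> K"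
    "continuous_on ({..<0} \<times> UNIV) (\<lambda>z. f (fst z) (snd z))"
    "s < 0 \<Longrightarrow> continuous_on UNIV (f s)"
  using assms unfolding smooth_class_def by (blast intro: jet_continuous_on jet_continuous_on')+

lemma smooth_class_jet2:
  assumes C: "smooth_class \<C>" and "f1 \<in> \<C>" "f2 \<in> \<C>" "jet f f1 f2"
  shows "\<exists>f11\<in>\<C>. \<exists>f12\<in>\<C>. \<exists>f22\<in>\<C>. jet2 f f1 f2 f11 f12 f22"
proof -
  obtain f11 f12 where 1: "f11 \<in> \<C>" "f12 \<in> \<C>" "jet f1 f11 f12"
    using smooth_classD(1)[OF C assms(2)] by blast
  obtain f21 f22 where 2: "f21 \<in> \<C>" "f22 \<in> \<C>" "jet f2 f21 f22"
    using smooth_classD(1)[OF C assms(3)] by blast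
  have "f12 s t = f21 s t" if "s < 0" for s t
    by (rule jet_mixed_partials[OF assms(4) 1(3) 2(3) smooth_classD(4)[OF C 1(2)] smooth_classD(4)[OF C 2(1)] that])
  then have "jet f2 f12 f22" using jet_cong[OF 2(3)] by auto
  then show ?thesis using 1 2 assms(4) unfolding jet2_def by blast
qed

context cylinder_equation begin

lemma solution_axial_derivative:
  assumes C: "smooth_class \<C>" and u: "solution u u1 u2 u11 u12 u22"
    and "u1 \<in> \<C>" "u2 \<in> \<C>" "u11 \<in> \<C>" "u12 \<in> \<C>" "u22 \<in> \<C>"
  shows "\<exists>u111\<in>\<C>. \<exists>u112\<in>\<C>. \<exists>u122\<in>\<C>. solution u1 u11 u12 u111 u112 u122"
proof -
  obtain u111 u112 u122 where v: "u111 \<in> \<C>" "u112 \<in> \<C>" "u122 \<in> \<C>" "jet2 u1 u11 u12 u111 u112 u122"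
    using smooth_class_jet2[OF C assms(5,6) solution_jets(3)[OF u]] by blast
  obtain x11 x12 x22 where x: "jet2 u2 u12 u22 x11 x12 x22"
    using smooth_class_jet2[OF C assms(6,7) solution_jets(4)[OF u]] by blast
  have jets: "jet u1 u11 u12" "jet u11 u111 u112" "jet u12 u112 u122" "jet u12 x11 x12" "jet u22 x12 x22"
    using v x by (auto simp: jet2_def)
  have "L t (u11 s t) (u12 s t) (u111 s t) (u112 s t) (u122 s t) = 0" if s: "s < 0" for s t
  proof -
    \<comment> \<open>\<open>u12\<close> has one jet obtained from \<open>u1\<close> and another
      obtained from \<open>u2\<close>; comparing their t-derivatives identifies the s-derivative of
      \<open>u22\<close> with \<open>u122\<close>.\<close>
    have "x12 s t = u122 s t"
      using DERIV_unique[OF jet_partial2[OF jets(4) s] jet_partial2[OF jets(3) s]] by simp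
    then have 22: "((\<lambda>x. u22 x t) has_real_derivative u122 s t) (at s)"
      using jet_partial1[OF jets(5) s, of t] by simp
    have "((\<lambda>x. L t (u1 x t) (u2 x t) (u11 x t) (u12 x t) (u22 x t)) has_real_derivative
       L t (u11 s t) (u12 s t) (u111 s t) (u112 s t) (u122 s t)) (at s)"
      unfolding L_def
      by (auto intro!: derivative_eq_intros jet_partial1[OF jets(1) s] jet_partial1[OF jets(2) s]
          jet_partial1[OF jets(3) s] jet_partial1[OF solution_jets(4)[OF u] s] 22 simp: algebra_simps)
    moreover have "((\<lambda>x. L t (u1 x t) (u2 x t) (u11 x t) (u12 x t) (u22 x t)) has_real_derivative 0) (at s)"
      by (rule has_field_derivative_transform_within_open[of "\<lambda>_. 0" _ _ "{..<0}"])
        (use s solution_jets(6)[OF u] in auto)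
    ultimately show ?thesis by (rule DERIV_unique)
  qed
  then have "solution u1 u11 u12 u111 u112 u122"
    using v smooth_classD(2)[OF C assms(3)] by (simp add: solution_def)
  then show ?thesis using v by blast
qed

theorem cylinder_bounds:
  assumes C: "smooth_class \<C>" and u: "solution u u1 u2 u11 u12 u22"
    and mem: "u \<in> \<C>" "u1 \<in> \<C>" "u2 \<in> \<C>" "u11 \<in> \<C>" "u12 \<in> \<C>" "u22 \<in> \<C>"
    and \<gamma>: "0 \<le> \<gamma>" "\<gamma> < 2 * \<alpha>"
    and T: "\<And>S. S < -1 \<Longrightarrow>
      integral {S..S+1} (\<lambda>s. integral {0..2*pi} (\<lambda>t. (u s t)\<^sup>2)) \<le> T * exp (- 2 * \<gamma> * S)"
  shows "\<exists>K. \<forall>s<0. \<forall>t. \<bar>u s t\<bar> \<le> K \<and> \<bar>u1 s t\<bar> \<le> K \<and> \<bar>u2 s t\<bar> \<le> K"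
proof -
  obtain E where E: "E > 0" "\<And>S. S < -1 \<Longrightarrow> \<exists>\<xi>\<in>{S..S+1}. \<forall>t.
     (u \<xi> t)\<^sup>2 \<le> E * integral {S..S+1} (\<lambda>s. integral {0..2*pi} (\<lambda>t. (u s t)\<^sup>2))"
    using energy_estimate[OF u smooth_classD(2)[OF C mem(2)] smooth_classD(2)[OF C mem(3)]
       smooth_classD(4)[OF C mem(4)] smooth_classD(4)[OF C mem(5)] smooth_classD(5)[OF C mem(6)]] by blast
  \<comment> \<open>The selected height \<xi> is at most \<open>S' + 1\<close>, so e^{-2\<gamma>S'}
    is at most e^{2\<gamma>} e^{-2\<gamma>\<xi>}; taking roots gives this constant. The modulus is
    there because the sign of \<open>T\<close> is not prescribed.\<close>
  define D where "D = sqrt (E * \<bar>T\<bar>) * exp \<gamma>"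
  have grow: "\<exists>\<xi><S. \<forall>t. \<bar>u \<xi> t\<bar> \<le> D * exp (- \<gamma> * \<xi>)" for S
  proof -
    \<comment> \<open>The shift by 2 puts the whole unit shell below both \<open>S\<close> and
      -1.\<close>
    define S' where "S' = min S (-1) - 2"
    have S': "S' < -1" "S' + 1 < S" by (auto simp: S'_def)
    obtain \<xi> where \<xi>: "\<xi> \<in> {S'..S'+1}"
        "\<And>t. (u \<xi> t)\<^sup>2 \<le> E * integral {S'..S'+1} (\<lambda>s. integral {0..2*pi} (\<lambda>t. (u s t)\<^sup>2))"
      using E(2)[OF S'(1)] by blast
    have "\<bar>u \<xi> t\<bar> \<le> D * exp (- \<gamma> * \<xi>)" for t
    proof -
      have "(u \<xi> t)\<^sup>2 \<le> E * (T * exp (- 2 * \<gamma> * S'))"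
        using \<xi>(2)[of t] mult_left_mono[OF T[OF S'(1)], of E] E(1) by linarith
      also have "\<dots> \<le> E * (\<bar>T\<bar> * (exp \<gamma> * exp (- \<gamma> * \<xi>))\<^sup>2)"
      proof (intro mult_left_mono mult_mono)
        have "- 2 * \<gamma> * S' \<le> 2 * (\<gamma> + - \<gamma> * \<xi>)"
          using mult_left_mono[of "\<xi> - S'" 1 "2 * \<gamma>"] \<xi>(1) \<gamma>(1) by (simp add: algebra_simps)
        then show "exp (- 2 * \<gamma> * S') \<le> (exp \<gamma> * exp (- \<gamma> * \<xi>))\<^sup>2"
          by (simp add: exp_double[symmetric] flip: exp_add)
      qed (use E in auto)
      also have "\<dots> = (D * exp (- \<gamma> * \<xi>))\<^sup>2"
        using E(1) by (simp add: D_def power_mult_distrib)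
      finally have "\<bar>u \<xi> t\<bar> \<le> \<bar>D * exp (- \<gamma> * \<xi>)\<bar>" by (simp add: abs_le_square_iff)
      moreover have "0 \<le> D" using E(1) by (simp add: D_def)
      ultimately show ?thesis by simp
    qed
    then show ?thesis using \<xi>(1) S' by (intro exI[of _ \<xi>]) auto
  qed
  have outer: "\<exists>K\<ge>0. \<forall>s\<in>{-1..<0}. \<forall>t. \<bar>f s t\<bar> \<le> K" if f: "f \<in> \<C>" for f
  proof -
    obtain K where "\<forall>s\<in>{-1..<0}. \<forall>t. \<bar>f s t\<bar> \<le> K" using smooth_classD(3)[OF C f] by blast
    then show ?thesis by (intro exI[of _ "max 0 K"]) (auto simp: le_max_iff_disj)
  qed
  have outer_ext: "\<exists>K. \<forall>s<0. \<forall>t. \<bar>f s t\<bar> \<le> K" if f: "f \<in> \<C>" "\<exists>K. \<forall>s< - 1. \<forall>t. \<bar>f s t\<bar> \<le> K" for f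
  proof -
    obtain K K' where "\<forall>s\<in>{-1..<0}. \<forall>t. \<bar>f s t\<bar> \<le> K" "\<forall>s< - 1. \<forall>t. \<bar>f s t\<bar> \<le> K'"
      using outer[OF f(1)] f(2) by blast
    then have "\<bar>f s t\<bar> \<le> max K K'" if "s < 0" for s t
      using that by (cases "s < -1") (auto simp: le_max_iff_disj)
    then show ?thesis by blast
  qed
  obtain M where M: "M \<ge> 0" "\<And>s t. s \<in> {-1..<0} \<Longrightarrow> \<bar>u s t\<bar> \<le> M" using outer[OF mem(1)] by blast
  have "\<bar>u s t\<bar> \<le> M" if s: "s < -1" for s t
  proof -
    \<comment> \<open>The barrier argument is one-sided; it is applied to \<open>u\<close> and to
      its negative with the same \<open>M\<close> taken from the outer part.\<close>
    have neg: "solution (\<lambda>s t. (-1) * u s t) (\<lambda>s t. (-1) * u1 s t) (\<lambda>s t. (-1) * u2 s t)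
       (\<lambda>s t. (-1) * u11 s t) (\<lambda>s t. (-1) * u12 s t) (\<lambda>s t. (-1) * u22 s t)"
      using u jet2_cmult[OF solution_jets(1)[OF u], of "-1"] unfolding solution_def L_cmult by simp
    have "u s t \<le> M"
      by (rule barrier_upper_bound[OF u M(1) _ \<gamma>(2) _ s, where C = D])
        (use M(2)[of "-1"] grow in \<open>force simp: abs_le_iff\<close>)+
    moreover have "(-1) * u s t \<le> M"
      by (rule barrier_upper_bound[OF neg M(1) _ \<gamma>(2) _ s, where C = D])
        (use M(2)[of "-1"] grow in \<open>force simp: abs_le_iff\<close>)+
    ultimately show ?thesis by linarith
  qed
  then obtain K0 where K0: "\<And>s t. s < 0 \<Longrightarrow> \<bar>u s t\<bar> \<le> K0" using outer_ext[OF mem(1)] by blast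
  obtain u111 u112 u122 where v: "u111 \<in> \<C>" "u112 \<in> \<C>" "u122 \<in> \<C>" "solution u1 u11 u12 u111 u112 u122"
    using solution_axial_derivative[OF C u mem(2-6)] by blast
  \<comment> \<open>A second differentiation is needed because Bernstein's bound for u_ss requires
    that u_ss itself solves the equation.\<close>
  obtain u1111 u1112 u1122 where w: "solution u11 u111 u112 u1111 u1112 u1122"
    using solution_axial_derivative[OF C v(4) mem(4,5) v(1-3)] by blast
  obtain K1 where K1: "\<And>s t. s < 0 \<Longrightarrow> \<bar>u1 s t\<bar> \<le> K1"
    using outer_ext[OF mem(2) axial_derivative_bound[OF u v(4) K0]] by blast
  obtain K2 where K2: "\<And>s t. s < 0 \<Longrightarrow> \<bar>u11 s t\<bar> \<le> K2"
    using outer_ext[OF mem(4) axial_derivative_bound[OF v(4) w K1]] by blast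
  have "\<bar>u1 s t\<bar> \<le> max K1 K2" "\<bar>u11 s t\<bar> \<le> max K1 K2" if "s < 0" for s t
    using K1[OF that, of t] K2[OF that, of t] by auto
  then obtain K3 where K3: "\<And>s t. s < 0 \<Longrightarrow> \<bar>u2 s t\<bar> \<le> K3"
    using angular_derivative_bound[OF u smooth_classD(2)[OF C mem(3)]] by blast
  show ?thesis
    using K0 K1 K3 by (intro exI[of _ "max K0 (max K1 K3)"]) (auto simp: le_max_iff_disj)
qed

end

section \<open>Logarithmic polar coordinates\<close>

lemma polar_nth [simp]: "polar r t $ 1 = r * cos t" "polar r t $ 2 = r * sin t"
  by (simp_all add: polar_def)

lemma norm_polar [simp]: "norm (polar r t) = \<bar>r\<bar>"
proof -
  have "(r * cos t)\<^sup>2 + (r * sin t)\<^sup>2 = r\<^sup>2"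
    by (simp add: power_mult_distrib flip: distrib_left)
  then show ?thesis by (simp add: norm_vec_def L2_set_def sum_2)
qed

lemma polar_exp_in_punctured_disc: "s < 0 \<Longrightarrow> polar (exp s) t \<in> punctured_disc"
  using norm_polar[of "exp s" t] by (auto simp: punctured_disc_def disc_def simp del: norm_polar)

lemma punctured_disc_polar:
  assumes "x \<in> punctured_disc"
  obtains s t where "s < 0" "x = polar (exp s) t"
proof -
  have n: "0 < norm x" "norm x < 1" using assms by (auto simp: punctured_disc_def disc_def)
  have "(x $ 1 / norm x)\<^sup>2 + (x $ 2 / norm x)\<^sup>2 = ((x $ 1)\<^sup>2 + (x $ 2)\<^sup>2) / (norm x)\<^sup>2"
    by (simp add: power_divide add_divide_distrib)
  also have "(x $ 1)\<^sup>2 + (x $ 2)\<^sup>2 = (norm x)\<^sup>2"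
    by (simp add: norm_vec_def L2_set_def sum_2)
  finally obtain t where t: "x $ 1 / norm x = cos t" "x $ 2 / norm x = sin t"
    using n sincos_total_2pi[of "x $ 1 / norm x" "x $ 2 / norm x"] by auto
  have "x = polar (exp (ln (norm x))) t"
    unfolding vec_eq_iff forall_2 polar_nth t[symmetric] using n by simp
  then show ?thesis using that[of "ln (norm x)" t] n by simp
qed

lemma open_punctured_disc: "open punctured_disc"
proof -
  have "disc = ball 0 1" by (auto simp: disc_def)
  then show ?thesis by (metis open_ball open_delete punctured_disc_def)
qed

lemma has_derivative_partial:
  fixes g :: "real ^ 'n \<Rightarrow> real"
  assumes "g differentiable (at x)"
  shows "(g has_derivative (\<lambda>h. \<Sum>i\<in>UNIV. h $ i * partial i g x)) (at x)"
proof -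
  obtain D where D: "(g has_derivative D) (at x)" using assms by (auto simp: differentiable_def)
  interpret D: bounded_linear D using D by (rule has_derivative_bounded_linear)
  have p: "partial i g x = D (axis i 1)" for i
  proof -
    have "((\<lambda>t. x + t *\<^sub>R axis i 1) has_derivative (\<lambda>h. h *\<^sub>R axis i 1)) (at 0)"
      by (auto intro!: derivative_eq_intros)
    moreover have "(g has_derivative D) (at (x + 0 *\<^sub>R axis i 1))" using D by simp
    ultimately have "((\<lambda>t. g (x + t *\<^sub>R axis i 1)) has_derivative (\<lambda>h. D (h *\<^sub>R axis i 1))) (at 0)"
      by (rule has_derivative_compose)
    then have "((\<lambda>t. g (x + t *\<^sub>R axis i 1)) has_real_derivative D (axis i 1)) (at 0)"
      by (simp add: has_field_derivative_def D.scaleR mult_commute_abs)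
    then show ?thesis unfolding partial_def by (rule DERIV_imp_deriv)
  qed
  have q: "D h = (\<Sum>i\<in>UNIV. h $ i * D (axis i 1))" for h
  proof -
    have "h = (\<Sum>i\<in>UNIV. h $ i *\<^sub>R axis i 1)"
      using basis_expansion[of h] by (simp add: scalar_mult_eq_scaleR)
    then have "D h = D (\<Sum>i\<in>UNIV. h $ i *\<^sub>R axis i 1)" by (rule arg_cong)
    then show ?thesis by (simp add: D.sum D.scaleR)
  qed
  have "D = (\<lambda>h. \<Sum>i\<in>UNIV. h $ i * partial i g x)" unfolding p by (rule ext) (rule q)
  then show ?thesis using D by simp
qed

lemma jet_polar:
  assumes "\<And>x. x \<in> punctured_disc \<Longrightarrow> g differentiable (at x)"
  shows "jet (\<lambda>s t. g (polar (exp s) t))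
    (\<lambda>s t. exp s * cos t * partial 1 g (polar (exp s) t) + exp s * sin t * partial 2 g (polar (exp s) t))
    (\<lambda>s t. - (exp s * sin t) * partial 1 g (polar (exp s) t) + exp s * cos t * partial 2 g (polar (exp s) t))"
  unfolding jet_def
proof (intro allI impI)
  fix s t :: real assume s: "s < 0"
  define P' where "P' h = (vector [exp s * cos t * fst h - exp s * sin t * snd h,
      exp s * sin t * fst h + exp s * cos t * snd h] :: real ^ 2)" for h :: "real \<times> real"
  have "((\<lambda>z. polar (exp (fst z)) (snd z)) has_derivative P') (at (s, t))"
  proof (subst has_derivative_componentwise_within, intro ballI)
    fix b :: "real ^ 2" assume "b \<in> Basis"
    then have "b = axis 1 1 \<or> b = axis 2 1" by (auto simp: Basis_vec_def exhaust_2) (metis exhaust_2)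
    then show "((\<lambda>z. polar (exp (fst z)) (snd z) \<bullet> b) has_derivative (\<lambda>h. P' h \<bullet> b)) (at (s, t))"
      by (elim disjE; simp add: inner_axis P'_def; auto intro!: derivative_eq_intros simp: algebra_simps)
  qed
  from has_derivative_compose[OF this, of g, simplified,
      OF has_derivative_partial[OF assms[OF polar_exp_in_punctured_disc[OF s]]]]
  show "((\<lambda>z. g (polar (exp (fst z)) (snd z))) has_derivative
     (\<lambda>z. (exp s * cos t * partial 1 g (polar (exp s) t) + exp s * sin t * partial 2 g (polar (exp s) t)) * fst z
       + (- (exp s * sin t) * partial 1 g (polar (exp s) t) + exp s * cos t * partial 2 g (polar (exp s) t)) * snd z))
     (at (s, t))"
    by (rule has_derivative_eq_rhs) (auto simp: sum_2 P'_def algebra_simps fun_eq_iff)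
qed

text \<open>An algebra of functions containing \<open>v\<close> in logarithmic polar coordinates and closed under
  differentiation, so that no formulas for higher derivatives of the composition are needed.\<close>

inductive_set polar_class :: "(real ^ 2 \<Rightarrow> real) \<Rightarrow> (real \<Rightarrow> real \<Rightarrow> real) set" for v where
  base: "(\<lambda>s t. iter_partial is v (polar (exp s) t)) \<in> polar_class v"
| const: "(\<lambda>s t. c) \<in> polar_class v"
| X: "(\<lambda>s t. exp s * cos t) \<in> polar_class v"
| Y: "(\<lambda>s t. exp s * sin t) \<in> polar_class v"
| add: "f \<in> polar_class v \<Longrightarrow> g \<in> polar_class v \<Longrightarrow> (\<lambda>s t. f s t + g s t) \<in> polar_class v"
| mult: "f \<in> polar_class v \<Longrightarrow> g \<in> polar_class v \<Longrightarrow> (\<lambda>s t. f s t * g s t) \<in> polar_class v"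

lemma polar_class_uminus: "f \<in> polar_class v \<Longrightarrow> (\<lambda>s t. - f s t) \<in> polar_class v"
  using polar_class.mult[OF polar_class.const[of "-1"]] by fastforce

lemma polar_class_closed:
  assumes v: "smooth_on punctured_disc v" and "f \<in> polar_class v"
  shows "\<exists>f1\<in>polar_class v. \<exists>f2\<in>polar_class v. jet f f1 f2"
  using assms(2)
proof induction
  case (base "is")
  have "(\<lambda>s t. exp s * cos t * iter_partial (1 # is) v (polar (exp s) t)
      + exp s * sin t * iter_partial (2 # is) v (polar (exp s) t)) \<in> polar_class v"
    "(\<lambda>s t. - (exp s * sin t) * iter_partial (1 # is) v (polar (exp s) t)
      + exp s * cos t * iter_partial (2 # is) v (polar (exp s) t)) \<in> polar_class v"
    by (intro polar_class.add polar_class.mult polar_class_uminus polar_class.X polar_class.Y polar_class.base)+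
  moreover have "jet (\<lambda>s t. iter_partial is v (polar (exp s) t))
    (\<lambda>s t. exp s * cos t * iter_partial (1 # is) v (polar (exp s) t)
      + exp s * sin t * iter_partial (2 # is) v (polar (exp s) t))
    (\<lambda>s t. - (exp s * sin t) * iter_partial (1 # is) v (polar (exp s) t)
      + exp s * cos t * iter_partial (2 # is) v (polar (exp s) t))"
    unfolding iter_partial.simps by (rule jet_polar) (use v in \<open>auto simp: smooth_on_def\<close>)
  ultimately show ?case by blast
next
  case (const c)
  then show ?case using jet_const polar_class.const by blast
next
  case X
  have "jet (\<lambda>s t. exp s * cos t) (\<lambda>s t. exp s * cos t) (\<lambda>s t. - (exp s * sin t))"
    by (rule jet_cong[OF jet_mult[OF jet_axial[OF DERIV_exp] jet_angular[OF DERIV_cos]]]) auto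
  then show ?case using polar_class.X polar_class_uminus[OF polar_class.Y] by blast
next
  case Y
  have "jet (\<lambda>s t. exp s * sin t) (\<lambda>s t. exp s * sin t) (\<lambda>s t. exp s * cos t)"
    by (rule jet_cong[OF jet_mult[OF jet_axial[OF DERIV_exp] jet_angular[OF DERIV_sin]]]) auto
  then show ?case using polar_class.X polar_class.Y by blast
next
  case (add f g)
  then obtain f1 f2 g1 g2 where *: "f1 \<in> polar_class v" "f2 \<in> polar_class v"
    "g1 \<in> polar_class v" "g2 \<in> polar_class v" "jet f f1 f2" "jet g g1 g2" by blast
  show ?case
    using jet_add[OF *(5,6)] polar_class.add[OF *(1,3)] polar_class.add[OF *(2,4)] by blast
next
  case (mult f g)
  then obtain f1 f2 g1 g2 where *: "f1 \<in> polar_class v" "f2 \<in> polar_class v"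
    "g1 \<in> polar_class v" "g2 \<in> polar_class v" "jet f f1 f2" "jet g g1 g2" by blast
  have "(\<lambda>s t. f1 s t * g s t + f s t * g1 s t) \<in> polar_class v"
    "(\<lambda>s t. f2 s t * g s t + f s t * g2 s t) \<in> polar_class v"
    by (intro polar_class.add polar_class.mult * mult.hyps)+
  then show ?case using jet_mult[OF *(5,6)] by blast
qed

text \<open>Boundedness passes through sums and products. The essential case is an iterated partial
  derivative of \<open>v\<close>, which extends continuously to the compact annulus e^{-1} \<le> |x|
  \<le> 1.\<close>

lemma polar_class_bounded:
  assumes v: "v \<in> smooth_up_to punctured_disc ({x. norm x \<le> 1} - {0})" and "f \<in> polar_class v"
  shows "\<exists>K. \<forall>s\<in>{-1..<0}. \<forall>t. \<bar>f s t\<bar> \<le> K"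
  using assms(2)
proof induction
  case (base "is")
  obtain g where g: "continuous_on ({x. norm x \<le> 1} - {0}) g"
      "\<And>x. x \<in> punctured_disc \<Longrightarrow> g x = iter_partial is v x"
    using v unfolding smooth_up_to_def by blast
  let ?A = "cball 0 1 - ball (0 :: real ^ 2) (exp (-1))"
  have "compact (g ` ?A)"
  proof (rule compact_continuous_image[OF continuous_on_subset[OF g(1)] compact_diff])
    show "?A \<subseteq> {x. norm x \<le> 1} - {0}" by auto
  qed auto
  then have "bounded (g ` ?A)" by (rule compact_imp_bounded)
  then obtain K where K: "\<And>x. x \<in> ?A \<Longrightarrow> \<bar>g x\<bar> \<le> K"
    unfolding bounded_iff by (metis imageI real_norm_def)
  have "\<bar>iter_partial is v (polar (exp s) t)\<bar> \<le> K" if "s \<in> {-1..<0}" for s t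
    using K[of "polar (exp s) t"] g(2)[OF polar_exp_in_punctured_disc, of s t] that by auto
  then show ?case by blast
next
  case X
  then show ?case by (intro exI[of _ 1]) (auto simp: abs_mult intro!: mult_le_one)
next
  case Y
  then show ?case by (intro exI[of _ 1]) (auto simp: abs_mult intro!: mult_le_one)
next
  case (add f g)
  then obtain K L where "\<forall>s\<in>{-1..<0}. \<forall>t. \<bar>f s t\<bar> \<le> K" "\<forall>s\<in>{-1..<0}. \<forall>t. \<bar>g s t\<bar> \<le> L" by blast
  then show ?case by (intro exI[of _ "K + L"]) (auto intro!: order_trans[OF abs_triangle_ineq] add_mono)
next
  case (mult f g)
  then obtain K L where *: "\<forall>s\<in>{-1..<0}. \<forall>t. \<bar>f s t\<bar> \<le> K" "\<forall>s\<in>{-1..<0}. \<forall>t. \<bar>g s t\<bar> \<le> L" by blast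
  then have "0 \<le> K" using order_trans[OF abs_ge_zero, of "f (-1) 0" K] by auto
  then show ?case using * by (intro exI[of _ "K * L"]) (auto simp: abs_mult intro!: mult_mono)
qed auto

lemma polar_class_periodic: "f \<in> polar_class v \<Longrightarrow> f s (t + 2 * pi) = f s t"
  by (induction rule: polar_class.induct) (auto simp: polar_def)

lemma smooth_class_polar_class:
  assumes "v \<in> smooth_up_to punctured_disc ({x. norm x \<le> 1} - {0})"
  shows "smooth_class (polar_class v)"
  unfolding smooth_class_def
proof (intro ballI conjI allI impI)
  fix f assume f: "f \<in> polar_class v"
  have "smooth_on punctured_disc v" using assms by (simp add: smooth_up_to_def)
  then show "\<exists>f1\<in>polar_class v. \<exists>f2\<in>polar_class v. jet f f1 f2"
    by (rule polar_class_closed[OF _ f])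
qed (simp_all add: polar_class_periodic polar_class_bounded[OF assms])

section \<open>Integration over shells in logarithmic polar coordinates\<close>

lemma continuous_on_vector_2:
  fixes f g :: "'a::topological_space \<Rightarrow> real"
  assumes "continuous_on S f" "continuous_on S g"
  shows "continuous_on S (\<lambda>x. vector [f x, g x] :: real ^ 2)"
proof -
  have "continuous_on S (\<lambda>x. (\<chi> i. vector [f x, g x] $ i) :: real ^ 2)"
  proof (rule continuous_on_vec_lambda)
    show "continuous_on S (\<lambda>x. (vector [f x, g x] :: real ^ 2) $ i)" for i
      using exhaust_2[of i] assms by auto
  qed
  then show ?thesis by simp
qed

text \<open>Connects \<open>real ^ 2\<close>, where the Jacobian formula is applied, with pairs,
  where the iterated integral is taken: the coordinate map sends boxes to boxes of equal content and
  so preserves integrals.\<close>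

lemma integral_cbox_vector_2:
  fixes \<phi> :: "real ^ 2 \<Rightarrow> real"
  assumes c: "continuous_on (cbox (vector [a1, a2]) (vector [b1, b2])) \<phi>"
  shows "integral (cbox (vector [a1, a2]) (vector [b1, b2])) \<phi> =
    integral {a1..b1} (\<lambda>x. integral {a2..b2} (\<lambda>y. \<phi> (vector [x, y])))"
proof -
  let ?g = "\<lambda>z. vector [fst z, snd z] :: real ^ 2" and ?h = "\<lambda>y :: real ^ 2. (y $ 1, y $ 2)"
  let ?a = "vector [a1, a2] :: real ^ 2" and ?b = "vector [b1, b2] :: real ^ 2"
  have gh: "?g (?h x) = x" for x by (simp add: vec_eq_iff forall_2)
  have hg: "?h (?g z) = z" for z by simp
  have gbox: "?g ` cbox u v = cbox (?g u) (?g v)" for u v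
  proof (intro set_eqI iffI)
    fix x assume "x \<in> cbox (?g u) (?g v)"
    then have "?h x \<in> cbox u v"
      by (cases u; cases v) (simp add: mem_box_cart forall_2 cbox_Pair_eq)
    then show "x \<in> ?g ` cbox u v" by (rule rev_image_eqI) (rule gh[symmetric])
  qed (cases u; cases v; auto simp: mem_box_cart forall_2 cbox_Pair_eq)
  have hbox: "?h ` cbox u v = cbox (?h u) (?h v)" for u v
  proof -
    have "cbox u v = ?g ` cbox (?h u) (?h v)" unfolding gbox gh ..
    then show ?thesis by (simp add: image_image)
  qed
  have ex2: "(\<exists>i::2. R i) \<longleftrightarrow> R 1 \<or> R 2" for R by (metis exhaust_2)
  have content: "measure lborel (?g ` cbox u v) = 1 * measure lborel (cbox u v)" for u v
    unfolding gbox by (cases u; cases v)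
      (auto simp: content_cbox_if_cart interval_eq_empty_cart content_Pair content_real_if ex2 UNIV_2)
  have cg: "continuous_on T ?g" for T
    by (intro continuous_on_vector_2 continuous_intros)
  have cont: "continuous (at z) ?g" for z
    using cg[of UNIV] by (metis UNIV_I continuous_on_eq_continuous_at open_UNIV)
  have boxes: "\<exists>w z. ?g ` cbox u v = cbox w z" "\<exists>w z. ?h ` cbox u' v' = cbox w z" for u v u' v'
    using gbox hbox by blast+
  have "((\<lambda>z. \<phi> (?g z)) has_integral (1 / 1) *\<^sub>R integral (cbox ?a ?b) \<phi>) (?h ` cbox ?a ?b)"
    by (rule has_integral_twiddle[OF zero_less_one hg gh cont boxes content
          integrable_integral[OF integrable_continuous[OF c]]])
  then have "((\<lambda>z. \<phi> (?g z)) has_integral integral (cbox ?a ?b) \<phi>) (cbox (a1, a2) (b1, b2))"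
    by (simp add: hbox)
  then have "integral (cbox ?a ?b) \<phi> = integral (cbox (a1, a2) (b1, b2)) (\<lambda>z. \<phi> (?g z))"
    by (simp add: integral_unique)
  also have "\<dots> = integral (cbox a1 b1) (\<lambda>x. integral (cbox a2 b2) (\<lambda>y. \<phi> (?g (x, y))))"
  proof (rule integral_prod_continuous, rule continuous_on_compose2[OF c])
    show "continuous_on (cbox (a1, a2) (b1, b2)) ?g"
      by (rule cg)
    show "?g ` cbox (a1, a2) (b1, b2) \<subseteq> cbox ?a ?b" using gbox[of "(a1,a2)" "(b1,b2)"] by simp
  qed
  finally show ?thesis by simp
qed

text \<open>Logarithmic polar coordinates have Jacobian e^{2s} and map the open box injectively onto
  part of the disc; for nonnegative \<open>f\<close> the integral over this part is at most the
  integral over the disc.\<close>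

lemma polar_shell_integral:
  fixes f :: "real ^ 2 \<Rightarrow> real"
  assumes f: "f absolutely_integrable_on disc" "continuous_on punctured_disc f" "\<And>x. 0 \<le> f x"
    and S: "S < -1"
  shows "integral {S..S+1} (\<lambda>s. integral {0..2*pi} (\<lambda>t. exp (2 * s) * f (polar (exp s) t)))
    \<le> integral disc f"
proof -
  define g where "g y = polar (exp (y $ 1)) (y $ 2)" for y :: "real ^ 2"
  define g' where "g' y h = (vector [exp (y $ 1) * cos (y $ 2) * h $ 1 - exp (y $ 1) * sin (y $ 2) * h $ 2,
      exp (y $ 1) * sin (y $ 2) * h $ 1 + exp (y $ 1) * cos (y $ 2) * h $ 2] :: real ^ 2)" for y h :: "real ^ 2"
  \<comment> \<open>Angles in the open box differ by less than 2 pi, which makes \<open>g\<close>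
    injective; passing to the closed box later does not change the integral.\<close>
  define B where "B = box (vector [S, 0]) (vector [S + 1, 2 * pi] :: real ^ 2)"
  have g: "(g has_derivative g' y) (at y within T)" for y T
  proof (subst has_derivative_componentwise_within, intro ballI)
    fix b :: "real ^ 2" assume "b \<in> Basis"
    then have "b = axis 1 1 \<or> b = axis 2 1" by (auto simp: Basis_vec_def exhaust_2) (metis exhaust_2)
    then show "((\<lambda>y. g y \<bullet> b) has_derivative (\<lambda>h. g' y h \<bullet> b)) (at y within T)"
      by (elim disjE; simp add: inner_axis g_def g'_def;
          auto intro!: derivative_eq_intros bounded_linear_imp_has_derivative bounded_linear_vec_nth simp: algebra_simps)
  qed
  have det: "det (matrix (g' y)) = exp (2 * y $ 1)" for y
  proof -
    have "det (matrix (g' y)) = exp (y $ 1) * cos (y $ 2) * (exp (y $ 1) * cos (y $ 2))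
        + exp (y $ 1) * sin (y $ 2) * (exp (y $ 1) * sin (y $ 2))"
      by (simp add: det_2 matrix_def g'_def axis_def)
    also have "\<dots> = exp (y $ 1) * exp (y $ 1) * (cos (y $ 2) * cos (y $ 2) + sin (y $ 2) * sin (y $ 2))"
      by (simp only: algebra_simps)
    also have "\<dots> = exp (2 * y $ 1)" by (simp flip: exp_add)
    finally show ?thesis .
  qed
  have inj: "inj_on g B"
  proof (rule inj_onI)
    fix y z assume yz: "y \<in> B" "z \<in> B" "g y = g z"
    have e: "exp (y $ 1) = exp (z $ 1)" using arg_cong[OF yz(3), of norm] by (simp add: g_def)
    then have "cos (y $ 2) = cos (z $ 2)" "sin (y $ 2) = sin (z $ 2)"
      using arg_cong[OF yz(3), of "\<lambda>x. x $ 1"] arg_cong[OF yz(3), of "\<lambda>x. x $ 2"] by (auto simp: g_def)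
    then obtain n :: int where n: "y $ 2 = z $ 2 + 2 * pi * n" using sin_cos_eq_iff by blast
    have "\<bar>y $ 2 - z $ 2\<bar> < 2 * pi" using yz(1,2) by (auto simp: B_def mem_box_cart forall_2)
    then have "\<bar>real_of_int n\<bar> < 1" using n by (simp add: abs_mult)
    then have "n = 0" by linarith
    then show "y = z" using e n by (simp add: vec_eq_iff forall_2)
  qed
  have cb: "g y \<in> punctured_disc" if "y \<in> cbox (vector [S, 0]) (vector [S + 1, 2 * pi])" for y
    using that S unfolding g_def by (intro polar_exp_in_punctured_disc) (auto simp: mem_box_cart forall_2)
  have sub: "g ` B \<subseteq> punctured_disc"
    using cb box_subset_cbox unfolding B_def by blast
  have B: "B \<in> sets lebesgue" by (simp add: B_def)
  have "g ` B \<in> sets lebesgue"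
    by (rule differentiable_image_in_sets_lebesgue[OF B])
      (use g in \<open>auto simp: differentiable_on_def differentiable_def\<close>)
  moreover have disc: "g ` B \<subseteq> disc" using sub by (auto simp: punctured_disc_def)
  ultimately have int: "f absolutely_integrable_on (g ` B)"
    by (rule set_integrable_subset[OF f(1)])
  have "integral (g ` B) (\<lambda>x. vec (f x) :: real ^ 1) =
      integral B (\<lambda>x. \<bar>det (matrix (g' x))\<bar> *\<^sub>R vec (f (g x)))"
    by (rule integral_change_of_variables[OF B g inj]) (use int in \<open>simp add: absolutely_integrable_on_1_iff\<close>)
  then have "integral B (\<lambda>y. exp (2 * y $ 1) * f (g y)) = integral (g ` B) f"
    by (simp add: integral_on_1_eq det vec_eq_iff)
  also have "\<dots> \<le> integral disc f"
    by (rule integral_subset_le[OF disc absolutely_integrable_on_def[THEN iffD1, OF int, THEN conjunct1]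
          absolutely_integrable_on_def[THEN iffD1, OF f(1), THEN conjunct1]]) (use f(3) in blast)
  finally have "integral B (\<lambda>y. exp (2 * y $ 1) * f (g y)) \<le> integral disc f" .
  moreover have "integral B (\<lambda>y. exp (2 * y $ 1) * f (g y))
      = integral {S..S+1} (\<lambda>s. integral {0..2*pi} (\<lambda>t. exp (2 * s) * f (polar (exp s) t)))"
    unfolding B_def integral_open_interval
  proof (subst integral_cbox_vector_2)
    have "continuous_on T g" for T
      unfolding continuous_on_eq_continuous_within using has_derivative_continuous[OF g] by blast
    then show "continuous_on (cbox (vector [S, 0]) (vector [S + 1, 2 * pi])) (\<lambda>y. exp (2 * y $ 1) * f (g y))"
      using cb by (intro continuous_intros continuous_on_compose2[OF f(2)]) auto
  qed (simp add: g_def)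
  ultimately show ?thesis by simp
qed

lemma disc_in_sets_lebesgue: "disc \<in> sets lebesgue"
proof -
  have "disc = ball 0 1" by (auto simp: disc_def)
  then show ?thesis by (metis fmeasurableD lmeasurable_ball)
qed

lemma borel_measurable_disc:
  fixes f :: "real ^ 2 \<Rightarrow> 'b::euclidean_space"
  assumes "continuous_on punctured_disc f"
  shows "f \<in> borel_measurable (lebesgue_on disc)"
proof (rule measurable_discrete_difference[where X = "{0}"])
  have p: "punctured_disc \<in> sets lebesgue" using open_punctured_disc by auto
  have "f \<in> borel_measurable (lebesgue_on punctured_disc)"
    by (rule continuous_imp_measurable_on_sets_lebesgue[OF assms p])
  then show "(\<lambda>x. if x \<in> punctured_disc then f x else 0) \<in> borel_measurable (lebesgue_on disc)"
    by (intro measurable_restrict_space1) (simp add: borel_measurable_if[OF p])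
  show "{x} \<in> sets (lebesgue_on disc)" if "x \<in> {0}" for x
    using that disc_in_sets_lebesgue by (simp add: sets_restrict_space_iff disc_def)
qed (auto simp: punctured_disc_def)

text \<open>The Jacobian e^{2s} and the weight e^{2\<beta>s} combine to e^{2(\<beta>+1)s}, which on
  the shell from S to S + 1 is at least its value at S since \<beta> + 1 \<ge> 0. The constant is
  the integral of |v|^2 |x|^{2\<beta>} over the disc.\<close>

lemma weighted_shell_bound:
  fixes v :: "real ^ 2 \<Rightarrow> real"
  assumes v: "continuous_on punctured_disc v" and h: "\<And>x. 0 \<le> h x"
    and fin: "(\<integral>\<^sup>+x\<in>disc. ennreal (\<bar>v x\<bar>\<^sup>2 * norm x powr (2 * \<beta>) + h x) \<partial>lebesgue) < \<infinity>"
    and \<gamma>: "0 \<le> \<beta> + 1"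
  obtains T where "\<And>S. S < -1 \<Longrightarrow>
    integral {S..S+1} (\<lambda>s. integral {0..2*pi} (\<lambda>t. (v (polar (exp s) t))\<^sup>2)) \<le> T * exp (- 2 * (\<beta> + 1) * S)"
proof (rule that)
  define f where "f x = (v x)\<^sup>2 * norm x powr (2 * \<beta>)" for x
  fix S :: real assume S: "S < -1"
  have f0: "0 \<le> f x" for x by (simp add: f_def)
  have cf: "continuous_on punctured_disc f"
    unfolding f_def by (intro continuous_intros v) (auto simp: punctured_disc_def)
  have mf: "f \<in> borel_measurable (lebesgue_on disc)"
    by (rule borel_measurable_disc[OF cf])
  have "(\<integral>\<^sup>+x\<in>disc. ennreal (f x) \<partial>lebesgue) \<le> (\<integral>\<^sup>+x\<in>disc. ennreal (\<bar>v x\<bar>\<^sup>2 * norm x powr (2 * \<beta>) + h x) \<partial>lebesgue)"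
    by (intro nn_integral_mono mult_right_mono ennreal_leI) (auto simp: f_def h)
  then have "(\<integral>\<^sup>+x\<in>disc. ennreal (f x) \<partial>lebesgue) < \<infinity>" using fin by (rule le_less_trans)
  moreover note disc = disc_in_sets_lebesgue
  ultimately have "integrable (lebesgue_on disc) f"
    using mf f0 by (intro integrableI_nonneg) (auto simp: nn_integral_restrict_space)
  then have "f absolutely_integrable_on disc"
    using disc f0 by (simp add: absolutely_integrable_on_def set_integrable_def integrable_restrict_space)
  note shell = polar_shell_integral[OF this cf f0 S]
  let ?R = "{S..S+1} \<times> {0..2*pi}"
  define w where "w s t = v (polar (exp s) t)" for s t
  have cw: "continuous_on ?R (\<lambda>z. w (fst z) (snd z))"
    unfolding w_def
  proof (rule continuous_on_compose2[OF v])
    show "continuous_on ?R (\<lambda>z. polar (exp (fst z)) (snd z))"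
      unfolding polar_def by (intro continuous_on_vector_2 continuous_intros)
  qed (use S in \<open>auto intro!: polar_exp_in_punctured_disc\<close>)
  have f_eq: "exp (2 * s) * f (polar (exp s) t) = exp (2 * (\<beta> + 1) * s) * (w s t)\<^sup>2" for s t
    by (simp add: f_def w_def powr_def exp_add algebra_simps)
  have int: "(\<lambda>s. integral {0..2*pi} (\<lambda>t. c s * (w s t)\<^sup>2)) integrable_on {S..S+1}"
     "s \<in> {S..S+1} \<Longrightarrow> (\<lambda>t. c s * (w s t)\<^sup>2) integrable_on {0..2*pi}"
    if c: "continuous_on UNIV c" for c :: "real \<Rightarrow> real" and s
  proof -
    have "continuous_on ?R (\<lambda>z. c (fst z) * (w (fst z) (snd z))\<^sup>2)"
      by (intro continuous_intros cw continuous_on_compose2[OF c]) auto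
    then have *: "continuous_on ({S..S+1} \<times> cbox 0 (2*pi)) (\<lambda>(s, t). c s * (w s t)\<^sup>2)"
      by (simp add: split_beta)
    show "(\<lambda>s. integral {0..2*pi} (\<lambda>t. c s * (w s t)\<^sup>2)) integrable_on {S..S+1}"
      using integral_continuous_on_param[OF *] by (intro integrable_continuous_real) simp
    show "(\<lambda>t. c s * (w s t)\<^sup>2) integrable_on {0..2*pi}" if "s \<in> {S..S+1}"
      using that by (intro integrable_continuous_real continuous_on_compose2[OF *, of _ "\<lambda>t. (s, t)", simplified])
        (auto intro!: continuous_intros)
  qed
  have "exp (2 * (\<beta> + 1) * S) * integral {S..S+1} (\<lambda>s. integral {0..2*pi} (\<lambda>t. (w s t)\<^sup>2))
     = integral {S..S+1} (\<lambda>s. integral {0..2*pi} (\<lambda>t. exp (2 * (\<beta> + 1) * S) * (w s t)\<^sup>2))"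
    by simp
  also have "\<dots> \<le> integral {S..S+1} (\<lambda>s. integral {0..2*pi} (\<lambda>t. exp (2 * (\<beta> + 1) * s) * (w s t)\<^sup>2))"
  proof (intro integral_le int continuous_intros mult_right_mono)
    fix s assume "s \<in> {S..S+1}"
    then show "exp (2 * (\<beta> + 1) * S) \<le> exp (2 * (\<beta> + 1) * s)"
      using \<gamma> by (auto intro: mult_left_mono)
  qed auto
  finally have "exp (2 * (\<beta> + 1) * S) * integral {S..S+1} (\<lambda>s. integral {0..2*pi} (\<lambda>t. (v (polar (exp s) t))\<^sup>2))
     \<le> integral {S..S+1} (\<lambda>s. integral {0..2*pi} (\<lambda>t. exp (2 * s) * f (polar (exp s) t)))"
    unfolding f_eq w_def .
  then have le: "exp (2 * (\<beta> + 1) * S) * integral {S..S+1} (\<lambda>s. integral {0..2*pi} (\<lambda>t. (v (polar (exp s) t))\<^sup>2))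
     \<le> integral disc f"
    using shell by (rule order_trans)
  have "exp (- 2 * (\<beta> + 1) * S) * exp (2 * (\<beta> + 1) * S) = 1"
    by (simp add: algebra_simps flip: exp_add)
  with mult_left_mono[OF le, of "exp (- 2 * (\<beta> + 1) * S)"]
  show "integral {S..S+1} (\<lambda>s. integral {0..2*pi} (\<lambda>t. (v (polar (exp s) t))\<^sup>2))
      \<le> integral disc f * exp (- 2 * (\<beta> + 1) * S)"
    by (simp only: mult.assoc[symmetric] mult.commute[of "integral disc f"] mult_1_left exp_ge_zero)
qed

section \<open>The linearized equation\<close>

text \<open>Period 2 pi makes the coefficients functions on the full circle, and
  \<open>k > 1\<close> is the form in which \<alpha> > 0 enters.\<close>

locale profile =
  fixes p k :: real and a :: "real \<Rightarrow> real"
  assumes p: "p > 2" and k: "k > 1"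
    and smooth: "smooth_real a"
    and periodic: "\<And>t. a (t + 2 * pi) = a t"
    and nonzero: "\<exists>t. a t \<noteq> 0"
    and ode: "\<And>t. deriv (deriv a) t + V p k (a t) (deriv a t) * a t = 0"
begin

abbreviation "a1 \<equiv> deriv a"
abbreviation "a2 \<equiv> deriv (deriv a)"

text \<open>\<open>E\<close> is |\<nabla>f|^2 at r = 1, and \<open>W\<close> is the denominator of
  \<open>V\<close>. The functions \<open>b11\<close>, \<open>b12\<close>, \<open>b22\<close> are the
  entries of \<open>A_matrix\<close> without the power of r; \<open>E1\<close>, \<open>m1\<close>,
  \<open>d12\<close>, \<open>d22\<close> are the derivatives of \<open>E\<close>, \<open>m\<close>,
  \<open>b12\<close>, \<open>b22\<close>.\<close>

definition E where "E t = (a1 t)\<^sup>2 + k\<^sup>2 * (a t)\<^sup>2"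
definition E1 where "E1 t = 2 * a1 t * a2 t + k\<^sup>2 * (2 * a t * a1 t)"
definition W where "W t = (p - 1) * (a1 t)\<^sup>2 + k\<^sup>2 * (a t)\<^sup>2"
definition c where "c = (p - 1) * k\<^sup>2 - (p - 2) * k"
definition D where "D t = (p - 1) * (a1 t)\<^sup>2 + c * (a t)\<^sup>2"

definition m where "m t = E t powr ((p - 4) / 2)"
definition m1 where "m1 t = (p - 4) / 2 * E t powr ((p - 4) / 2 - 1) * E1 t"

definition b11 where "b11 t = m t * ((a1 t)\<^sup>2 + (p - 1) * k\<^sup>2 * (a t)\<^sup>2)"
definition b12 where "b12 t = m t * ((p - 2) * k * a t * a1 t)"
definition b22 where "b22 t = m t * (k\<^sup>2 * (a t)\<^sup>2 + (p - 1) * (a1 t)\<^sup>2)"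
definition d12 where "d12 t = m1 t * ((p - 2) * k * a t * a1 t) + m t * ((p - 2) * k * ((a1 t)\<^sup>2 + a t * a2 t))"
definition d22 where "d22 t = m1 t * (k\<^sup>2 * (a t)\<^sup>2 + (p - 1) * (a1 t)\<^sup>2)
    + m t * (k\<^sup>2 * (2 * a t * a1 t) + (p - 1) * (2 * a1 t * a2 t))"

definition \<psi> where "\<psi> t = exp (alpha_weight p k * (ln (E t) - ln (D t)))"

lemma derivs:
  "(a has_real_derivative a1 t) (at t)" "(a1 has_real_derivative a2 t) (at t)"
  "continuous_on UNIV a" "continuous_on UNIV a1" "continuous_on UNIV a2"
proof -
  have d: "((deriv ^^ n) a) differentiable (at t)" for n t using smooth by (auto simp: smooth_real_def)
  have d0: "a differentiable (at t)" "a1 differentiable (at t)" "a2 differentiable (at t)" for t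
    using d[of 0 t] d[of 1 t] d[of 2 t] by (auto simp: numeral_2_eq_2)
  then show "(a has_real_derivative a1 t) (at t)" "(a1 has_real_derivative a2 t) (at t)"
    by (simp_all add: DERIV_deriv_iff_real_differentiable)
  show "continuous_on UNIV a" "continuous_on UNIV a1" "continuous_on UNIV a2"
    using d0 by (auto intro!: continuous_at_imp_continuous_on differentiable_imp_continuous_within)
qed

lemma deriv_shift_periodic:
  assumes "\<And>t. f (t + 2 * pi) = f t" "\<And>t. (f has_real_derivative f' t) (at t)"
  shows "f' (t + 2 * pi) = f' t"
proof -
  have "((\<lambda>t. f (t + 2 * pi)) has_real_derivative f' (t + 2 * pi)) (at t)"
    using assms(2)[of "t + 2 * pi"] by (simp add: DERIV_shift)
  then have "(f has_real_derivative f' (t + 2 * pi)) (at t)" using assms(1) by simp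
  then show ?thesis using DERIV_unique assms(2) by blast
qed

lemma periodics: "a1 (t + 2 * pi) = a1 t" "a2 (t + 2 * pi) = a2 t"
  using deriv_shift_periodic[OF periodic derivs(1)] deriv_shift_periodic[OF _ derivs(2)] by blast+

text \<open>The numerator is a combination of y^2 and k^2 x^2, each at most the denominator. Where
  the denominator vanishes, division by zero makes \<open>V\<close> zero, so the bound
  persists.\<close>

lemma V_bounded: "\<bar>V p k x y\<bar> \<le> \<bar>(2 * p - 3) * k\<^sup>2 - (p - 2) * k\<bar> + \<bar>(p - 1) * k\<^sup>2 - (p - 2) * k\<bar>"
    (is "_ \<le> \<bar>?A\<bar> + \<bar>?B\<bar>")
proof -
  let ?w = "(p - 1) * y\<^sup>2 + k\<^sup>2 * x\<^sup>2"
  have y: "y\<^sup>2 \<le> ?w" using p mult_right_mono[of 1 "p - 1" "y\<^sup>2"] by (simp add: add_increasing2)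
  have x: "k\<^sup>2 * x\<^sup>2 \<le> ?w" using p by simp
  have w: "0 \<le> ?w" using p by simp
  have "\<bar>?A * y\<^sup>2 + ?B * k\<^sup>2 * x\<^sup>2\<bar> \<le> \<bar>?A\<bar> * y\<^sup>2 + \<bar>?B\<bar> * (k\<^sup>2 * x\<^sup>2)"
    using abs_triangle_ineq[of "?A * y\<^sup>2" "?B * k\<^sup>2 * x\<^sup>2"] by (simp add: abs_mult)
  also have "\<dots> \<le> \<bar>?A\<bar> * ?w + \<bar>?B\<bar> * ?w"
    using x y by (intro add_mono mult_left_mono) auto
  finally have "\<bar>?A * y\<^sup>2 + ?B * k\<^sup>2 * x\<^sup>2\<bar> \<le> (\<bar>?A\<bar> + \<bar>?B\<bar>) * ?w" by (simp add: algebra_simps)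
  then show ?thesis
    using w unfolding V_def by (cases "?w = 0") (simp_all add: abs_of_nonneg pos_divide_le_eq)
qed

section \<open>Positivity of the squared gradient along the profile\<close>

lemma E_deriv: "(E has_real_derivative E1 t) (at t)"
  unfolding E_def[abs_def] E1_def by (auto intro!: derivative_eq_intros derivs)

lemma E_nonneg: "0 \<le> E t" by (simp add: E_def)

text \<open>The equation turns \<open>E1\<close> into 2 a a_\<theta> (k^2 - V), where
  \<open>V\<close> is bounded and |2 a a_\<theta>| \<le> E because k > 1. This is the hypothesis of
  a Gronwall argument.\<close>

lemma E1_bound: "\<exists>M. \<forall>t. \<bar>E1 t\<bar> \<le> M * E t"
proof -
  define C where "C = \<bar>(2 * p - 3) * k\<^sup>2 - (p - 2) * k\<bar> + \<bar>(p - 1) * k\<^sup>2 - (p - 2) * k\<bar>"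
  have "\<bar>E1 t\<bar> \<le> (k\<^sup>2 + C) * E t" for t
  proof -
    let ?v = "V p k (a t) (a1 t)"
    have a2: "a2 t = - ?v * a t" using ode[of t] by linarith
    have "E1 t = (k\<^sup>2 - ?v) * (2 * (a t * a1 t))" by (simp add: E1_def a2 algebra_simps)
    then have "\<bar>E1 t\<bar> = \<bar>k\<^sup>2 - ?v\<bar> * \<bar>2 * (a t * a1 t)\<bar>" by (simp add: abs_mult)
    also have "\<dots> \<le> (k\<^sup>2 + C) * E t"
    proof (rule mult_mono)
      show "\<bar>k\<^sup>2 - ?v\<bar> \<le> k\<^sup>2 + C"
        using V_bounded[of "a t" "a1 t"] zero_le_power2[of k] unfolding C_def by linarith
      have "\<bar>2 * (a t * a1 t)\<bar> \<le> (a1 t)\<^sup>2 + (a t)\<^sup>2"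
        using sum_squares_bound[of "\<bar>a t\<bar>" "\<bar>a1 t\<bar>"] by (simp add: abs_mult)
      also have "\<dots> \<le> E t"
        using k mult_right_mono[of 1 "k\<^sup>2" "(a t)\<^sup>2"] by (simp add: E_def one_le_power)
      finally show "\<bar>2 * (a t * a1 t)\<bar> \<le> E t" .
    qed (auto simp: C_def)
    finally show ?thesis .
  qed
  then show ?thesis by blast
qed

text \<open>Gronwall in both directions: E e^{-Mt} is nonincreasing and E e^{Mt} is nondecreasing,
  so a single zero of \<open>E\<close> would spread over the whole line and make \<open>a\<close>
  vanish identically.\<close>

lemma E_pos: "E t > 0"
proof (rule ccontr)
  assume "\<not> E t > 0"
  then have E0: "E t = 0" using E_nonneg[of t] by linarith
  obtain M where M: "\<And>t. \<bar>E1 t\<bar> \<le> M * E t" using E1_bound by blast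
  have "E s \<le> 0" for s
  proof (cases "t \<le> s")
    case True
    have "E s * exp (- M * s) \<le> E t * exp (- M * t)"
    proof (rule DERIV_nonpos_imp_nonincreasing[OF True])
      fix x
      have "((\<lambda>x. E x * exp (- M * x)) has_real_derivative (E1 x - M * E x) * exp (- M * x)) (at x)"
        by (auto intro!: derivative_eq_intros E_deriv simp: algebra_simps)
      moreover have "(E1 x - M * E x) * exp (- M * x) \<le> 0"
        using M[of x] by (intro mult_nonpos_nonneg) auto
      ultimately show "\<exists>y. ((\<lambda>x. E x * exp (- M * x)) has_real_derivative y) (at x) \<and> y \<le> 0" by blast
    qed
    then show ?thesis using E0 by (simp add: mult_le_0_iff)
  next
    case False
    then have st: "s \<le> t" by simp
    have "E s * exp (M * s) \<le> E t * exp (M * t)"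
    proof (rule DERIV_nonneg_imp_nondecreasing[OF st])
      fix x
      have "((\<lambda>x. E x * exp (M * x)) has_real_derivative (E1 x + M * E x) * exp (M * x)) (at x)"
        by (auto intro!: derivative_eq_intros E_deriv simp: algebra_simps)
      moreover have "0 \<le> (E1 x + M * E x) * exp (M * x)"
        using M[of x] by (intro mult_nonneg_nonneg) auto
      ultimately show "\<exists>y. ((\<lambda>x. E x * exp (M * x)) has_real_derivative y) (at x) \<and> 0 \<le> y" by blast
    qed
    then show ?thesis using E0 by (simp add: mult_le_0_iff)
  qed
  then have "E s = 0" for s using E_nonneg[of s] by (meson order_antisym)
  then have "a s = 0" for s
    using k zero_le_power2[of "a1 s"] by (simp add: E_def add_nonneg_eq_0_iff)
  then show False using nonzero by simp
qed

lemma c_pos: "c > 0"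
proof -
  have "c = k * ((p - 1) * (k - 1) + 1)" by (simp add: c_def algebra_simps power2_eq_square)
  also have "\<dots> > 0" using p k by (intro mult_pos_pos add_nonneg_pos) auto
  finally show ?thesis .
qed

lemma quadratic_pos: "x > 0 \<Longrightarrow> y > 0 \<Longrightarrow> x * (a1 t)\<^sup>2 + y * (a t)\<^sup>2 > 0"
  using E_pos[of t] by (cases "a t = 0"; cases "a1 t = 0") (auto simp: E_def add_pos_nonneg add_nonneg_pos)

lemma D_pos: "D t > 0" and W_pos: "W t > 0"
  unfolding D_def W_def using p k c_pos by (auto intro!: quadratic_pos)

lemma D_deriv: "(D has_real_derivative (p - 1) * (2 * a1 t * a2 t) + c * (2 * a t * a1 t)) (at t)"
  unfolding D_def[abs_def] by (auto intro!: derivative_eq_intros derivs)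

lemma m_pos: "m t > 0" using E_pos[of t] by (simp add: m_def)

lemma m_deriv: "(m has_real_derivative m1 t) (at t)"
  unfolding m_def[abs_def] m1_def using E_pos[of t]
  by (auto intro!: derivative_eq_intros E_deriv simp: powr_diff)

text \<open>The logarithmic derivative of \<open>(E/D)\<^sup>\<alpha>\<close> was found by integrating \<open>2\<alpha> b12/b22\<close>, which is a rational
  function of \<open>a\<^sub>\<theta>/a\<close>, along the equation for \<open>a\<close>.\<close>

lemma \<psi>_deriv:
  "(\<psi> has_real_derivative 2 * alpha_weight p k * b12 t / b22 t * \<psi> t) (at t)"
proof -
  let ?D1 = "(p - 1) * (2 * a1 t * a2 t) + c * (2 * a t * a1 t)"
  have d: "(\<psi> has_real_derivative \<psi> t * (alpha_weight p k * (E1 t / E t - ?D1 / D t))) (at t)"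
    unfolding \<psi>_def[abs_def] using E_pos[of t] D_pos[of t]
    by (auto intro!: derivative_eq_intros E_deriv D_deriv)
  have q: "E1 t / E t - ?D1 / D t = 2 * ((p - 2) * k * a t * a1 t) / W t"
  proof -
    \<comment> \<open>The numerator of \<open>V\<close>. Once the equation is multiplied by
      \<open>W\<close>, the claim about the logarithmic derivative becomes a polynomial identity in
      a, a_\<theta>, p and k.\<close>
    define n where "n = ((2 * p - 3) * k\<^sup>2 - (p - 2) * k) * (a1 t)\<^sup>2 + ((p - 1) * k\<^sup>2 - (p - 2) * k) * k\<^sup>2 * (a t)\<^sup>2"
    have "a2 t = - (n / W t) * a t" using ode[of t] unfolding V_def n_def W_def by linarith
    then have a2W: "a2 t * W t = - n * a t" using W_pos[of t] by simp
    have "(E1 t * D t - ?D1 * E t) * W t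
      = 2 * a1 t * ((a2 t * W t) * (D t - (p - 1) * E t) + a t * W t * (k\<^sup>2 * D t - c * E t))"
      by (simp add: E1_def algebra_simps)
    also have "\<dots> = 2 * a1 t * a t * (- n * (D t - (p - 1) * E t) + W t * (k\<^sup>2 * D t - c * E t))"
      unfolding a2W by (simp add: algebra_simps)
    also have "\<dots> = 2 * a1 t * a t * ((p - 2) * k * (E t * D t))"
      unfolding n_def D_def E_def W_def c_def by algebra
    finally have "(E1 t * D t - ?D1 * E t) * W t = 2 * ((p - 2) * k * a t * a1 t) * (E t * D t)"
      by (simp add: algebra_simps)
    moreover have "E1 t / E t - ?D1 / D t = (E1 t * D t - ?D1 * E t) / (E t * D t)"
      using E_pos[of t] D_pos[of t] by (simp add: diff_frac_eq)
    ultimately show ?thesis using E_pos[of t] D_pos[of t] W_pos[of t]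
      by (simp add: frac_eq_eq)
  qed
  have b: "b12 t / b22 t = (p - 2) * k * a t * a1 t / W t"
    using m_pos[of t] by (simp add: b12_def b22_def W_def add.commute)
  have "\<psi> t * (alpha_weight p k * (E1 t / E t - ?D1 / D t))
      = \<psi> t * (alpha_weight p k * (2 * (b12 t / b22 t)))"
    unfolding q b by simp
  also have "\<dots> = 2 * alpha_weight p k * b12 t / b22 t * \<psi> t" by simp
  finally show ?thesis using d by simp
qed

lemma is_cylinder_equation: "cylinder_equation (alpha_weight p k) b11 b12 b22 d12 d22 \<psi>"
proof
  show "alpha_weight p k > 0" using p k by (simp add: alpha_weight_def)
  show "(b12 has_real_derivative d12 t) (at t)" for t
    unfolding b12_def[abs_def] d12_def
    by (auto intro!: derivative_eq_intros m_deriv derivs simp: algebra_simps power2_eq_square)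
  show "(b22 has_real_derivative d22 t) (at t)" for t
    unfolding b22_def[abs_def] d22_def
    by (auto intro!: derivative_eq_intros m_deriv derivs simp: algebra_simps power2_eq_square)
  have cE: "continuous_on UNIV E" "continuous_on UNIV E1"
    unfolding E_def[abs_def] E1_def[abs_def] by (intro continuous_intros derivs)+
  have nz: "E t \<noteq> 0" for t using E_pos[of t] by simp
  have cm: "continuous_on UNIV m" "continuous_on UNIV m1"
    unfolding m_def[abs_def] m1_def[abs_def] by (intro continuous_intros cE; use nz in simp)+
  show "continuous_on UNIV b11" "continuous_on UNIV d12"
    unfolding b11_def[abs_def] d12_def[abs_def] by (intro continuous_intros cm derivs)+
  have E_per: "E (t + 2 * pi) = E t" "E1 (t + 2 * pi) = E1 t" "D (t + 2 * pi) = D t" for t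
    by (simp_all add: E_def E1_def D_def periodic periodics)
  then have "m (t + 2 * pi) = m t" "m1 (t + 2 * pi) = m1 t" for t
    by (simp_all add: m_def m1_def)
  then show "b11 (t + 2 * pi) = b11 t" "b12 (t + 2 * pi) = b12 t" "b22 (t + 2 * pi) = b22 t"
    "d12 (t + 2 * pi) = d12 t" for t
    by (simp_all add: b11_def b12_def b22_def d12_def periodic periodics)
  show "\<psi> (t + 2 * pi) = \<psi> t" for t by (simp add: \<psi>_def E_per)
  show "b22 t > 0" for t
    using mult_pos_pos[OF m_pos[of t] W_pos[of t]] by (simp add: b22_def W_def add.commute)
  show "b11 t * b22 t - (b12 t)\<^sup>2 > 0" for t
  proof -
    \<comment> \<open>Without \<open>m\<close> the matrix is E times the identity plus p - 2 times
      the outer square of (k a, a_\<theta>), a vector of squared length \<open>E\<close>; its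
      eigenvalues are therefore \<open>E\<close> and (p - 1) E.\<close>
    have "b11 t * b22 t - (b12 t)\<^sup>2 = (m t)\<^sup>2 * ((p - 1) * (E t)\<^sup>2)"
      unfolding b11_def b12_def b22_def E_def by algebra
    also have "\<dots> > 0" using m_pos[of t] E_pos[of t] p by simp
    finally show ?thesis .
  qed
  show "(\<psi> has_real_derivative 2 * alpha_weight p k * b12 t / b22 t * \<psi> t) (at t)" for t
    by (rule \<psi>_deriv)
  show "\<psi> t > 0" for t by (simp add: \<psi>_def)
qed

section \<open>The linearized equation on the cylinder\<close>

lemma A_matrix_eq: "A_matrix p k a r t =
   (r powr (2 * alpha_weight p k)) *\<^sub>R vector [vector [b11 t, b12 t], vector [b12 t, b22 t]]"
  by (simp add: A_matrix_def Let_def b11_def b12_def b22_def m_def E_def alpha_weight_def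
      vec_eq_iff forall_2)

text \<open>With r = e^s the frame gradient is (u_s, u_t)/r, so the frame divergence of the flux is
  the cylinder operator multiplied by the positive factor r^{2\<alpha>-2}.\<close>

lemma linearized_solution_cylinder:
  assumes v: "linearized_solution p k a v"
    and u: "jet2 (\<lambda>s t. v (polar (exp s) t)) u1 u2 u11 u12 u22"
    and d: "\<And>t. (b12 has_real_derivative d12 t) (at t)" "\<And>t. (b22 has_real_derivative d22 t) (at t)"
    and s: "s < 0"
  shows "b11 t * u11 s t + 2 * b12 t * u12 s t + b22 t * u22 s t
     + (2 * alpha_weight p k * b11 t + d12 t) * u1 s t + (2 * alpha_weight p k * b12 t + d22 t) * u2 s t = 0"
proof -
  define q where "q = 2 * alpha_weight p k"
  define r where "r = exp s"
  have r: "0 < r" "r < 1" "ln r = s" using s by (auto simp: r_def)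
  have j: "jet (\<lambda>s t. v (polar (exp s) t)) u1 u2" "jet u1 u11 u12" "jet u2 u12 u22"
    using u by (auto simp: jet2_def)
  have ln_neg: "ln x < 0" if "x \<in> {0<..<1}" for x :: real using that by simp
  define F where "F x \<tau> = A_matrix p k a x \<tau> *v frame_grad (\<lambda>s \<tau>. v (polar s \<tau>)) x \<tau>" for x \<tau>
  have F: "F x \<tau> $ 1 = x powr q * (b11 \<tau> * (u1 (ln x) \<tau> / x) + b12 \<tau> * (u2 (ln x) \<tau> / x))"
     "F x \<tau> $ 2 = x powr q * (b12 \<tau> * (u1 (ln x) \<tau> / x) + b22 \<tau> * (u2 (ln x) \<tau> / x))"
    if x: "x \<in> {0<..<1}" for x \<tau>
  proof -
    have "((\<lambda>y. v (polar (exp (ln y)) \<tau>)) has_real_derivative u1 (ln x) \<tau> * (1 / x)) (at x)"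
      using x by (intro DERIV_chain2[where g = ln, OF jet_partial1[OF j(1) ln_neg[OF x]]])
         (auto intro!: derivative_eq_intros)
    then have "((\<lambda>y. v (polar y \<tau>)) has_real_derivative u1 (ln x) \<tau> * (1 / x)) (at x)"
      by (rule has_field_derivative_transform_within_open[of _ _ _ "{0<..<1}"]) (use x in auto)
    then have 1: "deriv (\<lambda>y. v (polar y \<tau>)) x = u1 (ln x) \<tau> / x" by (simp add: DERIV_imp_deriv)
    have "((\<lambda>\<tau>. v (polar (exp (ln x)) \<tau>)) has_real_derivative u2 (ln x) \<tau>) (at \<tau>)"
      by (rule jet_partial2[OF j(1) ln_neg[OF x]])
    then have 2: "deriv (\<lambda>\<tau>. v (polar x \<tau>)) \<tau> = u2 (ln x) \<tau>"
      using x by (simp add: DERIV_imp_deriv)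
    show "F x \<tau> $ 1 = x powr q * (b11 \<tau> * (u1 (ln x) \<tau> / x) + b12 \<tau> * (u2 (ln x) \<tau> / x))"
     "F x \<tau> $ 2 = x powr q * (b12 \<tau> * (u1 (ln x) \<tau> / x) + b22 \<tau> * (u2 (ln x) \<tau> / x))"
      unfolding F_def A_matrix_eq frame_grad_def 1 2 q_def[symmetric]
      by (simp_all add: matrix_vector_mult_def sum_2 algebra_simps)
  qed
  have "((\<lambda>x. x powr q * (b11 t * u1 (ln x) t + b12 t * u2 (ln x) t)) has_real_derivative
      q * r powr (q - 1) * (b11 t * u1 s t + b12 t * u2 s t)
      + r powr q * (b11 t * (u11 s t * (1 / r)) + b12 t * (u12 s t * (1 / r)))) (at r)"
  proof -
    have ld: "(ln has_real_derivative 1 / r) (at r)" using r by (auto intro!: derivative_eq_intros)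
    have "((\<lambda>x. u1 (ln x) t) has_real_derivative u11 s t * (1 / r)) (at r)"
      "((\<lambda>x. u2 (ln x) t) has_real_derivative u12 s t * (1 / r)) (at r)"
      using DERIV_chain2[OF _ ld, of "\<lambda>x. u1 x t"] DERIV_chain2[OF _ ld, of "\<lambda>x. u2 x t"]
        jet_partial1[OF j(2) s] jet_partial1[OF j(3) s] r by auto
    moreover have "((\<lambda>x. x powr q) has_real_derivative q * r powr (q - 1)) (at r)"
      using r by (rule_tac has_real_derivative_powr)
    ultimately show ?thesis
      using r by (auto intro!: derivative_eq_intros simp: algebra_simps)
  qed
  then have "((\<lambda>x. x * F x t $ 1) has_real_derivative
      q * r powr (q - 1) * (b11 t * u1 s t + b12 t * u2 s t)
      + r powr q * (b11 t * (u11 s t * (1 / r)) + b12 t * (u12 s t * (1 / r)))) (at r)"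
    by (rule has_field_derivative_transform_within_open[of _ _ _ "{0<..<1}"])
      (use r in \<open>auto simp: F(1) field_simps\<close>)
  then have D1: "deriv (\<lambda>x. x * F x t $ 1) r = q * r powr (q - 1) * (b11 t * u1 s t + b12 t * u2 s t)
      + r powr q * (b11 t * (u11 s t * (1 / r)) + b12 t * (u12 s t * (1 / r)))"
    by (rule DERIV_imp_deriv)
  have "((\<lambda>\<tau>. r powr q * (b12 \<tau> * (u1 s \<tau> / r) + b22 \<tau> * (u2 s \<tau> / r))) has_real_derivative
     r powr q * ((d12 t * u1 s t + b12 t * u12 s t + d22 t * u2 s t + b22 t * u22 s t) / r)) (at t)"
    by (auto intro!: derivative_eq_intros d jet_partial2[OF j(2) s] jet_partial2[OF j(3) s]
        simp: r(1)[THEN less_imp_neq, THEN not_sym] add_divide_distrib algebra_simps)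
  moreover have "(\<lambda>\<tau>. F r \<tau> $ 2) = (\<lambda>\<tau>. r powr q * (b12 \<tau> * (u1 s \<tau> / r) + b22 \<tau> * (u2 s \<tau> / r)))"
    using r by (simp add: F fun_eq_iff)
  ultimately have D2: "deriv (\<lambda>\<tau>. F r \<tau> $ 2) t =
     r powr q * ((d12 t * u1 s t + b12 t * u12 s t + d22 t * u2 s t + b22 t * u22 s t) / r)"
    by (simp add: DERIV_imp_deriv)
  have "frame_div F r t = 0"
    using v r unfolding linearized_solution_def F_def[abs_def] by blast
  moreover have "frame_div F r t = r powr q / r / r * (b11 t * u11 s t + 2 * b12 t * u12 s t + b22 t * u22 s t
     + (q * b11 t + d12 t) * u1 s t + (q * b12 t + d22 t) * u2 s t)"
    unfolding frame_div_def D1 D2 using r by (simp add: powr_diff divide_simps) (simp add: algebra_simps)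
  ultimately show ?thesis using r by (simp add: q_def)
qed

end

section \<open>Conclusion on the disc\<close>

lemma shift_multiple:
  fixes f :: "real \<Rightarrow> 'a"
  assumes "\<And>t. f (t + c) = f t"
  shows "f (t + real n * c) = f t"
proof (induction n)
  case (Suc n)
  have "f (t + real (Suc n) * c) = f (t + real n * c + c)" by (simp add: algebra_simps)
  then show ?case using Suc assms by simp
qed simp

text \<open>The value at the origin is arbitrary; including it in the bound makes the estimate hold
  at every point of the disc.\<close>

lemma L_infinity_discI:
  fixes f :: "real ^ 2 \<Rightarrow> 'b::euclidean_space"
  assumes "continuous_on punctured_disc f" "\<And>x. x \<in> punctured_disc \<Longrightarrow> norm (f x) \<le> K"
  shows "f \<in> L_infinity disc"
proof -
  have "norm (f x) \<le> max K (norm (f 0))" if "x \<in> disc" for x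
    using assms(2)[of x] that by (cases "x = 0") (auto simp: punctured_disc_def le_max_iff_disj)
  then have "AE x in lebesgue_on disc. norm (f x) \<le> max K (norm (f 0))"
    by (intro AE_I2) (simp add: space_restrict_space)
  then show ?thesis using borel_measurable_disc[OF assms(1)] by (auto simp: L_infinity_def)
qed

theorem theorem1p2:
  fixes p \<beta> k \<alpha> :: real and N :: nat and a :: "real \<Rightarrow> real" and v :: "real ^ 2 \<Rightarrow> real"
  assumes "p > 2" and "N \<ge> 1"
    and "k = k_exponent p N"
    and "angular_profile p N a"
    and "\<alpha> = alpha_weight p k"
    and "\<alpha> - 1 < \<beta>" and "\<beta> < 2 * \<alpha> - 1"
    and "v \<in> Y1 N \<alpha> \<beta> \<inter> smooth_up_to punctured_disc ({x. norm x \<le> 1} - {0})"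
    and "linearized_solution p k a v"
  shows "v \<in> L_infinity disc \<and> (\<lambda>x. norm x *\<^sub>R grad v x) \<in> L_infinity disc"
proof -
  \<comment> \<open>The two bounds on \<beta> are compatible only when \<alpha> - 1 < 2\<alpha> -
    1.\<close>
  have \<alpha>: "\<alpha> > 0" using assms(6,7) by linarith
  have k: "k > 1"
    using \<alpha> assms(1) unfolding assms(5) alpha_weight_def by (simp add: zero_less_mult_iff)
  have "a (t + 2 * pi) = a t" for t
    using shift_multiple[of a "2 * pi / real N" t N] assms(2,4) by (simp add: angular_profile_def)
  then interpret profile p k a
    using assms(1-4) k by unfold_locales (auto simp: angular_profile_def)
  interpret cylinder_equation "alpha_weight p k" b11 b12 b22 d12 d22 \<psi>
    by (rule is_cylinder_equation)
  have v: "v \<in> smooth_up_to punctured_disc ({x. norm x \<le> 1} - {0})" using assms(8) by simp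
  then have smooth: "iter_partial is v differentiable (at x)" if "x \<in> punctured_disc" for "is" x
    using that by (auto simp: smooth_up_to_def smooth_on_def)
  have cont: "continuous_on punctured_disc (iter_partial is v)" for "is"
    using smooth by (auto intro!: continuous_at_imp_continuous_on differentiable_imp_continuous_within)
  note C = smooth_class_polar_class[OF v]
  define u where "u s t = v (polar (exp s) t)" for s t
  define u1 where "u1 s t = exp s * cos t * partial 1 v (polar (exp s) t)
      + exp s * sin t * partial 2 v (polar (exp s) t)" for s t
  define u2 where "u2 s t = - (exp s * sin t) * partial 1 v (polar (exp s) t)
      + exp s * cos t * partial 2 v (polar (exp s) t)" for s t
  have ju: "jet u u1 u2"
    unfolding u_def[abs_def] u1_def[abs_def] u2_def[abs_def]
    by (rule jet_polar) (use smooth[of _ "[]"] in simp)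
  have mem: "u \<in> polar_class v" "u1 \<in> polar_class v" "u2 \<in> polar_class v"
  proof -
    have P: "(\<lambda>s t. partial i v (polar (exp s) t)) \<in> polar_class v" for i
      using polar_class.base[of "[i]" v] by simp
    show "u \<in> polar_class v" using polar_class.base[of "[]" v] by (simp add: u_def[abs_def])
    show "u1 \<in> polar_class v" "u2 \<in> polar_class v"
      unfolding u1_def[abs_def] u2_def[abs_def]
      by (intro polar_class.add polar_class.mult polar_class_uminus polar_class.X polar_class.Y P)+
  qed
  obtain u11 u12 u22 where h: "u11 \<in> polar_class v" "u12 \<in> polar_class v" "u22 \<in> polar_class v"
      "jet2 u u1 u2 u11 u12 u22"
    using smooth_class_jet2[OF C mem(2,3) ju] by blast
  have sol: "solution u u1 u2 u11 u12 u22"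
    using h(4) linearized_solution_cylinder[OF assms(9) h(4)[unfolded u_def[abs_def]] b12_deriv b22_deriv]
      smooth_classD(2)[OF C mem(1)]
    by (simp add: solution_def L_def)
  obtain G where "(\<integral>\<^sup>+x\<in>disc. ennreal (\<bar>v x\<bar>\<^sup>2 * norm x powr (2 * \<beta>) +
        (norm (frame_components x (G x)))\<^sup>2 * norm x powr (2 * \<alpha>)) \<partial>lebesgue) < \<infinity>"
    using assms(8) by (auto simp: Y1_def)
  then obtain T where T: "\<And>S. S < -1 \<Longrightarrow>
    integral {S..S+1} (\<lambda>s. integral {0..2*pi} (\<lambda>t. (u s t)\<^sup>2)) \<le> T * exp (- 2 * (\<beta> + 1) * S)"
    using weighted_shell_bound[OF cont[of "[]", simplified],
        of "\<lambda>x. (norm (frame_components x (G x)))\<^sup>2 * norm x powr (2 * \<alpha>)" \<beta>] \<alpha> assms(6)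
    unfolding u_def by auto
  \<comment> \<open>The rate is \<gamma> = \<beta> + 1: the lower bound on \<beta> gives \<gamma> >
    \<alpha> > 0, the upper bound gives \<gamma> < 2\<alpha>.\<close>
  obtain K where K: "\<And>s t. s < 0 \<Longrightarrow> \<bar>u s t\<bar> \<le> K \<and> \<bar>u1 s t\<bar> \<le> K \<and> \<bar>u2 s t\<bar> \<le> K"
    using cylinder_bounds[OF C sol mem h(1-3) _ _ T] \<alpha> assms(5-7) by auto
  have "v \<in> L_infinity disc"
  proof (rule L_infinity_discI)
    show "continuous_on punctured_disc v" using cont[of "[]"] by simp
    show "norm (v x) \<le> K" if "x \<in> punctured_disc" for x
      by (rule punctured_disc_polar[OF that]) (use K in \<open>auto simp: u_def\<close>)
  qed
  moreover have "(\<lambda>x. norm x *\<^sub>R grad v x) \<in> L_infinity disc"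
  proof (rule L_infinity_discI)
    have "continuous_on punctured_disc (\<lambda>x. \<chi> i. partial i v x)"
      by (rule continuous_on_vec_lambda) (rule cont[of "[i]" for i, simplified])
    from continuous_on_scaleR[OF continuous_on_norm[OF continuous_on_id] this]
    show "continuous_on punctured_disc (\<lambda>x. norm x *\<^sub>R grad v x)"
      unfolding grad_def .
    fix x assume "x \<in> punctured_disc"
    then obtain s t where st: "s < 0" "x = polar (exp s) t" by (rule punctured_disc_polar)
    define g1 where "g1 = partial 1 v x"
    define g2 where "g2 = partial 2 v x"
    have "(norm (grad v x))\<^sup>2 = g1\<^sup>2 + g2\<^sup>2"
      unfolding power2_norm_eq_inner inner_vec_def
      by (simp add: sum_2 grad_def g1_def g2_def power2_eq_square)
    then have "(norm (norm x *\<^sub>R grad v x))\<^sup>2 = (exp s)\<^sup>2 * (g1\<^sup>2 + g2\<^sup>2)"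
      by (simp add: power_mult_distrib st(2))
    \<comment> \<open>Inserting sin^2 + cos^2 exposes the rotation: (u_s, u_t) is r times the
      gradient in the rotated frame, so the squared lengths agree.\<close>
    also have "\<dots> = (exp s)\<^sup>2 * (g1\<^sup>2 + g2\<^sup>2) * ((sin t)\<^sup>2 + (cos t)\<^sup>2)" by simp
    also have "\<dots> = (u1 s t)\<^sup>2 + (u2 s t)\<^sup>2"
      unfolding u1_def u2_def st(2)[symmetric] g1_def g2_def by algebra
    also have "\<dots> \<le> K\<^sup>2 + K\<^sup>2"
      using K[OF st(1), of t] by (intro add_mono abs_le_square_iff[THEN iffD1]) auto
    also have "\<dots> \<le> (2 * \<bar>K\<bar>)\<^sup>2" by (simp add: power_mult_distrib)
    finally show "norm (norm x *\<^sub>R grad v x) \<le> 2 * \<bar>K\<bar>"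
      by (rule power2_le_imp_le) simp
  qed
  ultimately show ?thesis by blast
qed

end
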